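(* There exists a deterministic algorithm that approximates the number of $2413$-copies in a permutation of length $n$ to within a multiplicative factor of $1+\varepsilon$, with running time $n\cdot\mathrm{poly}(\log n,1/\varepsilon)$.
   Context: A $2413$-copy in a permutation $\pi$ of length $n$ is a quadruple of indices $i_1<i_2<i_3<i_4$ such that $\pi(i_3)<\pi(i_1)<\pi(i_4)<\pi(i_2)$. Model: Word RAM. *)

theory Defs
  imports
    Complex_Main
    "HOL-Combinatorics.Permutations"
    "HOL-Computational_Algebra.Polynomial"
begin

section \<open>The Word RAM\<close>

text \<open>
  Words of \<open>w\<close> bits are the natural numbers below \<open>2 ^ w\<close>; the word size \<open>w\<close> is a run-time
  parameter of the machine, so that one and the same program can be run at every word size.
  A program names finitely many registers directly, and reaches the memory, whose \<open>2 ^ w\<close> cells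
  hold one word each, by indirect addressing through a register. Each instruction costs one
  unit of time.
\<close>

datatype operation = Add | Sub | Mul | Div | Mod | And | Or | Xor | Shl | Shr

fun alu :: "nat \<Rightarrow> operation \<Rightarrow> nat \<Rightarrow> nat \<Rightarrow> nat" where
  "alu w Add x y = take_bit w (x + y)"
| "alu w Sub x y = take_bit w (2 ^ w + x - y)"
| "alu w Mul x y = take_bit w (x * y)"
| "alu w Div x y = x div y"
| "alu w Mod x y = x mod y"
| "alu w And x y = and x y"
| "alu w Or x y = or x y"
| "alu w Xor x y = xor x y"
| "alu w Shl x y = take_bit w (push_bit y x)"
| "alu w Shr x y = drop_bit y x"

datatype instr =
    Const nat nat                \<comment> \<open>\<open>Const r k\<close>: \<open>r := k mod 2 ^ w\<close>\<close>
  | Op operation nat nat nat     \<comment> \<open>\<open>Op f r x y\<close>: \<open>r := x f y\<close>\<close>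
  | Load nat nat                 \<comment> \<open>\<open>Load r x\<close>: \<open>r := mem[x]\<close>\<close>
  | Store nat nat                \<comment> \<open>\<open>Store x y\<close>: \<open>mem[x] := y\<close>\<close>
  | Jump nat
  | JumpEq nat nat nat           \<comment> \<open>\<open>JumpEq x y l\<close>: if \<open>x = y\<close> go to \<open>l\<close>\<close>
  | JumpLess nat nat nat

type_synonym program = "instr list"

record config =
  pc :: nat
  reg :: "nat \<Rightarrow> nat"
  mem :: "nat \<Rightarrow> nat"

fun exec :: "nat \<Rightarrow> instr \<Rightarrow> config \<Rightarrow> config" where
  "exec w (Const r k) s = s\<lparr>pc := Suc (pc s), reg := (reg s)(r := take_bit w k)\<rparr>"
| "exec w (Op f r x y) s =
     s\<lparr>pc := Suc (pc s), reg := (reg s)(r := alu w f (reg s x) (reg s y))\<rparr>"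
| "exec w (Load r x) s = s\<lparr>pc := Suc (pc s), reg := (reg s)(r := mem s (reg s x))\<rparr>"
| "exec w (Store x y) s = s\<lparr>pc := Suc (pc s), mem := (mem s)(reg s x := reg s y)\<rparr>"
| "exec w (Jump l) s = s\<lparr>pc := l\<rparr>"
| "exec w (JumpEq x y l) s = s\<lparr>pc := (if reg s x = reg s y then l else Suc (pc s))\<rparr>"
| "exec w (JumpLess x y l) s = s\<lparr>pc := (if reg s x < reg s y then l else Suc (pc s))\<rparr>"

text \<open>The machine halts when control leaves the program.\<close>

definition halted :: "program \<Rightarrow> config \<Rightarrow> bool" where
  "halted P s \<longleftrightarrow> length P \<le> pc s"

definition step :: "nat \<Rightarrow> program \<Rightarrow> config \<Rightarrow> config" where
  "step w P s = (if halted P s then s else exec w (P ! pc s) s)"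

text \<open>The program \<open>P\<close>, started in \<open>s\<close>, halts after at most \<open>t\<close> steps with output \<open>v\<close> in register 0.\<close>

definition outputs_within :: "nat \<Rightarrow> program \<Rightarrow> config \<Rightarrow> nat \<Rightarrow> nat \<Rightarrow> bool" where
  "outputs_within w P s t v \<longleftrightarrow>
     halted P ((step w P ^^ t) s) \<and> reg ((step w P ^^ t) s) 0 = v"

section \<open>Counting 2413-copies\<close>

definition copies_2413 :: "nat \<Rightarrow> (nat \<Rightarrow> nat) \<Rightarrow> (nat \<times> nat \<times> nat \<times> nat) set" where
  "copies_2413 n \<pi> = {(i1, i2, i3, i4).
     {i1, i2, i3, i4} \<subseteq> {1..n} \<and> i1 < i2 \<and> i2 < i3 \<and> i3 < i4 \<and>
     \<pi> i3 < \<pi> i1 \<and> \<pi> i1 < \<pi> i4 \<and> \<pi> i4 < \<pi> i2}"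

text \<open>
  The input is the length \<open>n\<close>, the accuracy \<open>\<epsilon> = a / b\<close> as a pair of words, and the values
  \<open>\<pi> 1, \<dots>, \<pi> n\<close> in the memory cells \<open>1, \<dots>, n\<close>. All other registers and cells are zero.
\<close>

definition input_config :: "nat \<Rightarrow> (nat \<Rightarrow> nat) \<Rightarrow> nat \<Rightarrow> nat \<Rightarrow> config" where
  "input_config n \<pi> a b =
     \<lparr>pc = 0, reg = (\<lambda>_. 0)(0 := n, 1 := a, 2 := b), mem = (\<lambda>i. if i \<in> {1..n} then \<pi> i else 0)\<rparr>"

definition approximates_within_factor :: "real \<Rightarrow> real \<Rightarrow> real \<Rightarrow> bool" where
  "approximates_within_factor \<alpha> v x \<longleftrightarrow> v \<le> \<alpha> * x \<and> x \<le> \<alpha> * v"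

end

theory Submission
  imports Defs
begin

text \<open>
  Write a copy as points \<open>2, 4, 1, 3\<close> from left to right. Their coordinates are compared by three
  inequalities in \<open>x\<close> (pairs \<open>24, 41, 13\<close>) and three in \<open>y\<close> (pairs \<open>12, 23, 34\<close>), one for each pair of
  points. Classify the copies by the dyadic level \<open>d\<close> at which the leftmost and the rightmost point
  part: the vertical line in the middle of their common dyadic interval satisfies one of the
  comparisons in \<open>x\<close> for free, so two of the four points are no longer compared with each other. Once
  the other two points \<open>p\<close> (the pivot) and \<open>v\<close> are fixed, these two are counted independently of each
  other: the copies are a sum over \<open>p\<close>, \<open>d\<close> and \<open>v\<close> of products \<open>F (x v) * G (y v)\<close>, where \<open>F\<close> and \<open>G\<close>
  count points in rectangles and are monotone. Rounding \<open>F\<close> and \<open>G\<close> down to a geometric sequence with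
  ratio about \<open>1 + 1 / K\<close> turns the sum over \<open>v\<close> into polylogarithmically many rectangle counts, whose
  sides are found by binary search. Rectangle counts are read from a table of the points in all
  dyadic boxes; the table is indexed by a quadratic range of addresses, which costs nothing because
  the memory is initially zero.
\<close>

section \<open>A small language and its compiler\<close>

text \<open>The pivot is always extreme in \<open>x\<close>, because an extreme point and the level
  determine the dyadic interval and hence the middle line. The roles are chosen so that
  \<open>v\<close> is compared with one of the two remaining points in \<open>x\<close> only and
  with the other in \<open>y\<close> only; this is why one factor depends on \<open>x v\<close> and
  the other on \<open>y v\<close>. Summing these products over all pairs of \<open>p\<close> and
  \<open>v\<close> would still take quadratic time. After rounding, each factor is a combination of
  indicators of half-lines, so the sum over \<open>v\<close> becomes a box count for each pair of
  thresholds. Two roundings cost a factor \<open>(1 + 1 / K) ^ 2 \<le> 1 + 3 / K\<close>, hence the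
  3 in \<open>K\<close>. Rounding goes down, so the result never exceeds the true count and fits
  into a word; weighted sums may therefore be computed modulo \<open>2 ^ w\<close>. The language has
  no conditional: choices are made by multiplying with bits, so costs depend on loop counts
  alone.\<close>

text \<open>
  Expressions are evaluated stack-wise: an expression at level \<open>r\<close> may read the registers below \<open>r\<close>,
  leaves its value in register \<open>r\<close> and uses the registers above as scratch space. The second operand
  of a binary operation is at level \<open>r + 1\<close>, as is the body of \<open>Let\<close>, which finds the bound value in
  register \<open>r\<close>. \<open>Loop i a b\<close> runs \<open>b\<close>, at level \<open>r + 2\<close>, as often as register \<open>i\<close> says, with the
  accumulator in register \<open>r\<close>, initially \<open>a\<close>, and the round number in register \<open>r + 1\<close>.
\<close>

datatype exp =
    V nat | N nat | B operation exp exp | Lt exp exp | Ld exp | Let exp exp | Loop nat exp exp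

datatype com = Put exp exp | For nat com

primrec eval :: "nat \<Rightarrow> (nat \<Rightarrow> nat) \<Rightarrow> exp \<Rightarrow> nat \<Rightarrow> (nat \<Rightarrow> nat) \<Rightarrow> nat" where
  "eval w \<mu> (V i) r \<rho> = \<rho> i"
| "eval w \<mu> (N k) r \<rho> = take_bit w k"
| "eval w \<mu> (B f a b) r \<rho> =
     alu w f (eval w \<mu> a r \<rho>) (eval w \<mu> b (Suc r) (\<rho>(r := eval w \<mu> a r \<rho>)))"
| "eval w \<mu> (Lt a b) r \<rho> =
     of_bool (eval w \<mu> a r \<rho> < eval w \<mu> b (Suc r) (\<rho>(r := eval w \<mu> a r \<rho>)))"
| "eval w \<mu> (Ld a) r \<rho> = \<mu> (eval w \<mu> a r \<rho>)"
| "eval w \<mu> (Let a b) r \<rho> = eval w \<mu> b (Suc r) (\<rho>(r := eval w \<mu> a r \<rho>))"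
| "eval w \<mu> (Loop i a b) r \<rho> =
     rec_nat (eval w \<mu> a r \<rho>) (\<lambda>k x. eval w \<mu> b (r + 2) (\<rho>(r := x, Suc r := k))) (\<rho> i)"

primrec run :: "nat \<Rightarrow> com \<Rightarrow> nat \<Rightarrow> (nat \<Rightarrow> nat) \<Rightarrow> (nat \<Rightarrow> nat) \<Rightarrow> nat \<Rightarrow> nat" where
  "run w (Put a b) r \<rho> \<mu> =
     \<mu>(eval w \<mu> a r \<rho> := eval w \<mu> b (Suc r) (\<rho>(r := eval w \<mu> a r \<rho>)))"
| "run w (For i c) r \<rho> \<mu> = rec_nat \<mu> (\<lambda>k. run w c (Suc r) (\<rho>(r := k))) (\<rho> i)"

primrec wf_exp :: "nat \<Rightarrow> exp \<Rightarrow> nat \<Rightarrow> bool" where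
  "wf_exp r\<^sub>0 (V i) r = (i < r)"
| "wf_exp r\<^sub>0 (N k) r = True"
| "wf_exp r\<^sub>0 (B f a b) r = (wf_exp r\<^sub>0 a r \<and> wf_exp r\<^sub>0 b (Suc r))"
| "wf_exp r\<^sub>0 (Lt a b) r = (wf_exp r\<^sub>0 a r \<and> wf_exp r\<^sub>0 b (Suc r))"
| "wf_exp r\<^sub>0 (Ld a) r = wf_exp r\<^sub>0 a r"
| "wf_exp r\<^sub>0 (Let a b) r = (wf_exp r\<^sub>0 a r \<and> wf_exp r\<^sub>0 b (Suc r))"
| "wf_exp r\<^sub>0 (Loop i a b) r = (i < r\<^sub>0 \<and> wf_exp r\<^sub>0 a r \<and> wf_exp r\<^sub>0 b (r + 2))"

primrec wf_com :: "nat \<Rightarrow> com \<Rightarrow> nat \<Rightarrow> bool" where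
  "wf_com r\<^sub>0 (Put a b) r = (wf_exp r\<^sub>0 a r \<and> wf_exp r\<^sub>0 b (Suc r))"
| "wf_com r\<^sub>0 (For i c) r = (i < r\<^sub>0 \<and> wf_com r\<^sub>0 c (Suc r))"

text \<open>
  The cost reads the loop counts from the fixed assignment \<open>g\<close>; loops may only count up to registers
  below \<open>r\<^sub>0\<close>, whose contents do not change, so the cost does not depend on the evaluation.
\<close>

primrec cost :: "(nat \<Rightarrow> nat) \<Rightarrow> exp \<Rightarrow> nat" where
  "cost g (V i) = 1"
| "cost g (N k) = 1"
| "cost g (B f a b) = cost g a + cost g b + 1"
| "cost g (Lt a b) = cost g a + cost g b + 3"
| "cost g (Ld a) = cost g a + 1"
| "cost g (Let a b) = cost g a + cost g b + 1"
| "cost g (Loop i a b) = cost g a + 1 + g i * (cost g b + 5) + 2"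

primrec cost_com :: "(nat \<Rightarrow> nat) \<Rightarrow> com \<Rightarrow> nat" where
  "cost_com g (Put a b) = cost g a + cost g b + 1"
| "cost_com g (For i c) = 1 + g i * (cost_com g c + 4) + 2"

primrec compile :: "exp \<Rightarrow> nat \<Rightarrow> nat \<Rightarrow> instr list" where
  "compile (V i) l r = [Op Or r i i]"
| "compile (N k) l r = [Const r k]"
| "compile (B f a b) l r =
     (let A = compile a l r; C = compile b (l + length A) (Suc r)
      in A @ C @ [Op f r r (Suc r)])"
| "compile (Lt a b) l r =
     (let A = compile a l r; C = compile b (l + length A) (Suc r); q = l + length A + length C
      in A @ C @ [JumpLess r (Suc r) (q + 3), Const r 0, Jump (q + 4), Const r 1])"
| "compile (Ld a) l r = compile a l r @ [Load r r]"
| "compile (Let a b) l r =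
     (let A = compile a l r; C = compile b (l + length A) (Suc r)
      in A @ C @ [Op Or r (Suc r) (Suc r)])"
| "compile (Loop i a b) l r =
     (let A = compile a l r; q = l + length A; C = compile b (q + 3) (r + 2)
      in A @ [Const (Suc r) 0, JumpLess (Suc r) i (q + 3), Jump (q + 7 + length C)] @ C @
         [Op Or r (r + 2) (r + 2), Const (r + 2) 1, Op Add (Suc r) (Suc r) (r + 2), Jump (Suc q)])"

primrec compile_com :: "com \<Rightarrow> nat \<Rightarrow> nat \<Rightarrow> instr list" where
  "compile_com (Put a b) l r =
     (let A = compile a l r; C = compile b (l + length A) (Suc r) in A @ C @ [Store r (Suc r)])"
| "compile_com (For i c) l r =
     (let C = compile_com c (l + 3) (Suc r)
      in [Const r 0, JumpLess r i (l + 3), Jump (l + 6 + length C)] @ C @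
         [Const (Suc r) 1, Op Add r r (Suc r), Jump (Suc l)])"

section \<open>Correctness and running time of compiled code\<close>

definition code_at :: "program \<Rightarrow> nat \<Rightarrow> instr list \<Rightarrow> bool" where
  "code_at P l c \<longleftrightarrow> (\<exists>A C. P = A @ c @ C \<and> length A = l)"

lemma code_at_append: "code_at P l (c @ d) \<Longrightarrow> code_at P l c \<and> code_at P (l + length c) d"
  unfolding code_at_def by (metis append.assoc length_append)

lemma code_at_Cons:
  "code_at P l (i # c) \<Longrightarrow> l < length P \<and> P ! l = i \<and> code_at P (Suc l) c"
proof -
  assume "code_at P l (i # c)"
  then obtain A C where *: "P = A @ (i # c) @ C" "length A = l" unfolding code_at_def by blast
  then have "P = (A @ [i]) @ c @ C" "length (A @ [i]) = Suc l" by simp_all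
  then have "code_at P (Suc l) c" unfolding code_at_def by blast
  with * show ?thesis by (simp add: nth_append)
qed

text \<open>Registers from \<open>r\<close> on are scratch space and left unconstrained, so lowering
  \<open>r\<close> simply forgets a consumed operand.\<close>

definition holds :: "nat \<Rightarrow> (nat \<Rightarrow> nat) \<Rightarrow> nat \<Rightarrow> (nat \<Rightarrow> nat) \<Rightarrow> config \<Rightarrow> bool" where
  "holds l \<mu> r \<rho> s \<longleftrightarrow> pc s = l \<and> mem s = \<mu> \<and> (\<forall>i<r. reg s i = \<rho> i)"

text \<open>A Hoare triple with a step bound. The number of steps is bounded by \<open>t\<close> and
  not fixed, so that branches of unequal length share one cost.\<close>

definition goes where
  "goes w P t l \<mu> r \<rho> l' \<mu>' r' \<rho>' \<longleftrightarrow>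
     (\<forall>s. holds l \<mu> r \<rho> s \<longrightarrow> (\<exists>k\<le>t. holds l' \<mu>' r' \<rho>' ((step w P ^^ k) s)))"

lemma goes_trans:
  assumes "goes w P t l \<mu> r \<rho> l' \<mu>' r' \<rho>'" "goes w P t' l' \<mu>' r' \<rho>' l'' \<mu>'' r'' \<rho>''"
  shows "goes w P (t + t') l \<mu> r \<rho> l'' \<mu>'' r'' \<rho>''"
  unfolding goes_def
proof (intro allI impI)
  fix s assume "holds l \<mu> r \<rho> s"
  then obtain k where k: "k \<le> t" "holds l' \<mu>' r' \<rho>' ((step w P ^^ k) s)"
    using assms(1) unfolding goes_def by blast
  then obtain k' where "k' \<le> t'" "holds l'' \<mu>'' r'' \<rho>'' ((step w P ^^ k') ((step w P ^^ k) s))"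
    using assms(2) unfolding goes_def by blast
  with k show "\<exists>k\<le>t + t'. holds l'' \<mu>'' r'' \<rho>'' ((step w P ^^ k) s)"
    by (intro exI[of _ "k' + k"]) (simp add: funpow_add)
qed

lemma goes_mono: "goes w P t l \<mu> r \<rho> l' \<mu>' r' \<rho>' \<Longrightarrow> t \<le> t' \<Longrightarrow> goes w P t' l \<mu> r \<rho> l' \<mu>' r' \<rho>'"
  unfolding goes_def by (meson le_trans)

lemma goes_instr:
  assumes "code_at P l (i # c)" "\<And>s. holds l \<mu> r \<rho> s \<Longrightarrow> holds l' \<mu>' r' \<rho>' (exec w i s)"
  shows "goes w P 1 l \<mu> r \<rho> l' \<mu>' r' \<rho>'"
  unfolding goes_def
proof (intro allI impI)
  fix s assume a: "holds l \<mu> r \<rho> s"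
  then have "step w P s = exec w i s"
    using code_at_Cons[OF assms(1)] by (simp add: step_def halted_def holds_def)
  with assms(2)[OF a] show "\<exists>k\<le>1. holds l' \<mu>' r' \<rho>' ((step w P ^^ k) s)"
    by (intro exI[of _ 1]) simp
qed

lemma alu_less: "x < 2 ^ w \<Longrightarrow> y < 2 ^ w \<Longrightarrow> alu w f x y < 2 ^ w"
proof (cases f)
  assume *: "x < 2 ^ w" "y < 2 ^ w"
  have t: "take_bit w x = x" "take_bit w y = y" using * by (simp_all add: take_bit_nat_eq_self)
  { case And then show ?thesis using t by (metis alu.simps(6) take_bit_and take_bit_nat_less_exp) }
  { case Or then show ?thesis using t by (metis alu.simps(7) take_bit_or take_bit_nat_less_exp) }
  { case Xor then show ?thesis using t by (metis alu.simps(8) take_bit_xor take_bit_nat_less_exp) }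
  { case Div then show ?thesis using * by (simp add: order_le_less_trans[OF div_le_dividend]) }
  { case Mod then show ?thesis using * by (simp add: order_le_less_trans[OF mod_less_eq_dividend]) }
  { case Shr then show ?thesis using *
      by (simp add: drop_bit_eq_div order_le_less_trans[OF div_le_dividend]) }
qed (simp_all add: take_bit_nat_less_exp)

text \<open>Keeps every register a word. The compiler proof needs this for loop counts, since the
  machine advances a counter by \<open>Add\<close>, which agrees with \<open>Suc\<close> only below
  \<open>2 ^ w\<close>.\<close>

lemma eval_less:
  assumes "0 < w" "\<forall>A. \<mu> A < 2 ^ w"
  shows "wf_exp r\<^sub>0 e r \<Longrightarrow> r\<^sub>0 \<le> r \<Longrightarrow> \<forall>i<r. \<rho> i < 2 ^ w \<Longrightarrow> eval w \<mu> e r \<rho> < 2 ^ w"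
proof (induction e arbitrary: r \<rho>)
  case (B f a b)
  then show ?case by (auto intro!: alu_less simp: less_Suc_eq)
next
  case (Lt a b)
  have "1 < (2::nat) ^ w" using assms(1) by (intro one_less_power) auto
  then show ?case by (simp add: of_bool_def)
next
  case (Let a b)
  then show ?case by (auto simp: less_Suc_eq)
next
  case (Loop i a b)
  have "\<rho> i < 2 ^ w" using Loop by auto
  have "k \<le> \<rho> i \<Longrightarrow> rec_nat (eval w \<mu> a r \<rho>) (\<lambda>k x. eval w \<mu> b (r + 2) (\<rho>(r := x, Suc r := k))) k < 2 ^ w" for k
  proof (induction k)
    case 0 then show ?case using Loop by simp
  next
    case (Suc k)
    then have "k < 2 ^ w" using \<open>\<rho> i < 2 ^ w\<close> by linarith
    with Suc show ?case using Loop.prems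
      by (auto simp: less_Suc_eq intro!: Loop.IH(2))
  qed
  then show ?case by simp
qed (use assms in \<open>auto simp: take_bit_nat_less_exp\<close>)

text \<open>Induction on \<open>e\<close>. All writes go to registers from \<open>r\<close> on, and
  \<open>r\<^sub>0 \<le> r\<close>, so the loop counts below \<open>r\<^sub>0\<close> keep the
  values recorded by \<open>g\<close>; hence one cost bound serves every round of a loop.\<close>

lemma goes_compile:
  assumes w: "0 < w" and \<mu>: "\<forall>A. \<mu> A < 2 ^ w"
  shows "code_at P l (compile e l r) \<Longrightarrow> wf_exp r\<^sub>0 e r \<Longrightarrow> r\<^sub>0 \<le> r \<Longrightarrow> \<forall>i<r. \<rho> i < 2 ^ w \<Longrightarrow>
    \<forall>i<r\<^sub>0. \<rho> i = g i \<Longrightarrow>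
    goes w P (cost g e) l \<mu> r \<rho> (l + length (compile e l r)) \<mu> (Suc r) (\<rho>(r := eval w \<mu> e r \<rho>))"
proof (induction e arbitrary: l r \<rho>)
  case (V i)
  have "goes w P 1 l \<mu> r \<rho> (l + 1) \<mu> (Suc r) (\<rho>(r := \<rho> i))"
    by (rule goes_instr) (use V.prems in \<open>auto simp: holds_def less_Suc_eq\<close>)
  then show ?case by (simp del: fun_upd_apply)
next
  case (N k)
  have "goes w P 1 l \<mu> r \<rho> (l + 1) \<mu> (Suc r) (\<rho>(r := take_bit w k))"
    by (rule goes_instr) (use N.prems in \<open>auto simp: holds_def less_Suc_eq\<close>)
  then show ?case by (simp del: fun_upd_apply)
next
  case (B f a b)
  define A where "A = compile a l r"
  define C where "C = compile b (l + length A) (Suc r)"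
  define va where "va = eval w \<mu> a r \<rho>"
  define vb where "vb = eval w \<mu> b (Suc r) (\<rho>(r := va))"
  have c: "code_at P l A" "code_at P (l + length A) C"
      "code_at P (l + length A + length C) [Op f r r (Suc r)]"
    using B.prems(1) by (auto simp: A_def C_def Let_def dest!: code_at_append)
  have va: "va < 2 ^ w" unfolding va_def using B.prems eval_less[OF w \<mu>] by auto
  have 1: "goes w P (cost g a) l \<mu> r \<rho> (l + length A) \<mu> (Suc r) (\<rho>(r := va))"
    unfolding A_def va_def by (rule B.IH(1)) (use c B.prems in \<open>auto simp: A_def\<close>)
  have 2: "goes w P (cost g b) (l + length A) \<mu> (Suc r) (\<rho>(r := va)) (l + length A + length C) \<mu>
      (Suc (Suc r)) (\<rho>(r := va, Suc r := vb))"
    unfolding C_def vb_def by (rule B.IH(2)) (use c va B.prems in \<open>auto simp: C_def less_Suc_eq\<close>)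
  have 3: "goes w P 1 (l + length A + length C) \<mu> (Suc (Suc r)) (\<rho>(r := va, Suc r := vb))
      (l + length A + length C + 1) \<mu> (Suc r) (\<rho>(r := alu w f va vb))"
    by (rule goes_instr[OF c(3)]) (auto simp: holds_def less_Suc_eq)
  show ?case
    using goes_trans[OF goes_trans[OF 1 2] 3] by (simp add: Let_def A_def C_def va_def vb_def add.assoc del: fun_upd_apply)
next
  case (Lt a b)
  define A where "A = compile a l r"
  define C where "C = compile b (l + length A) (Suc r)"
  define q where "q = l + length A + length C"
  define va where "va = eval w \<mu> a r \<rho>"
  define vb where "vb = eval w \<mu> b (Suc r) (\<rho>(r := va))"
  have c: "code_at P l A" "code_at P (l + length A) C"
      "code_at P q [JumpLess r (Suc r) (q + 3), Const r 0, Jump (q + 4), Const r 1]"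
    using Lt.prems(1) by (auto simp: A_def C_def q_def Let_def dest!: code_at_append)
  have c': "code_at P (Suc q) [Const r 0, Jump (q + 4), Const r 1]"
      "code_at P (Suc (Suc q)) [Jump (q + 4), Const r 1]" "code_at P (Suc (Suc (Suc q))) [Const r 1]"
    using c(3) by (auto dest!: code_at_Cons)
  have va: "va < 2 ^ w" unfolding va_def using Lt.prems eval_less[OF w \<mu>] by auto
  have 1: "goes w P (cost g a) l \<mu> r \<rho> (l + length A) \<mu> (Suc r) (\<rho>(r := va))"
    unfolding A_def va_def by (rule Lt.IH(1)) (use c Lt.prems in \<open>auto simp: A_def\<close>)
  have 2: "goes w P (cost g b) (l + length A) \<mu> (Suc r) (\<rho>(r := va)) q \<mu>
      (Suc (Suc r)) (\<rho>(r := va, Suc r := vb))"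
    unfolding C_def vb_def q_def by (rule Lt.IH(2)) (use c va Lt.prems in \<open>auto simp: C_def less_Suc_eq\<close>)
  \<comment> \<open>The false branch takes three steps, the true branch two; 3 bounds both.\<close>
  have 3: "goes w P 3 q \<mu> (Suc (Suc r)) (\<rho>(r := va, Suc r := vb)) (q + 4) \<mu> (Suc r) (\<rho>(r := of_bool (va < vb)))"
  proof (cases "va < vb")
    case True
    have 4: "goes w P 1 q \<mu> (Suc (Suc r)) (\<rho>(r := va, Suc r := vb)) (q + 3) \<mu> (Suc r) (\<rho>(r := va))"
      by (rule goes_instr[OF c(3)]) (use True in \<open>auto simp: holds_def less_Suc_eq\<close>)
    have 5: "goes w P 1 (q + 3) \<mu> (Suc r) (\<rho>(r := va)) (q + 4) \<mu> (Suc r) (\<rho>(r := 1))"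
      by (rule goes_instr[of _ _ "Const r 1" "[]"])
        (use c'(3) w in \<open>auto simp: holds_def less_Suc_eq numeral_eq_Suc\<close>)
    show ?thesis using goes_mono[OF goes_trans[OF 4 5], of 3] True by simp
  next
    case False
    have 4: "goes w P 1 q \<mu> (Suc (Suc r)) (\<rho>(r := va, Suc r := vb)) (Suc q) \<mu> (Suc r) (\<rho>(r := va))"
      by (rule goes_instr[OF c(3)]) (use False in \<open>auto simp: holds_def less_Suc_eq\<close>)
    have 5: "goes w P 1 (Suc q) \<mu> (Suc r) (\<rho>(r := va)) (Suc (Suc q)) \<mu> (Suc r) (\<rho>(r := 0))"
      by (rule goes_instr[OF c'(1)]) (auto simp: holds_def less_Suc_eq)
    have 6: "goes w P 1 (Suc (Suc q)) \<mu> (Suc r) (\<rho>(r := 0)) (q + 4) \<mu> (Suc r) (\<rho>(r := 0))"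
      by (rule goes_instr[OF c'(2)]) (auto simp: holds_def less_Suc_eq)
    show ?thesis using goes_trans[OF 4 goes_trans[OF 5 6]] False by (simp add: numeral_eq_Suc)
  qed
  have "eval w \<mu> (Lt a b) r \<rho> = of_bool (va < vb)"
      "l + length (compile (Lt a b) l r) = q + 4"
    by (simp_all add: Let_def va_def vb_def q_def A_def C_def)
  then show ?case
    using goes_trans[OF goes_trans[OF 1 2] 3] by (simp only: cost.simps add.assoc)
next
  case (Ld a)
  have c: "code_at P l (compile a l r)" "code_at P (l + length (compile a l r)) [Load r r]"
    using Ld.prems(1) by (auto dest!: code_at_append)
  have "goes w P (cost g a) l \<mu> r \<rho> (l + length (compile a l r)) \<mu> (Suc r) (\<rho>(r := eval w \<mu> a r \<rho>))"
    by (rule Ld.IH) (use c Ld.prems in auto)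
  from goes_trans[OF this goes_instr[OF c(2)]] show ?case
    by (auto simp: holds_def less_Suc_eq)
next
  case (Let a b)
  define A where "A = compile a l r"
  define C where "C = compile b (l + length A) (Suc r)"
  define va where "va = eval w \<mu> a r \<rho>"
  define vb where "vb = eval w \<mu> b (Suc r) (\<rho>(r := va))"
  have c: "code_at P l A" "code_at P (l + length A) C"
      "code_at P (l + length A + length C) [Op Or r (Suc r) (Suc r)]"
    using Let.prems(1) by (auto simp: A_def C_def Let_def dest!: code_at_append)
  have va: "va < 2 ^ w" unfolding va_def using Let.prems eval_less[OF w \<mu>] by auto
  have 1: "goes w P (cost g a) l \<mu> r \<rho> (l + length A) \<mu> (Suc r) (\<rho>(r := va))"
    unfolding A_def va_def by (rule Let.IH(1)) (use c Let.prems in \<open>auto simp: A_def\<close>)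
  have 2: "goes w P (cost g b) (l + length A) \<mu> (Suc r) (\<rho>(r := va)) (l + length A + length C) \<mu>
      (Suc (Suc r)) (\<rho>(r := va, Suc r := vb))"
    unfolding C_def vb_def by (rule Let.IH(2)) (use c va Let.prems in \<open>auto simp: C_def less_Suc_eq\<close>)
  have 3: "goes w P 1 (l + length A + length C) \<mu> (Suc (Suc r)) (\<rho>(r := va, Suc r := vb))
      (l + length A + length C + 1) \<mu> (Suc r) (\<rho>(r := vb))"
    by (rule goes_instr[OF c(3)]) (auto simp: holds_def less_Suc_eq)
  show ?case
    using goes_trans[OF goes_trans[OF 1 2] 3] by (simp add: Let_def A_def C_def va_def vb_def add.assoc del: fun_upd_apply)
next
  case (Loop i a b)
  define A where "A = compile a l r"
  define q where "q = l + length A"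
  define C where "C = compile b (q + 3) (r + 2)"
  define acc where "acc k = rec_nat (eval w \<mu> a r \<rho>) (\<lambda>k x. eval w \<mu> b (r + 2) (\<rho>(r := x, Suc r := k))) k" for k
  define \<sigma> where "\<sigma> k = \<rho>(r := acc k, Suc r := k)" for k
  have acc_Suc: "acc (Suc k) = eval w \<mu> b (r + 2) (\<sigma> k)" for k
    by (simp add: acc_def \<sigma>_def)
  have acc_0: "acc 0 = eval w \<mu> a r \<rho>" by (simp add: acc_def)
  have i: "i < r" "\<rho> i = g i" using Loop.prems by auto
  then have i': "\<rho> i < 2 ^ w" using Loop.prems(4) by blast
  note i = i i'
  let ?I = "[Const (Suc r) 0, JumpLess (Suc r) i (q + 3), Jump (q + 7 + length C)]"
  let ?J = "[Op Or r (r + 2) (r + 2), Const (r + 2) 1, Op Add (Suc r) (Suc r) (r + 2), Jump (Suc q)]"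
  have c: "code_at P l A"
    "code_at P q [Const (Suc r) 0, JumpLess (Suc r) i (q + 3), Jump (q + 7 + length C)]"
    "code_at P (q + 3) C"
    "code_at P (q + 3 + length C) [Op Or r (r + 2) (r + 2), Const (r + 2) 1, Op Add (Suc r) (Suc r) (r + 2), Jump (Suc q)]"
  proof -
    have "code_at P l (A @ ?I @ C @ ?J)"
      using Loop.prems(1) by (simp add: A_def C_def q_def Let_def)
    then have *: "code_at P l A" "code_at P q (?I @ C @ ?J)"
      using code_at_append unfolding q_def by blast+
    have "code_at P (q + length ?I) (C @ ?J)" "code_at P q ?I" using code_at_append[OF *(2)] by blast+
    then have "code_at P (q + 3) (C @ ?J)" by (simp add: numeral_3_eq_3)
    then show "code_at P l A" "code_at P q ?I" "code_at P (q + 3) C" "code_at P (q + 3 + length C) ?J"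
      using * \<open>code_at P q ?I\<close> code_at_append by blast+
  qed
  have c': "code_at P (q + 1) [JumpLess (Suc r) i (q + 3), Jump (q + 7 + length C)]"
      "code_at P (q + 2) [Jump (q + 7 + length C)]"
      "code_at P (q + 4 + length C) [Const (r + 2) 1, Op Add (Suc r) (Suc r) (r + 2), Jump (Suc q)]"
      "code_at P (q + 5 + length C) [Op Add (Suc r) (Suc r) (r + 2), Jump (Suc q)]"
      "code_at P (q + 6 + length C) [Jump (Suc q)]"
    using c(2,4) by (auto simp: numeral_eq_Suc dest!: code_at_Cons)
  have acc: "acc k < 2 ^ w" if "k \<le> \<rho> i" for k
    using that
  proof (induction k)
    case 0 then show ?case using Loop.prems eval_less[OF w \<mu>] by (auto simp: acc_def)
  next
    case (Suc k)
    then show ?case using Loop.prems i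
      by (auto simp: acc_Suc \<sigma>_def less_Suc_eq intro!: eval_less[OF w \<mu>])
  qed
  have 1: "goes w P (cost g a) l \<mu> r \<rho> q \<mu> (Suc r) (\<rho>(r := acc 0))"
    unfolding acc_0 A_def q_def
    by (rule Loop.IH(1)) (use c(1) Loop.prems in \<open>auto simp: A_def\<close>)
  have 2: "goes w P 1 q \<mu> (Suc r) (\<rho>(r := acc 0)) (q + 1) \<mu> (r + 2) (\<sigma> 0)"
    by (rule goes_instr[OF c(2)]) (auto simp: holds_def less_Suc_eq \<sigma>_def)
  \<comment> \<open>One round consists of the test, the body and four closing instructions that
    store the result, advance the counter and jump back.\<close>
  have 3: "goes w P (k * (cost g b + 5)) (q + 1) \<mu> (r + 2) (\<sigma> 0) (q + 1) \<mu> (r + 2) (\<sigma> k)"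
    if "k \<le> \<rho> i" for k
    using that
  proof (induction k)
    case 0 show ?case by (auto simp: goes_def)
  next
    case (Suc k)
    have k: "k < \<rho> i" "Suc k < 2 ^ w" using Suc i by auto
    have 4: "goes w P 1 (q + 1) \<mu> (r + 2) (\<sigma> k) (q + 3) \<mu> (r + 2) (\<sigma> k)"
      by (rule goes_instr[OF c'(1)]) (use k i in \<open>auto simp: holds_def less_Suc_eq \<sigma>_def\<close>)
    have 5: "goes w P (cost g b) (q + 3) \<mu> (r + 2) (\<sigma> k) (q + 3 + length C) \<mu> (Suc (r + 2)) ((\<sigma> k)(r + 2 := acc (Suc k)))"
      unfolding acc_Suc C_def
      by (rule Loop.IH(2)) (use c k acc[of k] Loop.prems in \<open>auto simp: C_def \<sigma>_def less_Suc_eq\<close>)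
    have 6: "goes w P 1 (q + 3 + length C) \<mu> (Suc (r + 2)) ((\<sigma> k)(r + 2 := acc (Suc k)))
       (q + 4 + length C) \<mu> (r + 2) ((\<sigma> k)(r := acc (Suc k)))"
      by (rule goes_instr[OF c(4)]) (auto simp: holds_def less_Suc_eq \<sigma>_def)
    have 7: "goes w P 1 (q + 4 + length C) \<mu> (r + 2) ((\<sigma> k)(r := acc (Suc k)))
       (q + 5 + length C) \<mu> (r + 3) ((\<sigma> k)(r := acc (Suc k), r + 2 := 1))"
      by (rule goes_instr[OF c'(3)]) (use w in \<open>auto simp: holds_def less_Suc_eq \<sigma>_def numeral_eq_Suc\<close>)
    have 8: "goes w P 1 (q + 5 + length C) \<mu> (r + 3) ((\<sigma> k)(r := acc (Suc k), r + 2 := 1))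
       (q + 6 + length C) \<mu> (r + 2) (\<sigma> (Suc k))"
      by (rule goes_instr[OF c'(4)])
        (use k in \<open>auto simp: holds_def less_Suc_eq \<sigma>_def numeral_eq_Suc take_bit_nat_eq_self\<close>)
    have 9: "goes w P 1 (q + 6 + length C) \<mu> (r + 2) (\<sigma> (Suc k)) (q + 1) \<mu> (r + 2) (\<sigma> (Suc k))"
      by (rule goes_instr[OF c'(5)]) (auto simp: holds_def)
    have "goes w P (1 + cost g b + 1 + 1 + 1 + 1) (q + 1) \<mu> (r + 2) (\<sigma> k) (q + 1) \<mu> (r + 2) (\<sigma> (Suc k))"
      by (intro goes_trans[OF _ 9] goes_trans[OF _ 8] goes_trans[OF _ 7] goes_trans[OF _ 6] goes_trans[OF _ 5] 4)
    note 10 = this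
    have "k \<le> \<rho> i" using k by simp
    from goes_trans[OF Suc.IH[OF this] 10] show ?case by (rule goes_mono) simp
  qed
  have 4: "goes w P 1 (q + 1) \<mu> (r + 2) (\<sigma> (\<rho> i)) (q + 2) \<mu> (r + 2) (\<sigma> (\<rho> i))"
    by (rule goes_instr[OF c'(1)]) (use i in \<open>auto simp: holds_def less_Suc_eq \<sigma>_def\<close>)
  have 5: "goes w P 1 (q + 2) \<mu> (r + 2) (\<sigma> (\<rho> i)) (q + 7 + length C) \<mu> (Suc r) (\<rho>(r := acc (\<rho> i)))"
    by (rule goes_instr[OF c'(2)]) (auto simp: holds_def less_Suc_eq \<sigma>_def)
  have len: "l + length (compile (Loop i a b) l r) = q + 7 + length C"
    by (simp add: Let_def A_def q_def C_def)
  have ev: "eval w \<mu> (Loop i a b) r \<rho> = acc (\<rho> i)" by (simp add: acc_def)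
  have "goes w P (cost g a + 1 + g i * (cost g b + 5) + 1 + 1) l \<mu> r \<rho> (q + 7 + length C) \<mu> (Suc r) (\<rho>(r := acc (\<rho> i)))"
    unfolding i(2)[symmetric]
    by (intro goes_trans[OF _ 5] goes_trans[OF _ 4] goes_trans[OF _ 3] goes_trans[OF _ 2] 1 order_refl)
  then show ?case unfolding len ev by (simp add: add.assoc del: fun_upd_apply)
qed

lemma run_less:
  assumes "0 < w"
  shows "wf_com r\<^sub>0 c r \<Longrightarrow> r\<^sub>0 \<le> r \<Longrightarrow> \<forall>i<r. \<rho> i < 2 ^ w \<Longrightarrow> \<forall>A. \<mu> A < 2 ^ w \<Longrightarrow> run w c r \<rho> \<mu> A < 2 ^ w"
proof (induction c arbitrary: r \<rho> \<mu> A)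
  case (Put a b)
  then show ?case using assms eval_less by (auto simp: less_Suc_eq)
next
  case (For i c)
  have "\<rho> i < 2 ^ w" using For by auto
  have "k \<le> \<rho> i \<Longrightarrow> rec_nat \<mu> (\<lambda>k. run w c (Suc r) (\<rho>(r := k))) k A < 2 ^ w" for k A
  proof (induction k arbitrary: A)
    case (Suc k)
    then have "k < 2 ^ w" using \<open>\<rho> i < 2 ^ w\<close> by linarith
    with Suc show ?case using For.prems by (auto simp: less_Suc_eq intro!: For.IH)
  qed (use For.prems in auto)
  then show ?case by simp
qed

lemma goes_compile_com:
  assumes w: "0 < w"
  shows "code_at P l (compile_com c l r) \<Longrightarrow> wf_com r\<^sub>0 c r \<Longrightarrow> r\<^sub>0 \<le> r \<Longrightarrow> \<forall>i<r. \<rho> i < 2 ^ w \<Longrightarrow>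
    \<forall>i<r\<^sub>0. \<rho> i = g i \<Longrightarrow> \<forall>A. \<mu> A < 2 ^ w \<Longrightarrow>
    goes w P (cost_com g c) l \<mu> r \<rho> (l + length (compile_com c l r)) (run w c r \<rho> \<mu>) r \<rho>"
proof (induction c arbitrary: l r \<rho> \<mu>)
  case (Put a b)
  define A where "A = compile a l r"
  define C where "C = compile b (l + length A) (Suc r)"
  define va where "va = eval w \<mu> a r \<rho>"
  define vb where "vb = eval w \<mu> b (Suc r) (\<rho>(r := va))"
  have c: "code_at P l A" "code_at P (l + length A) C"
      "code_at P (l + length A + length C) [Store r (Suc r)]"
    using Put.prems(1) by (auto simp: A_def C_def Let_def dest!: code_at_append)
  have va: "va < 2 ^ w" unfolding va_def using Put.prems eval_less[OF w] by auto
  have 1: "goes w P (cost g a) l \<mu> r \<rho> (l + length A) \<mu> (Suc r) (\<rho>(r := va))"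
    unfolding A_def va_def by (rule goes_compile[OF w]) (use c Put.prems in \<open>auto simp: A_def\<close>)
  have 2: "goes w P (cost g b) (l + length A) \<mu> (Suc r) (\<rho>(r := va)) (l + length A + length C) \<mu>
      (Suc (Suc r)) (\<rho>(r := va, Suc r := vb))"
    unfolding C_def vb_def
    by (rule goes_compile[OF w]) (use c va Put.prems in \<open>auto simp: C_def less_Suc_eq\<close>)
  have 3: "goes w P 1 (l + length A + length C) \<mu> (Suc (Suc r)) (\<rho>(r := va, Suc r := vb))
      (l + length A + length C + 1) (\<mu>(va := vb)) r \<rho>"
    by (rule goes_instr[OF c(3)]) (auto simp: holds_def less_Suc_eq)
  show ?case
    using goes_trans[OF goes_trans[OF 1 2] 3] by (simp add: Let_def A_def C_def va_def vb_def add.assoc del: fun_upd_apply)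
next
  case (For i c)
  define C where "C = compile_com c (l + 3) (Suc r)"
  define m where "m k = rec_nat \<mu> (\<lambda>k. run w c (Suc r) (\<rho>(r := k))) k" for k
  have m_Suc: "m (Suc k) = run w c (Suc r) (\<rho>(r := k)) (m k)" for k
    by (simp add: m_def)
  have i: "i < r" "\<rho> i = g i" using For.prems by auto
  then have i': "\<rho> i < 2 ^ w" using For.prems(4) by blast
  note i = i i'
  let ?I = "[Const r 0, JumpLess r i (l + 3), Jump (l + 6 + length C)]"
  let ?J = "[Const (Suc r) 1, Op Add r r (Suc r), Jump (Suc l)]"
  have c:
    "code_at P l [Const r 0, JumpLess r i (l + 3), Jump (l + 6 + length C)]"
    "code_at P (l + 3) C"
    "code_at P (l + 3 + length C) [Const (Suc r) 1, Op Add r r (Suc r), Jump (Suc l)]"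
  proof -
    have *: "code_at P l (?I @ C @ ?J)"
      using For.prems(1) by (simp add: C_def Let_def)
    have "code_at P (l + length ?I) (C @ ?J)" "code_at P l ?I" using code_at_append[OF *] by blast+
    then have "code_at P (l + 3) (C @ ?J)" by (simp add: numeral_3_eq_3)
    then show "code_at P l ?I" "code_at P (l + 3) C" "code_at P (l + 3 + length C) ?J"
      using \<open>code_at P l ?I\<close> code_at_append by blast+
  qed
  have c': "code_at P (l + 1) [JumpLess r i (l + 3), Jump (l + 6 + length C)]"
      "code_at P (l + 2) [Jump (l + 6 + length C)]"
      "code_at P (l + 4 + length C) [Op Add r r (Suc r), Jump (Suc l)]"
      "code_at P (l + 5 + length C) [Jump (Suc l)]"
    using c(1,3) by (auto simp: numeral_eq_Suc dest!: code_at_Cons)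
  have m: "\<forall>A. m k A < 2 ^ w" if "k \<le> \<rho> i" for k
    using that
  proof (induction k)
    case 0 then show ?case using For.prems by (auto simp: m_def)
  next
    case (Suc k)
    have "m (Suc k) A < 2 ^ w" for A
      unfolding m_Suc
      by (rule run_less[OF w]) (use Suc For.prems i in \<open>auto simp: less_Suc_eq\<close>)
    then show ?case by auto
  qed
  have 2: "goes w P 1 l \<mu> r \<rho> (l + 1) (m 0) (Suc r) (\<rho>(r := 0))"
    by (rule goes_instr[OF c(1)]) (auto simp: holds_def less_Suc_eq m_def)
  have 3: "goes w P (k * (cost_com g c + 4)) (l + 1) (m 0) (Suc r) (\<rho>(r := 0)) (l + 1) (m k) (Suc r) (\<rho>(r := k))"
    if "k \<le> \<rho> i" for k
    using that
  proof (induction k)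
    case 0 show ?case by (auto simp: goes_def)
  next
    case (Suc k)
    have k: "k < \<rho> i" "Suc k < 2 ^ w" using Suc i by auto
    have 4: "goes w P 1 (l + 1) (m k) (Suc r) (\<rho>(r := k)) (l + 3) (m k) (Suc r) (\<rho>(r := k))"
      by (rule goes_instr[OF c'(1)]) (use k i in \<open>auto simp: holds_def less_Suc_eq\<close>)
    have 5: "goes w P (cost_com g c) (l + 3) (m k) (Suc r) (\<rho>(r := k)) (l + 3 + length C) (m (Suc k)) (Suc r) (\<rho>(r := k))"
      unfolding m_Suc C_def
      by (rule For.IH) (use c k m[of k] For.prems in \<open>auto simp: C_def less_Suc_eq\<close>)
    have 7: "goes w P 1 (l + 3 + length C) (m (Suc k)) (Suc r) (\<rho>(r := k))
       (l + 4 + length C) (m (Suc k)) (r + 2) (\<rho>(r := k, Suc r := 1))"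
      by (rule goes_instr[OF c(3)]) (use w in \<open>auto simp: holds_def less_Suc_eq numeral_eq_Suc\<close>)
    have 8: "goes w P 1 (l + 4 + length C) (m (Suc k)) (r + 2) (\<rho>(r := k, Suc r := 1))
       (l + 5 + length C) (m (Suc k)) (Suc r) (\<rho>(r := Suc k))"
      by (rule goes_instr[OF c'(3)])
        (use k in \<open>auto simp: holds_def less_Suc_eq numeral_eq_Suc take_bit_nat_eq_self\<close>)
    have 9: "goes w P 1 (l + 5 + length C) (m (Suc k)) (Suc r) (\<rho>(r := Suc k)) (l + 1) (m (Suc k)) (Suc r) (\<rho>(r := Suc k))"
      by (rule goes_instr[OF c'(4)]) (auto simp: holds_def)
    have "goes w P (1 + cost_com g c + 1 + 1 + 1) (l + 1) (m k) (Suc r) (\<rho>(r := k)) (l + 1) (m (Suc k)) (Suc r) (\<rho>(r := Suc k))"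
      by (intro goes_trans[OF _ 9] goes_trans[OF _ 8] goes_trans[OF _ 7] goes_trans[OF _ 5] 4)
    note 10 = this
    have "k \<le> \<rho> i" using k by simp
    from goes_trans[OF Suc.IH[OF this] 10] show ?case by (rule goes_mono) simp
  qed
  have 4: "goes w P 1 (l + 1) (m (\<rho> i)) (Suc r) (\<rho>(r := \<rho> i)) (l + 2) (m (\<rho> i)) (Suc r) (\<rho>(r := \<rho> i))"
    by (rule goes_instr[OF c'(1)]) (use i in \<open>auto simp: holds_def less_Suc_eq\<close>)
  have 5: "goes w P 1 (l + 2) (m (\<rho> i)) (Suc r) (\<rho>(r := \<rho> i)) (l + 6 + length C) (m (\<rho> i)) r \<rho>"
    by (rule goes_instr[OF c'(2)]) (auto simp: holds_def less_Suc_eq)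
  have len: "l + length (compile_com (For i c) l r) = l + 6 + length C"
    by (simp add: Let_def C_def)
  have ev: "run w (For i c) r \<rho> \<mu> = m (\<rho> i)" by (simp add: m_def)
  have "goes w P (1 + g i * (cost_com g c + 4) + 1 + 1) l \<mu> r \<rho> (l + 6 + length C) (m (\<rho> i)) r \<rho>"
    unfolding i(2)[symmetric]
    by (intro goes_trans[OF _ 5] goes_trans[OF _ 4] goes_trans[OF _ 3] 2 order_refl)
  then show ?case unfolding len ev by (simp add: add.assoc del: fun_upd_apply)
qed

section \<open>Splitting copies by dyadic separators\<close>

text \<open>
  \<open>sep d x z\<close>: at level \<open>d\<close>, the numbers \<open>x\<close> and \<open>z\<close> lie in the left and in the right half of the same
  dyadic interval.
\<close>

definition sep :: "nat \<Rightarrow> nat \<Rightarrow> nat \<Rightarrow> bool" where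
  "sep d x z \<longleftrightarrow> odd (z div 2 ^ d) \<and> Suc (x div 2 ^ d) = z div 2 ^ d"

text \<open>For \<open>x < z\<close> the only separating level is the highest bit in which the two
  differ. The induction strips the lowest bit: level 0 separates only siblings \<open>2 * k\<close>
  and \<open>2 * k + 1\<close>, and every other pair keeps its strict order after halving.\<close>

lemma sum_sep:
  "x < 2 ^ h \<Longrightarrow> z < 2 ^ h \<Longrightarrow> (\<Sum>d<h. of_bool (sep d x z)) = (of_bool (x < z) :: nat)"
proof (induction h arbitrary: x z)
  case (Suc h)
  have "(\<Sum>d<Suc h. of_bool (sep d x z)) =
      (of_bool (sep 0 x z) :: nat) + (\<Sum>d<h. of_bool (sep d (x div 2) (z div 2)))"
    by (simp only: sum.lessThan_Suc_shift sep_def power_Suc div_mult2_eq)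
  also have "(\<Sum>d<h. of_bool (sep d (x div 2) (z div 2))) = (of_bool (x div 2 < z div 2) :: nat)"
    by (rule Suc.IH) (use Suc.prems in auto)
  also have "(of_bool (sep 0 x z) :: nat) + of_bool (x div 2 < z div 2) = of_bool (x < z)"
  proof -
    have "(odd z \<and> Suc x = z) \<noteq> (x div 2 < z div 2)" if "x < z"
      using that by presburger
    moreover have "\<not> (odd z \<and> Suc x = z) \<and> \<not> x div 2 < z div 2" if "\<not> x < z"
      using that by presburger
    ultimately show ?thesis by (cases "x < z") (auto simp: sep_def)
  qed
  finally show ?case .
qed simp

section \<open>Counting points in boxes\<close>

definition rect :: "nat set \<Rightarrow> (nat \<Rightarrow> nat) \<Rightarrow> (nat \<Rightarrow> nat) \<Rightarrow> nat \<Rightarrow> nat \<Rightarrow> nat \<Rightarrow> nat \<Rightarrow> nat" where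
  "rect S x y xl xh yl yh = (\<Sum>q\<in>S. of_bool (xl \<le> x q \<and> x q < xh \<and> yl \<le> y q \<and> y q < yh))"

text \<open>Inclusion-exclusion over the four corners, with the subtracted terms moved to the left
  because natural subtraction truncates. It can fail for reversed sides.\<close>

lemma rect_corners:
  assumes "xl \<le> xh" "yl \<le> yh"
  shows "rect S x y xl xh yl yh + (rect S x y 0 xl 0 yh + rect S x y 0 xh 0 yl) =
    rect S x y 0 xh 0 yh + rect S x y 0 xl 0 yl"
  unfolding rect_def sum.distrib[symmetric] using assms by (intro sum.cong) auto

lemma rect_empty: "xh \<le> xl \<or> yh \<le> yl \<Longrightarrow> rect S x y xl xh yl yh = 0"
  by (auto simp: rect_def intro!: sum.neutral)

lemma rect_le_card: "rect S x y xl xh yl yh \<le> card S"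
  unfolding rect_def by (rule order_trans[OF sum_mono[where g = "\<lambda>_. 1"]]) auto

lemma rect_mono:
  "xl' \<le> xl \<Longrightarrow> xh \<le> xh' \<Longrightarrow> yl' \<le> yl \<Longrightarrow> yh \<le> yh' \<Longrightarrow>
   rect S x y xl xh yl yh \<le> rect S x y xl' xh' yl' yh'"
  unfolding rect_def by (intro sum_mono) auto

lemma mult_sums:
  fixes c :: nat
  shows "c * (sum f S * sum g T) = (\<Sum>i\<in>S. \<Sum>j\<in>T. c * (f i * g j))"
  by (simp only: sum_product) (simp only: sum_distrib_left)

lemma sum_swap4:
  "(\<Sum>a\<in>S. \<Sum>b\<in>S. \<Sum>c\<in>S. \<Sum>e\<in>S. \<Sum>d\<in>T. f a b c e d) =
   (\<Sum>d\<in>T. \<Sum>a\<in>S. \<Sum>b\<in>S. \<Sum>c\<in>S. \<Sum>e\<in>S. f a b c e d)"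
proof -
  have "(\<Sum>a\<in>S. \<Sum>b\<in>S. \<Sum>c\<in>S. \<Sum>e\<in>S. \<Sum>d\<in>T. f a b c e d) =
    (\<Sum>a\<in>S. \<Sum>b\<in>S. \<Sum>c\<in>S. \<Sum>d\<in>T. \<Sum>e\<in>S. f a b c e d)"
    by (intro sum.cong refl sum.swap)
  also have "\<dots> = (\<Sum>a\<in>S. \<Sum>b\<in>S. \<Sum>d\<in>T. \<Sum>c\<in>S. \<Sum>e\<in>S. f a b c e d)"
    by (intro sum.cong refl sum.swap)
  also have "\<dots> = (\<Sum>a\<in>S. \<Sum>d\<in>T. \<Sum>b\<in>S. \<Sum>c\<in>S. \<Sum>e\<in>S. f a b c e d)"
    by (intro sum.cong refl sum.swap)
  finally show ?thesis by (simp only: sum.swap[of _ S T])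
qed

text \<open>Points are bare indices with two coordinate functions, so that the rotated point set is
  the same index set with mirrored coordinates. The arguments \<open>a\<close>, \<open>b\<close>,
  \<open>c\<close>, \<open>e\<close> play 2, 4, 1, 3.\<close>

definition copy :: "(nat \<Rightarrow> nat) \<Rightarrow> (nat \<Rightarrow> nat) \<Rightarrow> nat \<Rightarrow> nat \<Rightarrow> nat \<Rightarrow> nat \<Rightarrow> bool" where
  "copy x y a b c e \<longleftrightarrow> x a < x b \<and> x b < x c \<and> x c < x e \<and> y c < y a \<and> y a < y e \<and> y e < y b"

text \<open>The first number of the right half of the dyadic interval of length
  \<open>2 ^ Suc d\<close> that contains \<open>z\<close>.\<close>

definition middle :: "nat \<Rightarrow> nat \<Rightarrow> nat" where
  "middle d z = z div 2 ^ Suc d * 2 ^ Suc d + 2 ^ d"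

context
  fixes M :: nat and x y :: "nat \<Rightarrow> nat" and d p :: nat
begin

text \<open>
  If \<open>p\<close> lies in the left half of its interval, it plays the role of \<open>2\<close>, \<open>v\<close> that of \<open>3\<close>, and two points
  of the copy lie on either side of the middle; \<open>F\<close> counts the candidates for \<open>1\<close> and \<open>G\<close> those for \<open>4\<close>.
  If \<open>p\<close> lies in the right half, it plays the role of \<open>3\<close>, \<open>v\<close> that of \<open>1\<close>, and only \<open>2\<close> lies to the left
  of the middle; \<open>F\<close> counts the candidates for \<open>4\<close> and \<open>G\<close> those for \<open>2\<close>. The copies with only \<open>3\<close> to the
  right of the middle are the latter case for the point set rotated by 180 degrees, which
  preserves the pattern.
\<close>

definition "upper_x = (if odd (x p div 2 ^ d) then x p else middle d (x p) + 2 ^ d)"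
definition "lower_x = (if odd (x p div 2 ^ d) then x p div 2 ^ Suc d * 2 ^ Suc d else x p + 1)"
definition "lower_y = (if odd (x p div 2 ^ d) then 0 else y p + 1)"
definition "upper_y = (if odd (x p div 2 ^ d) then y p else M)"
definition "lower_y' = (if odd (x p div 2 ^ d) then y p + 1 else 0)"
definition "upper_y' = (if odd (x p div 2 ^ d) then M else y p)"

definition "Fcount S z = rect S x y (middle d (x p)) z lower_y' upper_y'"
definition "Gcount S z = rect S x y lower_x (middle d (x p)) (z + 1) upper_y"

definition "pivot_sum S =
  (\<Sum>v\<in>S. of_bool (x v < upper_x \<and> lower_y \<le> y v) * (Fcount S (x v) * Gcount S (y v)))"

text \<open>With \<open>p\<close> leftmost, \<open>sep\<close> puts \<open>e\<close> into the right
  half, and the middle lies between \<open>b\<close> and \<open>c\<close>, which makes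
  \<open>x b < x c\<close> automatic. Expanding the product of the two counts leaves exactly the
  other five comparisons.\<close>

lemma pivot_sum_even:
  assumes "even (x p div 2 ^ d)" "\<forall>q\<in>S. y q < M"
  shows "pivot_sum S = (\<Sum>e\<in>S. \<Sum>c\<in>S. \<Sum>b\<in>S. of_bool (copy x y p b c e \<and> sep d (x p) (x e) \<and>
    x b div 2 ^ d = x p div 2 ^ d \<and> x c div 2 ^ d = x e div 2 ^ d))"
proof -
  define D :: nat where "D = 2 ^ d"
  define u where "u = x p div D"
  have D: "0 < D" by (simp add: D_def)
  have u2: "even u" using assms by (simp add: u_def D_def)
  have dv: "z div D = k \<longleftrightarrow> k * D \<le> z \<and> z < k * D + D" for z k
    using D by (metis add.commute div_nat_eqI dividend_less_div_times mult.commute mult_Suc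
      times_div_less_eq_dividend)
  have mid: "middle d (x p) = u * D + D"
  proof -
    have "x p div 2 ^ Suc d = u div 2" by (simp add: u_def D_def div_mult2_eq mult.commute[of 2])
    then show ?thesis using u2 unfolding middle_def D_def[symmetric] by (auto simp: D_def elim: evenE)
  qed
  have *: "(x e < middle d (x p) + D \<and> y p + 1 \<le> y e) \<and>
      (middle d (x p) \<le> x c \<and> x c < x e \<and> 0 \<le> y c \<and> y c < y p) \<and>
      (x p + 1 \<le> x b \<and> x b < middle d (x p) \<and> y e + 1 \<le> y b \<and> y b < M) \<longleftrightarrow>
      copy x y p b c e \<and> sep d (x p) (x e) \<and> x b div D = x p div D \<and> x c div D = x e div D"
    if "b \<in> S" "c \<in> S" "e \<in> S" for b c e
  proof -
    have "u * D \<le> x p \<and> x p < u * D + D" using dv[of "x p" u] u_def by simp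
    moreover have "sep d (x p) (x e) \<longleftrightarrow> x e div D = Suc u"
      using u2 by (auto simp: sep_def D_def[symmetric] u_def[symmetric])
    moreover have "x e div D = Suc u \<Longrightarrow> x c div D = x e div D \<longleftrightarrow> x c div D = Suc u" by simp
    ultimately show ?thesis
      using assms(2) that unfolding copy_def mid u_def[symmetric] dv[of "x e" "Suc u"] dv[of "x b" u] dv[of "x c" "Suc u"]
      by (auto simp: dv)
  qed
  have "pivot_sum S = (\<Sum>e\<in>S. \<Sum>c\<in>S. \<Sum>b\<in>S.
      of_bool (x e < middle d (x p) + D \<and> y p + 1 \<le> y e) *
      (of_bool (middle d (x p) \<le> x c \<and> x c < x e \<and> 0 \<le> y c \<and> y c < y p) *
       of_bool (x p + 1 \<le> x b \<and> x b < middle d (x p) \<and> y e + 1 \<le> y b \<and> y b < M)))"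
    using assms(1)
    by (simp only: pivot_sum_def upper_x_def lower_y_def Fcount_def Gcount_def rect_def lower_x_def
      upper_y_def lower_y'_def upper_y'_def not_True_eq_False if_False mult_sums D_def[symmetric])
  also have "\<dots> = (\<Sum>e\<in>S. \<Sum>c\<in>S. \<Sum>b\<in>S. of_bool (copy x y p b c e \<and> sep d (x p) (x e) \<and>
      x b div 2 ^ d = x p div 2 ^ d \<and> x c div 2 ^ d = x e div 2 ^ d))"
    unfolding of_bool_conj[symmetric]
    by (intro sum.cong refl arg_cong[of _ _ of_bool]) (use * in \<open>simp add: D_def\<close>)
  finally show ?thesis .
qed

text \<open>With \<open>p\<close> rightmost and \<open>b\<close> in the same half, \<open>c\<close>
  is caught between them and needs no condition of its own. Only \<open>a\<close> lies left of the
  middle, so \<open>x a < x b\<close> is automatic.\<close>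

lemma pivot_sum_odd:
  assumes "odd (x p div 2 ^ d)" "\<forall>q\<in>S. y q < M"
  shows "pivot_sum S = (\<Sum>c\<in>S. \<Sum>b\<in>S. \<Sum>a\<in>S. of_bool (copy x y a b c p \<and> sep d (x a) (x p) \<and>
    x b div 2 ^ d = x p div 2 ^ d))"
proof -
  define D :: nat where "D = 2 ^ d"
  define u where "u = x p div D"
  have D: "0 < D" by (simp add: D_def)
  have u2: "odd u" using assms by (simp add: u_def D_def)
  then obtain k where k: "u = Suc k" by (cases u) auto
  have dv: "z div D = k \<longleftrightarrow> k * D \<le> z \<and> z < k * D + D" for z k
    using D by (metis add.commute div_nat_eqI dividend_less_div_times mult.commute mult_Suc
      times_div_less_eq_dividend)
  have low: "x p div 2 ^ Suc d * 2 ^ Suc d = k * D"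
  proof -
    have "x p div 2 ^ Suc d = u div 2" by (simp add: u_def D_def div_mult2_eq mult.commute[of 2])
    then show ?thesis using u2 k unfolding D_def[symmetric] by (auto simp: D_def elim: evenE)
  qed
  have mid: "middle d (x p) = u * D" unfolding middle_def low k D_def[symmetric] by simp
  have *: "(x c < x p \<and> 0 \<le> y c) \<and>
      (middle d (x p) \<le> x b \<and> x b < x c \<and> y p + 1 \<le> y b \<and> y b < M) \<and>
      (k * D \<le> x a \<and> x a < middle d (x p) \<and> y c + 1 \<le> y a \<and> y a < y p) \<longleftrightarrow>
      copy x y a b c p \<and> sep d (x a) (x p) \<and> x b div D = x p div D"
    if "a \<in> S" "b \<in> S" "c \<in> S" for a b c
  proof -
    have "u * D \<le> x p \<and> x p < u * D + D" using dv[of "x p" u] u_def by simp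
    moreover have "sep d (x a) (x p) \<longleftrightarrow> x a div D = k"
      using u2 k by (auto simp: sep_def D_def[symmetric] u_def[symmetric])
    ultimately show ?thesis
      using assms(2) that unfolding copy_def mid u_def[symmetric] dv[of "x a" k] dv[of "x b" u]
      by (auto simp: k)
  qed
  have "pivot_sum S = (\<Sum>c\<in>S. \<Sum>b\<in>S. \<Sum>a\<in>S.
      of_bool (x c < x p \<and> 0 \<le> y c) *
      (of_bool (middle d (x p) \<le> x b \<and> x b < x c \<and> y p + 1 \<le> y b \<and> y b < M) *
       of_bool (k * D \<le> x a \<and> x a < middle d (x p) \<and> y c + 1 \<le> y a \<and> y a < y p)))"
    using assms(1)
    by (simp only: pivot_sum_def upper_x_def lower_y_def Fcount_def Gcount_def rect_def lower_x_def
      upper_y_def lower_y'_def upper_y'_def if_True not_False_eq_True mult_sums low)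
  also have "\<dots> = (\<Sum>c\<in>S. \<Sum>b\<in>S. \<Sum>a\<in>S. of_bool (copy x y a b c p \<and> sep d (x a) (x p) \<and>
      x b div 2 ^ d = x p div 2 ^ d))"
    unfolding of_bool_conj[symmetric]
    by (intro sum.cong refl arg_cong[of _ _ of_bool]) (use * in \<open>simp add: D_def\<close>)
  finally show ?thesis .
qed

end

section \<open>Rotation of the point set by 180 degrees\<close>

definition mirror :: "nat \<Rightarrow> nat \<Rightarrow> nat" where
  "mirror M z = M - 1 - z"

text \<open>For \<open>M = 2 ^ m\<close>, mirroring complements all \<open>m\<close> bits, and
  complementing commutes with dropping the lowest \<open>d\<close> of them.\<close>

lemma mirror_div:
  assumes "z < 2 ^ m" "d \<le> m"
  shows "mirror (2 ^ m) z div 2 ^ d + z div 2 ^ d + 1 = 2 ^ (m - d)"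
proof -
  define D k :: nat where "D = 2 ^ d" and "k = 2 ^ (m - d)"
  have M: "2 ^ m = k * D" using assms(2) by (simp add: D_def k_def flip: power_add)
  define q s where "q = z div D" and "s = z mod D"
  have z: "z = q * D + s" "s < D" by (simp_all only: q_def s_def div_mult_mod_eq) (simp add: D_def)
  have "q < k" using assms(1) unfolding M q_def
    by (simp add: less_mult_imp_div_less)
  then obtain j where j: "k = q + 1 + j" by (metis less_iff_Suc_add add_Suc_right plus_1_eq_Suc add.commute add.assoc)
  obtain t where t: "D = s + 1 + t" using z(2) by (metis less_iff_Suc_add add_Suc_right plus_1_eq_Suc add.commute add.assoc)
  have "mirror (2 ^ m) z = j * D + t"
    unfolding mirror_def M j z(1) using t by (simp add: algebra_simps)
  moreover have "t < D" using t by simp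
  ultimately have "mirror (2 ^ m) z div D = j" by simp
  then show ?thesis using j unfolding D_def[symmetric] k_def[symmetric] q_def[symmetric] by simp
qed

text \<open>Complementing swaps the halves of every dyadic interval. By \<open>d < m\<close> the
  number \<open>2 ^ (m - d)\<close> is even, so mirroring flips the parity of the quotients.\<close>

lemma sep_mirror:
  assumes "x < 2 ^ m" "z < 2 ^ m" "d < m"
  shows "sep d (mirror (2 ^ m) z) (mirror (2 ^ m) x) \<longleftrightarrow> sep d x z"
proof -
  obtain k :: nat where k: "2 ^ (m - d) = 2 * k"
    using assms(3) by (metis Suc_diff_Suc power_Suc)
  define A B a b where "A = mirror (2 ^ m) x div 2 ^ d" and "B = mirror (2 ^ m) z div 2 ^ d"
    and "a = x div 2 ^ d" and "b = z div 2 ^ d"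
  have "A + a + 1 = 2 * k" "B + b + 1 = 2 * k"
    using mirror_div[OF assms(1), of d] mirror_div[OF assms(2), of d] assms(3)
    unfolding A_def B_def a_def b_def k by simp_all
  then have "(odd A \<and> Suc B = A) = (odd b \<and> Suc a = b)" by presburger
  then show ?thesis unfolding sep_def A_def B_def a_def b_def .
qed

lemma mirror_div_eq:
  assumes "x < 2 ^ m" "z < 2 ^ m" "d < m"
  shows "mirror (2 ^ m) z div 2 ^ d = mirror (2 ^ m) x div 2 ^ d \<longleftrightarrow> z div 2 ^ d = x div 2 ^ d"
  using mirror_div[OF assms(1), of d] mirror_div[OF assms(2), of d] assms(3) by linarith

lemma mirror_less_iff: "z < M \<Longrightarrow> z' < M \<Longrightarrow> mirror M z < mirror M z' \<longleftrightarrow> z' < z"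
  unfolding mirror_def by linarith

text \<open>Reversing 2413 gives 3142, and complementing the values gives 2413 back; only the order
  of the roles is reversed.\<close>

lemma copy_mirror:
  assumes "\<forall>q\<in>S. x q < M \<and> y q < M" "a \<in> S" "b \<in> S" "c \<in> S" "e \<in> S"
  shows "copy (\<lambda>q. mirror M (x q)) (\<lambda>q. mirror M (y q)) a b c e \<longleftrightarrow> copy x y e c b a"
proof -
  have "x a < M" "x b < M" "x c < M" "x e < M" "y a < M" "y b < M" "y c < M" "y e < M"
    using assms by auto
  then show ?thesis unfolding copy_def by (auto simp: mirror_less_iff)
qed

text \<open>The extreme points of a copy part at exactly one level, where the middle cuts the copy
  2|2, 1|3 or 3|1. The unrotated sum covers the first two kinds; the parity factor retains only the
  1|3 splits of the rotated set, which are the 3|1 splits of the original.\<close>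

lemma copy_count:
  assumes bd: "\<forall>q\<in>S. x q < 2 ^ m \<and> y q < 2 ^ m"
  defines "x' \<equiv> \<lambda>q. mirror (2 ^ m) (x q)" and "y' \<equiv> \<lambda>q. mirror (2 ^ m) (y q)"
  shows "(\<Sum>a\<in>S. \<Sum>b\<in>S. \<Sum>c\<in>S. \<Sum>e\<in>S. of_bool (copy x y a b c e)) =
    (\<Sum>p\<in>S. \<Sum>d<m. pivot_sum (2 ^ m) x y d p S) +
    (\<Sum>p\<in>S. \<Sum>d<m. of_bool (odd (x' p div 2 ^ d)) * pivot_sum (2 ^ m) x' y' d p S)"
proof -
  \<comment> \<open>\<open>A\<close>, \<open>B\<close>, \<open>C\<close> are the splits 2|2, 1|3,
    3|1. In \<open>B\<close> and \<open>C\<close> one quotient suffices, as the remaining point lies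
    between two points of the same half.\<close>
  define A where "A d a b c e \<longleftrightarrow> copy x y a b c e \<and> sep d (x a) (x e) \<and>
    x b div 2 ^ d = x a div 2 ^ d \<and> x c div 2 ^ d = x e div 2 ^ d" for d a b c e
  define B where "B d a b c e \<longleftrightarrow> copy x y a b c e \<and> sep d (x a) (x e) \<and>
    x b div 2 ^ d = x e div 2 ^ d" for d a b c e
  define C where "C d a b c e \<longleftrightarrow> copy x y a b c e \<and> sep d (x a) (x e) \<and>
    x c div 2 ^ d = x a div 2 ^ d" for d a b c e
  have 1: "(\<Sum>p\<in>S. \<Sum>d<m. pivot_sum (2 ^ m) x y d p S) =
    (\<Sum>d<m. (\<Sum>a\<in>S. \<Sum>b\<in>S. \<Sum>c\<in>S. \<Sum>e\<in>S. of_bool (A d a b c e) + of_bool (B d a b c e)))"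
  proof -
    have "pivot_sum (2 ^ m) x y d p S = (\<Sum>e\<in>S. \<Sum>c\<in>S. \<Sum>b\<in>S. of_bool (A d p b c e)) +
        (\<Sum>c\<in>S. \<Sum>b\<in>S. \<Sum>a\<in>S. of_bool (B d a b c p))" if "p \<in> S" for d p
    proof (cases "even (x p div 2 ^ d)")
      case True
      then have "\<not> B d a b c p" for a b c by (auto simp: B_def sep_def)
      then show ?thesis using pivot_sum_even[of x p d S y "2 ^ m"] True bd that by (simp add: A_def)
    next
      case False
      then have "\<not> A d p b c e" for b c e
        unfolding A_def sep_def by (metis even_Suc)
      then show ?thesis using pivot_sum_odd[of x p d S y "2 ^ m"] False bd that by (simp add: B_def)
    qed
    then have "(\<Sum>p\<in>S. \<Sum>d<m. pivot_sum (2 ^ m) x y d p S) =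
      (\<Sum>p\<in>S. \<Sum>d<m. (\<Sum>e\<in>S. \<Sum>c\<in>S. \<Sum>b\<in>S. of_bool (A d p b c e)) +
        (\<Sum>c\<in>S. \<Sum>b\<in>S. \<Sum>a\<in>S. of_bool (B d a b c p)))" by (intro sum.cong refl) simp
    also have "\<dots> = (\<Sum>d<m. (\<Sum>a\<in>S. \<Sum>e\<in>S. \<Sum>c\<in>S. \<Sum>b\<in>S. of_bool (A d a b c e)) +
        (\<Sum>e\<in>S. \<Sum>c\<in>S. \<Sum>b\<in>S. \<Sum>a\<in>S. of_bool (B d a b c e)))"
      by (subst sum.swap) (simp only: sum.distrib)
    also have "\<dots> = (\<Sum>d<m. (\<Sum>a\<in>S. \<Sum>b\<in>S. \<Sum>c\<in>S. \<Sum>e\<in>S. of_bool (A d a b c e)) +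
        (\<Sum>a\<in>S. \<Sum>b\<in>S. \<Sum>c\<in>S. \<Sum>e\<in>S. of_bool (B d a b c e)))"
    proof -
      have r: "(\<Sum>e\<in>S. \<Sum>c\<in>S. \<Sum>b\<in>S. f b c e) = (\<Sum>b\<in>S. \<Sum>c\<in>S. \<Sum>e\<in>S. f b c e)" for f :: "nat \<Rightarrow> nat \<Rightarrow> nat \<Rightarrow> nat"
      proof -
        have "(\<Sum>e\<in>S. \<Sum>c\<in>S. \<Sum>b\<in>S. f b c e) = (\<Sum>e\<in>S. \<Sum>b\<in>S. \<Sum>c\<in>S. f b c e)"
          by (intro sum.cong refl sum.swap)
        also have "\<dots> = (\<Sum>b\<in>S. \<Sum>e\<in>S. \<Sum>c\<in>S. f b c e)" by (rule sum.swap)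
        also have "\<dots> = (\<Sum>b\<in>S. \<Sum>c\<in>S. \<Sum>e\<in>S. f b c e)" by (intro sum.cong refl sum.swap)
        finally show ?thesis .
      qed
      have q: "(\<Sum>e\<in>S. \<Sum>c\<in>S. \<Sum>b\<in>S. \<Sum>a\<in>S. f a b c e) = (\<Sum>a\<in>S. \<Sum>b\<in>S. \<Sum>c\<in>S. \<Sum>e\<in>S. f a b c e)"
        for f :: "nat \<Rightarrow> nat \<Rightarrow> nat \<Rightarrow> nat \<Rightarrow> nat"
      proof -
        have "(\<Sum>e\<in>S. \<Sum>c\<in>S. \<Sum>b\<in>S. \<Sum>a\<in>S. f a b c e) = (\<Sum>e\<in>S. \<Sum>a\<in>S. \<Sum>b\<in>S. \<Sum>c\<in>S. f a b c e)"
          by (intro sum.cong refl r)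
        also have "\<dots> = (\<Sum>a\<in>S. \<Sum>e\<in>S. \<Sum>b\<in>S. \<Sum>c\<in>S. f a b c e)" by (rule sum.swap)
        also have "\<dots> = (\<Sum>a\<in>S. \<Sum>b\<in>S. \<Sum>e\<in>S. \<Sum>c\<in>S. f a b c e)" by (intro sum.cong refl sum.swap)
        also have "\<dots> = (\<Sum>a\<in>S. \<Sum>b\<in>S. \<Sum>c\<in>S. \<Sum>e\<in>S. f a b c e)" by (intro sum.cong refl sum.swap)
        finally show ?thesis .
      qed
      show ?thesis by (intro sum.cong refl arg_cong2[of _ _ _ _ plus] r q)
    qed
    finally show ?thesis by (simp only: sum.distrib)
  qed
  have 2: "(\<Sum>p\<in>S. \<Sum>d<m. of_bool (odd (x' p div 2 ^ d)) * pivot_sum (2 ^ m) x' y' d p S) =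
    (\<Sum>d<m. (\<Sum>a\<in>S. \<Sum>b\<in>S. \<Sum>c\<in>S. \<Sum>e\<in>S. of_bool (C d a b c e)))"
  proof -
    have "of_bool (odd (x' p div 2 ^ d)) * pivot_sum (2 ^ m) x' y' d p S =
      (\<Sum>b\<in>S. \<Sum>c\<in>S. \<Sum>e\<in>S. of_bool (C d p b c e))" if "p \<in> S" "d < m" for d p
    proof -
      have iff: "copy x' y' e c b p \<and> sep d (x' e) (x' p) \<and> x' c div 2 ^ d = x' p div 2 ^ d \<longleftrightarrow> C d p b c e"
        if "b \<in> S" "c \<in> S" "e \<in> S" for b c e
        using that \<open>p \<in> S\<close> \<open>d < m\<close> bd unfolding x'_def y'_def C_def
        by (simp add: copy_mirror[OF bd] sep_mirror mirror_div_eq)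
      show ?thesis
      proof (cases "odd (x' p div 2 ^ d)")
        case True
        have "\<forall>q\<in>S. y' q < 2 ^ m" unfolding y'_def mirror_def by (auto intro: le_less_trans[of _ "2 ^ m - 1"])
        from pivot_sum_odd[of x' p d S y' "2 ^ m", OF True this] True
        show ?thesis by (simp add: iff)
      next
        case False
        have "\<not> C d p b c e" if "b \<in> S" "c \<in> S" "e \<in> S" for b c e
          using iff[OF that] False unfolding sep_def by blast
        then show ?thesis using False by simp
      qed
    qed
    then have "(\<Sum>p\<in>S. \<Sum>d<m. of_bool (odd (x' p div 2 ^ d)) * pivot_sum (2 ^ m) x' y' d p S) =
      (\<Sum>p\<in>S. \<Sum>d<m. \<Sum>b\<in>S. \<Sum>c\<in>S. \<Sum>e\<in>S. of_bool (C d p b c e))"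
      by (intro sum.cong refl) simp
    also have "\<dots> = (\<Sum>d<m. \<Sum>p\<in>S. \<Sum>b\<in>S. \<Sum>c\<in>S. \<Sum>e\<in>S. of_bool (C d p b c e))"
      by (rule sum.swap)
    finally show ?thesis .
  qed
  have 3: "of_bool (copy x y a b c e) =
      (\<Sum>d<m. (of_bool (A d a b c e) + of_bool (B d a b c e)) + of_bool (C d a b c e) :: nat)"
    if "a \<in> S" "b \<in> S" "c \<in> S" "e \<in> S" for a b c e
  proof -
    have "of_bool (copy x y a b c e) = of_bool (copy x y a b c e) * (of_bool (x a < x e) :: nat)"
      by (auto simp: copy_def)
    also have "(of_bool (x a < x e) :: nat) = (\<Sum>d<m. of_bool (sep d (x a) (x e)))"
      using sum_sep bd that by metis
    also have "of_bool (copy x y a b c e) * \<dots> = (\<Sum>d<m. of_bool (copy x y a b c e \<and> sep d (x a) (x e)))"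
      by (simp add: sum_distrib_left of_bool_conj)
    also have "\<dots> = (\<Sum>d<m. (of_bool (A d a b c e) + of_bool (B d a b c e)) + of_bool (C d a b c e))"
    proof (rule sum.cong[OF refl])
      fix d
      show "of_bool (copy x y a b c e \<and> sep d (x a) (x e)) =
        (of_bool (A d a b c e) + of_bool (B d a b c e) + of_bool (C d a b c e) :: nat)"
      proof (cases "copy x y a b c e \<and> sep d (x a) (x e)")
        case True
        define u ub uc where "u = x a div 2 ^ d" and "ub = x b div 2 ^ d" and "uc = x c div 2 ^ d"
        \<comment> \<open>Quotients are monotone and that of \<open>x e\<close> is
          \<open>Suc u\<close>, so \<open>ub\<close> and \<open>uc\<close> admit only three
          combinations, one for each of \<open>C\<close>, \<open>A\<close>,
          \<open>B\<close>.\<close>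
        have "u \<le> ub" "ub \<le> uc" "uc \<le> Suc u" "x e div 2 ^ d = Suc u"
          using True unfolding u_def ub_def uc_def copy_def sep_def
          by (auto intro!: div_le_mono dest: less_imp_le)
        then show ?thesis using True
          unfolding A_def B_def C_def u_def[symmetric] ub_def[symmetric] uc_def[symmetric] by auto
      qed (auto simp: A_def B_def C_def)
    qed
    finally show ?thesis .
  qed
  have "(\<Sum>a\<in>S. \<Sum>b\<in>S. \<Sum>c\<in>S. \<Sum>e\<in>S. of_bool (copy x y a b c e)) =
    (\<Sum>a\<in>S. \<Sum>b\<in>S. \<Sum>c\<in>S. \<Sum>e\<in>S. \<Sum>d<m. (of_bool (A d a b c e) + of_bool (B d a b c e)) + of_bool (C d a b c e) :: nat)"
    using 3 by (intro sum.cong refl) simp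
  also have "\<dots> = (\<Sum>d<m. \<Sum>a\<in>S. \<Sum>b\<in>S. \<Sum>c\<in>S. \<Sum>e\<in>S. (of_bool (A d a b c e) + of_bool (B d a b c e)) + of_bool (C d a b c e))"
    by (rule sum_swap4)
  finally show ?thesis unfolding 1 2 by (simp only: sum.distrib)
qed

section \<open>Rounding and thresholds\<close>

text \<open>The integer form of growth by the factor \<open>1 + 1 / K\<close>. The summand 1 lets
  the sequence leave 0 and advance by single units below \<open>K\<close>, so that small values are
  not rounded at all.\<close>

definition delta :: "nat \<Rightarrow> nat \<Rightarrow> nat \<Rightarrow> nat" where
  "delta n K t = (if t \<le> n then t div K + 1 else 0)"

text \<open>
  The sequence stops growing beyond \<open>n\<close>, so that its values fit into a word.
\<close>

primrec tau :: "nat \<Rightarrow> nat \<Rightarrow> nat \<Rightarrow> nat" where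
  "tau n K 0 = 0"
| "tau n K (Suc k) = tau n K k + delta n K (tau n K k)"

text \<open>A telescoping sum for the largest \<open>tau n K k\<close> with \<open>k \<le> g\<close>
  that does not exceed \<open>z\<close>. Indicators of thresholds are used because products of such
  sums expand into box conditions.\<close>

definition round_down :: "nat \<Rightarrow> nat \<Rightarrow> nat \<Rightarrow> nat \<Rightarrow> nat" where
  "round_down n K g z = (\<Sum>k<g. of_bool (tau n K (Suc k) \<le> z) * delta n K (tau n K k))"

text \<open>Either all thresholds so far are passed, or \<open>z\<close> lies in a gap already met.
  The gap above \<open>r\<close> has length \<open>r div K + 1\<close>, so rounding loses at most
  \<open>r div K\<close>.\<close>

lemma round_down_cases:
  assumes "z \<le> n"
  shows "(tau n K g \<le> z \<and> round_down n K g z = tau n K g) \<or>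
    (z < tau n K g \<and> round_down n K g z \<le> z \<and> z \<le> round_down n K g z + round_down n K g z div K)"
proof (induction g)
  case (Suc g)
  then show ?case
  proof
    assume *: "tau n K g \<le> z \<and> round_down n K g z = tau n K g"
    then have "delta n K (tau n K g) = tau n K g div K + 1" using assms by (simp add: delta_def)
    then show ?thesis using * by (cases "tau n K (Suc g) \<le> z") (auto simp: round_down_def)
  next
    assume *: "z < tau n K g \<and> round_down n K g z \<le> z \<and> z \<le> round_down n K g z + round_down n K g z div K"
    then have "\<not> tau n K (Suc g) \<le> z" by simp
    then show ?thesis using * by (auto simp: round_down_def)
  qed
qed (simp add: round_down_def)

lemma tau_mono: "k \<le> k' \<Longrightarrow> tau n K k \<le> tau n K k'"
  by (induction rule: dec_induct) auto

lemma tau_le: "tau n K k \<le> 2 * n + 1"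
proof (induction k)
  case (Suc k)
  have "tau n K k div K \<le> tau n K k" by (rule div_le_dividend)
  then have "tau n K k + tau n K k div K \<le> 2 * n" if "tau n K k \<le> n" using that by linarith
  with Suc show ?case by (simp add: delta_def)
qed simp

text \<open>While the sequence stays within \<open>n\<close>, a block of \<open>K\<close> increments
  starting at \<open>t\<close> adds at least \<open>K * (t div K + 1) \<ge> t\<close> and so doubles
  it. One step reaches 1 and \<open>m\<close> blocks then reach \<open>2 ^ m > n\<close>; the
  required index \<open>1 + K * m\<close> is rounded up to \<open>K * (m + 1)\<close>.\<close>

lemma tau_large:
  assumes "0 < K" "n < 2 ^ m"
  shows "n < tau n K (K * (m + 1))"
proof (rule ccontr)
  assume "\<not> n < tau n K (K * (m + 1))"
  then have le: "tau n K k \<le> n" if "k \<le> K * (m + 1)" for k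
    using tau_mono[OF that] by (meson le_trans linorder_not_less)
  have step: "tau n K k + i * (tau n K k div K + 1) \<le> tau n K (k + i)" if "k + i \<le> K * (m + 1)" for k i
    using that
  proof (induction i)
    case (Suc i)
    have "tau n K k div K \<le> tau n K (k + i) div K" by (intro div_le_mono tau_mono) simp
    moreover have "tau n K (k + Suc i) = tau n K (k + i) + (tau n K (k + i) div K + 1)"
      using le[of "k + i"] Suc.prems by (simp add: delta_def)
    ultimately show ?case using Suc.IH Suc.prems by simp
  qed simp
  have double: "2 ^ j \<le> tau n K (1 + K * j)" if "1 + K * j \<le> K * (m + 1)" for j
    using that
  proof (induction j)
    case 0 show ?case by (simp add: delta_def)
  next
    case (Suc j)
    define t where "t = tau n K (1 + K * j)"
    have "t \<le> K * (t div K) + K" using assms(1)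
      by (metis add_le_cancel_left less_imp_le mod_less_divisor mult_div_mod_eq)
    then have "t + t \<le> t + K * (t div K + 1)" by simp
    also have "\<dots> \<le> tau n K (1 + K * j + K)" unfolding t_def by (rule step) (use Suc.prems in simp)
    finally have "2 * t \<le> tau n K (1 + K * Suc j)" by (simp add: add.commute add.left_commute)
    moreover have "2 ^ j \<le> t" unfolding t_def by (rule Suc.IH) (use Suc.prems in simp)
    ultimately show ?case by simp
  qed
  have "1 + K * m \<le> K * (m + 1)" using assms(1) by simp
  from double[OF this] le[OF this] assms(2) show False by simp
qed

context
  fixes n K m g :: nat
  assumes K: "0 < K" and n: "n < 2 ^ m" and g: "g = K * (m + 1)"
begin

lemma round_down_bounds:
  assumes "z \<le> n"
  shows "round_down n K g z \<le> z" "K * z \<le> (K + 1) * round_down n K g z"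
    "n < K \<Longrightarrow> round_down n K g z = z"
proof -
  define r where "r = round_down n K g z"
  have "z < tau n K g" using tau_large[OF K n] assms unfolding g by simp
  with round_down_cases[OF assms, of K g] have r: "r \<le> z" "z \<le> r + r div K" unfolding r_def by auto
  have "K * z \<le> K * (r + r div K)" using r(2) by (rule mult_le_mono2)
  also have "\<dots> \<le> (K + 1) * r" by (simp add: algebra_simps)
  finally show "K * z \<le> (K + 1) * round_down n K g z" unfolding r_def .
  show "round_down n K g z \<le> z" using r(1) unfolding r_def .
  assume "n < K"
  then have "r div K = 0" using r(1) assms by simp
  then show "round_down n K g z = z" using r unfolding r_def by simp
qed

definition "pivot_approx x y d p S =
  (\<Sum>v\<in>S. of_bool (x v < upper_x x d p \<and> lower_y x y d p \<le> y v) *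
     (round_down n K g (Fcount (2 ^ m) x y d p S (x v)) * round_down n K g (Gcount (2 ^ m) x y d p S (y v))))"

lemma pivot_approx_bounds:
  assumes "card S \<le> n"
  shows "pivot_approx x y d p S \<le> pivot_sum (2 ^ m) x y d p S"
    "K ^ 2 * pivot_sum (2 ^ m) x y d p S \<le> (K + 1) ^ 2 * pivot_approx x y d p S"
    "n < K \<Longrightarrow> pivot_approx x y d p S = pivot_sum (2 ^ m) x y d p S"
proof -
  have F: "Fcount (2 ^ m) x y d p S z \<le> n" and G: "Gcount (2 ^ m) x y d p S z \<le> n" for z
    unfolding Fcount_def Gcount_def using rect_le_card assms by (meson le_trans)+
  show "pivot_approx x y d p S \<le> pivot_sum (2 ^ m) x y d p S"
    unfolding pivot_approx_def pivot_sum_def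
    by (intro sum_mono mult_le_mono order_refl round_down_bounds F G)
  have prod: "K ^ 2 * (of_bool b * (u * v)) \<le> (K + 1) ^ 2 * (of_bool b * (u' * v'))"
    if "K * u \<le> (K + 1) * u'" "K * v \<le> (K + 1) * v'" for b u v u' v'
  proof -
    have "K ^ 2 * (u * v) = (K * u) * (K * v)" "(K + 1) ^ 2 * (u' * v') = ((K + 1) * u') * ((K + 1) * v')"
      by (simp_all only: power2_eq_square ac_simps)
    then have "K ^ 2 * (u * v) \<le> (K + 1) ^ 2 * (u' * v')" using mult_le_mono[OF that] by (simp only:)
    then show ?thesis by (cases b) (simp_all only: of_bool_eq mult_1 mult_zero_left mult_zero_right order_refl)
  qed
  show "K ^ 2 * pivot_sum (2 ^ m) x y d p S \<le> (K + 1) ^ 2 * pivot_approx x y d p S"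
    unfolding pivot_approx_def pivot_sum_def sum_distrib_left
    by (intro sum_mono prod round_down_bounds(2) F G)
  assume "n < K"
  then show "pivot_approx x y d p S = pivot_sum (2 ^ m) x y d p S"
    unfolding pivot_approx_def pivot_sum_def by (simp only: round_down_bounds(3)[OF F] round_down_bounds(3)[OF G])
qed

text \<open>After expanding both roundings, \<open>Fcount\<close> reaches its threshold exactly from
  \<open>s k\<close> on and \<open>Gcount\<close> exactly below \<open>t l\<close>. Summing over
  \<open>v\<close> first then gives one box count per pair of thresholds, weighted by the two
  increments.\<close>

lemma pivot_approx_thresholds:
  assumes "\<forall>v\<in>S. x v < Z \<and> y v < Z"
    and "\<forall>k<g. \<forall>z<Z. z < s k \<longleftrightarrow> Fcount (2 ^ m) x y d p S z < tau n K (Suc k)"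
    and "\<forall>l<g. \<forall>z<Z. z < t l \<longleftrightarrow> tau n K (Suc l) \<le> Gcount (2 ^ m) x y d p S z"
  shows "(\<Sum>k<g. \<Sum>l<g. delta n K (tau n K k) * delta n K (tau n K l) *
      rect S x y (s k) (upper_x x d p) (lower_y x y d p) (t l)) = pivot_approx x y d p S"
proof -
  let ?D = "\<lambda>k. delta n K (tau n K k)"
  have "pivot_approx x y d p S = (\<Sum>v\<in>S. \<Sum>k<g. \<Sum>l<g.
     of_bool (x v < upper_x x d p \<and> lower_y x y d p \<le> y v) *
      ((of_bool (tau n K (Suc k) \<le> Fcount (2 ^ m) x y d p S (x v)) * ?D k) *
       (of_bool (tau n K (Suc l) \<le> Gcount (2 ^ m) x y d p S (y v)) * ?D l)))"
    by (simp only: pivot_approx_def round_down_def mult_sums)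
  also have "\<dots> = (\<Sum>v\<in>S. \<Sum>k<g. \<Sum>l<g. ?D k * ?D l *
     of_bool (s k \<le> x v \<and> x v < upper_x x d p \<and> lower_y x y d p \<le> y v \<and> y v < t l))"
  proof (intro sum.cong refl)
    fix v k l assume "v \<in> S" "k \<in> {..<g}" "l \<in> {..<g}"
    then have "tau n K (Suc k) \<le> Fcount (2 ^ m) x y d p S (x v) \<longleftrightarrow> s k \<le> x v"
      "tau n K (Suc l) \<le> Gcount (2 ^ m) x y d p S (y v) \<longleftrightarrow> y v < t l"
      using assms by (auto simp flip: linorder_not_less)
    then show "of_bool (x v < upper_x x d p \<and> lower_y x y d p \<le> y v) *
      ((of_bool (tau n K (Suc k) \<le> Fcount (2 ^ m) x y d p S (x v)) * ?D k) *
       (of_bool (tau n K (Suc l) \<le> Gcount (2 ^ m) x y d p S (y v)) * ?D l)) = ?D k * ?D l *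
     of_bool (s k \<le> x v \<and> x v < upper_x x d p \<and> lower_y x y d p \<le> y v \<and> y v < t l)"
      by (simp only:) (auto simp: of_bool_def)
  qed
  also have "\<dots> = (\<Sum>k<g. \<Sum>v\<in>S. \<Sum>l<g. ?D k * ?D l *
     of_bool (s k \<le> x v \<and> x v < upper_x x d p \<and> lower_y x y d p \<le> y v \<and> y v < t l))"
    by (rule sum.swap)
  also have "\<dots> = (\<Sum>k<g. \<Sum>l<g. \<Sum>v\<in>S. ?D k * ?D l *
     of_bool (s k \<le> x v \<and> x v < upper_x x d p \<and> lower_y x y d p \<le> y v \<and> y v < t l))"
    by (intro sum.cong refl sum.swap)
  finally show ?thesis by (simp only: rect_def sum_distrib_left)
qed

end

text \<open>Finds, from the top bit down, how many numbers below \<open>2 ^ m - 1\<close> satisfy a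
  downward closed \<open>P\<close>. The outcome of a test enters as a factor, so the search needs no
  branching.\<close>

primrec bsearch :: "(nat \<Rightarrow> bool) \<Rightarrow> nat \<Rightarrow> nat \<Rightarrow> nat" where
  "bsearch P m 0 = 0"
| "bsearch P m (Suc i) = bsearch P m i + of_bool (P (bsearch P m i + 2 ^ (m - 1 - i) - 1)) * 2 ^ (m - 1 - i)"

text \<open>The answer lies between the current value \<open>b\<close> and
  \<open>b + 2 ^ (m - i) - 1\<close>. While no test has failed, this upper end is
  \<open>2 ^ m - 1\<close>, which is never tested; hence the guard on the last clause.\<close>

lemma bsearch_invariant:
  assumes "\<And>z z'. z \<le> z' \<Longrightarrow> P z' \<Longrightarrow> P z" "i \<le> m"
  shows "bsearch P m i + 2 ^ (m - i) \<le> 2 ^ m \<and> (\<forall>z < bsearch P m i. P z) \<and>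
    (bsearch P m i + 2 ^ (m - i) < 2 ^ m \<longrightarrow> \<not> P (bsearch P m i + 2 ^ (m - i) - 1))"
  using assms(2)
proof (induction i)
  case (Suc i)
  define b where "b = bsearch P m i"
  define q :: nat where "q = 2 ^ (m - 1 - i)"
  have "m - i = Suc (m - 1 - i)" using Suc.prems by simp
  then have q2: "(2::nat) ^ (m - i) = 2 * q" by (simp add: q_def)
  have q': "(2::nat) ^ (m - Suc i) = q" by (simp add: q_def)
  have q0: "0 < q" by (simp add: q_def)
  have IH: "b + 2 * q \<le> 2 ^ m" "\<forall>z<b. P z" "b + 2 * q < 2 ^ m \<longrightarrow> \<not> P (b + 2 * q - 1)"
    using Suc unfolding b_def q2 by auto
  show ?case
  proof (cases "P (b + q - 1)")
    case True
    then have "bsearch P m (Suc i) = b + q" by (simp add: b_def q_def)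
    moreover have "P z" if "z < b + q" for z using that assms(1)[OF _ True] by simp
    ultimately show ?thesis using IH q' by (simp add: add.assoc mult_2)
  next
    case False
    then have "bsearch P m (Suc i) = b" by (simp add: b_def q_def)
    then show ?thesis using IH q' False q0 by simp
  qed
qed simp

text \<open>The result cannot exceed \<open>2 ^ m - 1\<close>, so nothing is learnt about that
  number itself. This is why \<open>M\<close> is later taken above \<open>n + 1\<close> and not
  merely above \<open>n\<close>.\<close>

lemma bsearch_iff:
  assumes "\<And>z z'. z \<le> z' \<Longrightarrow> P z' \<Longrightarrow> P z" "z < 2 ^ m - 1"
  shows "z < bsearch P m m \<longleftrightarrow> P z"
proof -
  have *: "bsearch P m m + 1 \<le> 2 ^ m" "\<forall>z<bsearch P m m. P z"
     "bsearch P m m + 1 < 2 ^ m \<longrightarrow> \<not> P (bsearch P m m)"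
    using bsearch_invariant[of P m m, OF assms(1)] by auto
  show ?thesis
  proof
    assume "P z"
    show "z < bsearch P m m"
    proof (rule ccontr)
      assume "\<not> z < bsearch P m m"
      then show False using * assms(1)[OF _ \<open>P z\<close>, of "bsearch P m m"] assms(2) by simp
    qed
  qed (use * in simp)
qed

lemma bsearch_less:
  assumes "\<And>z z'. z \<le> z' \<Longrightarrow> P z' \<Longrightarrow> P z"
    and "i \<le> m"
  shows "bsearch P m i < 2 ^ m"
proof -
  have "bsearch P m i + 2 ^ (m - i) \<le> 2 ^ m" by (rule conjunct1[OF bsearch_invariant]) (use assms in blast)+
  moreover have "(0::nat) < 2 ^ (m - i)" by simp
  ultimately show ?thesis by linarith
qed

lemma card_copies_2413:
  "card (copies_2413 n \<pi>) = (\<Sum>a\<in>{1..n}. \<Sum>b\<in>{1..n}. \<Sum>c\<in>{1..n}. \<Sum>e\<in>{1..n}. of_bool (copy (\<lambda>q. q) \<pi> a b c e))"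
proof -
  let ?S = "{1..n}"
  let ?P = "\<lambda>q. case q of (a, b, c, e) \<Rightarrow> copy (\<lambda>q. q) \<pi> a b c e"
  let ?A = "?S \<times> ?S \<times> ?S \<times> ?S"
  have "copies_2413 n \<pi> = {q \<in> ?A. ?P q}"
    unfolding copies_2413_def copy_def by auto
  then have "card (copies_2413 n \<pi>) = (\<Sum>q\<in>{q \<in> ?A. ?P q}. 1)"
    by (simp only: card_eq_sum)
  also have "\<dots> = (\<Sum>q\<in>?A. if ?P q then 1 else 0)"
    by (rule sum.inter_filter) simp
  also have "\<dots> = (\<Sum>(a, b, c, e)\<in>?A. of_bool (copy (\<lambda>q. q) \<pi> a b c e))"
    by (intro sum.cong refl) (simp add: of_bool_def split: prod.split)
  finally show ?thesis by (simp only: sum.cartesian_product)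
qed

lemma card_copies_2413_le: "card (copies_2413 n \<pi>) \<le> n ^ 4"
proof -
  have "copies_2413 n \<pi> \<subseteq> {1..n} \<times> {1..n} \<times> {1..n} \<times> {1..n}" (is "_ \<subseteq> ?A")
    unfolding copies_2413_def by auto
  then have "card (copies_2413 n \<pi>) \<le> card ?A" by (rule card_mono[rotated]) simp
  also have "card ?A = n ^ 4" by (simp only: card_cartesian_product) (simp add: power4_eq_xxxx)
  finally show ?thesis .
qed

section \<open>The counting expression\<close>

lemma alu_Add: "x + y < 2 ^ w \<Longrightarrow> alu w Add x y = x + y"
  by (simp add: take_bit_nat_eq_self)

lemma alu_Sub: "y \<le> x \<Longrightarrow> x < 2 ^ w \<Longrightarrow> alu w Sub x y = x - y"
proof -
  assume *: "y \<le> x" "x < 2 ^ w"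
  then have e: "2 ^ w + x - y = 2 ^ w + (x - y)" by simp
  show ?thesis unfolding alu.simps e take_bit_eq_mod mod_add_self1 using * by simp
qed

lemma alu_Mul: "x * y < 2 ^ w \<Longrightarrow> alu w Mul x y = x * y"
  by (simp add: take_bit_nat_eq_self)

lemma alu_Shl: "x * 2 ^ y < 2 ^ w \<Longrightarrow> alu w Shl x y = x * 2 ^ y"
  by (simp add: take_bit_nat_eq_self push_bit_eq_mult)

lemma alu_Shr: "alu w Shr x y = x div 2 ^ y"
  by (simp add: drop_bit_eq_div)

lemma alu_Mul_of_bool: "x < 2 ^ w \<Longrightarrow> alu w Mul x (of_bool b) = of_bool b * x"
  by (cases b) (simp_all add: take_bit_nat_eq_self)

declare alu.simps(1-3) [simp del] alu.simps(9-10) [simp del]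

lemma reg_simps:
  "(r::nat) + 3 = Suc (Suc (Suc r))" "r + 4 = Suc (Suc (Suc (Suc r)))"
  "r + 5 = Suc (Suc (Suc (Suc (Suc r))))" "r + 6 = Suc (Suc (Suc (Suc (Suc (Suc r)))))"
  "r + 7 = Suc (Suc (Suc (Suc (Suc (Suc (Suc r))))))"
  by simp_all

definition sum_exp :: "nat \<Rightarrow> nat \<Rightarrow> exp \<Rightarrow> exp" where
  "sum_exp r i e = Loop i (N 0) (B Add e (V r))"

text \<open>Only congruence modulo \<open>2 ^ w\<close> is asked of the summands, and partial sums
  may wrap around; the exact value is recovered wherever a bound on the total is known.\<close>

lemma eval_sum_exp:
  assumes "\<And>k x. k < \<rho> i \<Longrightarrow> take_bit w (eval w \<mu> e (r + 2) (\<rho>(r := x, Suc r := k))) = take_bit w (f k)"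
  shows "eval w \<mu> (sum_exp r i e) r \<rho> = take_bit w (\<Sum>k<\<rho> i. f k)"
proof -
  define acc where "acc = rec_nat (0::nat) (\<lambda>k x. eval w \<mu> (B Add e (V r)) (r + 2) (\<rho>(r := x, Suc r := k)))"
  have "acc c = take_bit w (\<Sum>k<c. f k)" if "c \<le> \<rho> i" for c
    using that
  proof (induction c)
    case 0
    show ?case by (simp add: acc_def)
  next
    case (Suc c)
    have "acc (Suc c) = take_bit w (eval w \<mu> e (r + 2) (\<rho>(r := acc c, Suc r := c)) + acc c)"
      by (simp add: acc_def alu.simps(1))
    also have "\<dots> = take_bit w (f c + acc c)"
      using assms[of c "acc c"] Suc.prems unfolding take_bit_eq_mod by (metis Suc_le_lessD mod_add_left_eq)
    also have "\<dots> = take_bit w (\<Sum>k<Suc c. f k)"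
      using Suc by (simp add: take_bit_eq_mod mod_add_right_eq add.commute)
    finally show ?case .
  qed
  then show ?thesis by (simp add: sum_exp_def acc_def)
qed

definition sel :: "nat \<Rightarrow> exp \<Rightarrow> exp \<Rightarrow> exp" where
  "sel c e\<^sub>1 e\<^sub>2 = B Add (B Mul e\<^sub>1 (V c)) (B Mul e\<^sub>2 (B Sub (N 1) (V c)))"

text \<open>The operand that is not selected may have wrapped around, but it is multiplied by 0; so
  its value is not specified.\<close>

lemma eval_sel:
  assumes "\<rho> c = of_bool b" "c < r" "0 < w"
    "b \<Longrightarrow> eval w \<mu> e\<^sub>1 r \<rho> = v\<^sub>1 \<and> v\<^sub>1 < 2 ^ w"
    "\<And>x. \<not> b \<Longrightarrow> eval w \<mu> e\<^sub>2 (Suc r) (\<rho>(r := x)) = v\<^sub>2 \<and> v\<^sub>2 < 2 ^ w"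
  shows "eval w \<mu> (sel c e\<^sub>1 e\<^sub>2) r \<rho> = (if b then v\<^sub>1 else v\<^sub>2)"
proof -
  have "1 < (2::nat) ^ w" using assms(3) by (intro one_less_power) auto
  then have "alu w Sub (take_bit w (Suc 0)) (of_bool b) = of_bool (\<not> b)"
    using assms(3) by (cases b) (auto simp: alu_Sub)
  then show ?thesis using assms
    by (cases b) (simp_all add: sel_def alu.simps(1,3) take_bit_nat_eq_self)
qed

text \<open>Registers \<open>r\<close> to \<open>r + 3\<close> hold the value found so far, the
  round, the power of two on trial and the tested number; \<open>e\<close> is the test.\<close>

definition search_exp :: "nat \<Rightarrow> exp \<Rightarrow> exp" where
  "search_exp r e = Loop 4 (N 0)
     (Let (B Shl (N 1) (B Sub (B Sub (V 4) (N 1)) (V (r + 1))))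
     (Let (B Sub (B Add (V r) (V (r + 2))) (N 1))
       (B Add (B Mul e (V (r + 2))) (V r))))"

lemma eval_search_exp:
  assumes "\<rho> 4 = m" "4 < r" "0 < w" "2 * 2 ^ m < (2::nat) ^ w" "m < 2 ^ w"
    and mono: "\<And>z z'. z \<le> z' \<Longrightarrow> P z' \<Longrightarrow> P z"
    and e: "\<And>k x s z. z < 2 ^ m \<Longrightarrow>
      eval w \<mu> e (r + 4) (\<rho>(r := x, Suc r := k, r + 2 := s, r + 3 := z)) = of_bool (P z)"
  shows "eval w \<mu> (search_exp r e) r \<rho> = bsearch P m m"
proof -
  define body where "body =
     (Let (B Shl (N 1) (B Sub (B Sub (V 4) (N 1)) (V (r + 1))))
     (Let (B Sub (B Add (V r) (V (r + 2))) (N 1))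
       (B Add (B Mul e (V (r + 2))) (V r))))"
  define acc where "acc = rec_nat (0::nat) (\<lambda>k x. eval w \<mu> body (r + 2) (\<rho>(r := x, Suc r := k)))"
  have one: "take_bit w (Suc 0) = Suc 0" using assms(3) by simp
  have w1: "1 < (2::nat) ^ w" using assms(3) by (intro one_less_power) auto
  have "acc i = bsearch P m i" if "i \<le> m" for i
    using that
  proof (induction i)
    case (Suc i)
    define b where "b = bsearch P m i"
    define q :: nat where "q = 2 ^ (m - 1 - i)"
    have "m - i = Suc (m - 1 - i)" using Suc.prems by simp
    then have q2: "(2::nat) ^ (m - i) = 2 * q" by (simp add: q_def)
    have "b + 2 * q \<le> 2 ^ m"
      using conjunct1[OF bsearch_invariant[of P i m]] mono Suc.prems unfolding b_def q2 by simp
    moreover have "0 < q" by (simp add: q_def)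
    ultimately have bq: "b + q - 1 < 2 ^ m" "b + q < 2 ^ w" "b < 2 ^ w" "q < 2 ^ w" "0 < q"
      using assms(4) by linarith+
    have "eval w \<mu> body (r + 2) (\<rho>(r := b, Suc r := i)) = b + of_bool (P (b + q - 1)) * q"
    proof -
      have 1: "alu w Sub (alu w Sub m (Suc 0)) i = m - 1 - i"
        using Suc.prems assms(5) by (simp add: alu_Sub)
      have 2: "alu w Shl (Suc 0) (m - 1 - i) = q" using bq unfolding q_def by (simp add: alu_Shl)
      have 3: "alu w Sub (alu w Add b q) (Suc 0) = b + q - 1" using bq by (simp add: alu_Add alu_Sub)
      have 4: "alu w Mul (of_bool (P (b + q - 1))) q = of_bool (P (b + q - 1)) * q"
        using bq by (simp add: alu_Mul)
      have 5: "alu w Add (of_bool (P (b + q - 1)) * q) b = b + of_bool (P (b + q - 1)) * q"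
        using bq by (simp add: alu_Add)
      have "eval w \<mu> e (r + 4) (\<rho>(r := b, Suc r := i, r + 2 := q, r + 3 := b + q - 1)) =
          of_bool (P (b + q - 1))" by (rule e) (rule bq)
      then show ?thesis
        using assms(1-3) 1 2 3 4 5 unfolding body_def
        by (simp add: one reg_simps del: of_bool_eq_iff)
    qed
    then have "acc (Suc i) = b + of_bool (P (b + q - 1)) * q"
      using Suc unfolding acc_def b_def by simp
    then show ?case by (simp add: b_def q_def)
  qed (simp add: acc_def)
  then show ?thesis using assms(1) by (simp add: search_exp_def acc_def body_def)
qed

text \<open>
  The dyadic interval of level \<open>i\<close> that contains \<open>z\<close> has the number \<open>(z + 2 * M) div 2 ^ i\<close>, as in a
  binary heap; the offset makes numbers of different levels distinct. The numbers below \<open>x\<close> are the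
  disjoint union of the left siblings of the odd-numbered intervals that contain \<open>x\<close>.
\<close>

definition dom_exp :: "nat \<Rightarrow> nat \<Rightarrow> nat \<Rightarrow> exp" where
  "dom_exp r x y = sum_exp r 6 (sum_exp (r + 2) 6
     (Let (B Shr (B Add (V x) (B Mul (N 2) (V 5))) (V (r + 1)))
     (Let (B Shr (B Add (V y) (B Mul (N 2) (V 5))) (V (r + 3)))
       (B Mul (B Mul (Ld (B Add (B Mul (B Sub (V (r + 4)) (N 1)) (B Mul (N 4) (V 5))) (B Sub (V (r + 5)) (N 1))))
          (B Mod (V (r + 4)) (N 2))) (B Mod (V (r + 5)) (N 2))))))"

text \<open>\<open>16 * M * M\<close> bounds the table addresses, made of two node numbers below
  \<open>4 * M\<close>; \<open>n ^ 4\<close> bounds the final count.\<close>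

locale parameters =
  fixes w n m M K :: nat and \<pi> :: "nat \<Rightarrow> nat"
  assumes perm: "\<And>q. q \<in> {1..n} \<Longrightarrow> \<pi> q \<in> {1..n}"
    and m: "n + 1 < M" and M: "M = 2 ^ m"
    and w: "16 * M * M < 2 ^ w" "n ^ 4 < 2 ^ w"
    and K: "0 < K" "K < 2 ^ w" "K * (m + 1) < 2 ^ w"
begin

abbreviation "S \<equiv> {1..n}"
abbreviation "g \<equiv> K * (m + 1)"

lemma w0: "0 < w"
proof (rule ccontr)
  assume "\<not> 0 < w"
  then show False using w(1) m by simp
qed

lemma M_less: "16 * M < 2 ^ w" "M * 16 * M < 2 ^ w" "n < M" "n + 1 < M" "m < 2 ^ w" "K < 2 ^ w"
proof -
  have "16 * M \<le> 16 * M * M" using m by simp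
  then show "16 * M < 2 ^ w" using w(1) by (rule le_less_trans)
  moreover have "m < M" unfolding M by (rule less_exp)
  ultimately show "m < 2 ^ w" by linarith
qed (use w(1) m K in \<open>auto simp: ac_simps\<close>)

lemma w4: "4 < w"
proof -
  have "(2::nat) ^ 4 \<le> 16 * M" using m by simp
  then have "2 ^ 4 < (2::nat) ^ w" using M_less(1) by (rule le_less_trans)
  then show ?thesis by (rule power_less_imp_less_exp[rotated]) simp
qed

lemma numerals: "take_bit w (Suc 0) = Suc 0" "take_bit w 2 = (2::nat)" "take_bit w 4 = (4::nat)"
proof -
  have "16 \<le> 16 * M" using m by simp
  then have "16 < (2::nat) ^ w" using M_less(1) by linarith
  then show "take_bit w (Suc 0) = Suc 0" "take_bit w 2 = (2::nat)" "take_bit w 4 = (4::nat)"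
    by (intro take_bit_nat_eq_self; linarith)+
qed

text \<open>
  Registers 0 to 9 hold \<open>n\<close>, \<open>a\<close>, \<open>b\<close>, \<open>n + 1\<close>, \<open>m\<close>, \<open>M\<close>, \<open>m + 1\<close>, \<open>K\<close>, the number \<open>K * (m + 1)\<close> of
  thresholds, and 2.
\<close>

definition glob :: "(nat \<Rightarrow> nat) \<Rightarrow> bool" where
  "glob \<rho> \<longleftrightarrow> \<rho> 0 = n \<and> \<rho> 3 = n + 1 \<and> \<rho> 4 = m \<and> \<rho> 5 = M \<and> \<rho> 6 = m + 1 \<and> \<rho> 7 = K \<and> \<rho> 8 = g \<and> \<rho> 9 = 2"

lemma glob_upd: "glob \<rho> \<Longrightarrow> 10 \<le> i \<Longrightarrow> glob (\<rho>(i := x))"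
  by (auto simp: glob_def)

lemma shift_div: "i < m + 1 \<Longrightarrow> (z + 2 * M) div 2 ^ i = z div 2 ^ i + 2 ^ (m + 1 - i)"
proof -
  assume "i < m + 1"
  then have "2 * M = 2 ^ (m + 1 - i) * 2 ^ i" unfolding M by (simp flip: power_add power_Suc)
  then show ?thesis by simp
qed

end

text \<open>The memory once the table is built. It is specified at genuine node numbers only: those
  of level \<open>i\<close> run from \<open>2 ^ (m + 1 - i)\<close> to
  \<open>2 ^ (m + 2 - i) - 1\<close>.\<close>

locale algorithm = parameters +
  fixes \<mu> :: "nat \<Rightarrow> nat"
  assumes input: "\<And>q. q \<in> {1..n} \<Longrightarrow> \<mu> q = \<pi> q"
    and tab: "\<And>i j u v. i < m + 1 \<Longrightarrow> j < m + 1 \<Longrightarrow>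
      2 ^ (m + 1 - i) \<le> u \<Longrightarrow> u < 2 ^ (m + 2 - i) \<Longrightarrow> 2 ^ (m + 1 - j) \<le> v \<Longrightarrow> v < 2 ^ (m + 2 - j) \<Longrightarrow>
      \<mu> (u * (4 * M) + v) =
        (\<Sum>q\<in>{1..n}. of_bool ((q + 2 * M) div 2 ^ i = u \<and> (\<pi> q + 2 * M) div 2 ^ j = v))"
begin

text \<open>By \<open>sum_sep\<close> in each coordinate, dominance is a double sum over levels of
  products of \<open>sep\<close> indicators, and each pair of levels is one table entry, at the left
  siblings \<open>U - 1\<close> and \<open>W - 1\<close>. There are \<open>m + 1\<close> levels
  because a bound may equal \<open>2 ^ m\<close>.\<close>

lemma eval_dom_exp:
  assumes "glob \<rho>" "10 \<le> r" "x < r" "y < r" "\<rho> x \<le> M" "\<rho> y \<le> M"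
  shows "eval w \<mu> (dom_exp r x y) r \<rho> = rect S (\<lambda>q. q) \<pi> 0 (\<rho> x) 0 (\<rho> y)"
proof -
  let ?X = "\<rho> x" and ?Y = "\<rho> y"
  define f where "f i j = (\<Sum>q\<in>S. of_bool (sep i q ?X) * of_bool (sep j (\<pi> q) ?Y) :: nat)" for i j
  have g: "\<rho> 5 = M" "\<rho> 6 = m + 1" using assms(1) by (auto simp: glob_def)
  have "eval w \<mu> (dom_exp r x y) r \<rho> = take_bit w (\<Sum>i<\<rho> 6. \<Sum>j<\<rho> 6. f i j)"
    unfolding dom_exp_def
  proof (rule eval_sum_exp, goal_cases)
    case (1 i a)
    have "eval w \<mu> (sum_exp (r + 2) 6
     (Let (B Shr (B Add (V x) (B Mul (N 2) (V 5))) (V (r + 1)))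
     (Let (B Shr (B Add (V y) (B Mul (N 2) (V 5))) (V (r + 3)))
       (B Mul (B Mul (Ld (B Add (B Mul (B Sub (V (r + 4)) (N 1)) (B Mul (N 4) (V 5))) (B Sub (V (r + 5)) (N 1))))
          (B Mod (V (r + 4)) (N 2))) (B Mod (V (r + 5)) (N 2)))))) (r + 2) (\<rho>(r := a, Suc r := i)) =
      take_bit w (\<Sum>j<(\<rho>(r := a, Suc r := i)) 6. f i j)"
    proof (rule eval_sum_exp, goal_cases)
      case (1 j b)
      have ij: "i < m + 1" "j < m + 1" using 1 \<open>i < \<rho> 6\<close> g assms(2) by auto
      define U where "U = (?X + 2 * M) div 2 ^ i"
      define W where "W = (?Y + 2 * M) div 2 ^ j"
      define t where "t = \<mu> ((U - 1) * (4 * M) + (W - 1))"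
      have U: "U = ?X div 2 ^ i + 2 ^ (m + 1 - i)" and W: "W = ?Y div 2 ^ j + 2 ^ (m + 1 - j)"
        using shift_div ij by (auto simp: U_def W_def)
      have "1 \<le> U" "1 \<le> W" unfolding U W by (simp_all add: add.commute trans_le_add1)
      have UW: "U \<le> ?X + 2 * M" "W \<le> ?Y + 2 * M" unfolding U_def W_def by (rule div_le_dividend)+
      then have UW4: "U < 4 * M" "W < 4 * M" using assms(5,6) M_less(3) by linarith+
      have addr: "(U - 1) * (4 * M) + (W - 1) < 2 ^ w"
      proof -
        have "(U - 1) * (4 * M) + (W - 1) < (U - 1) * (4 * M) + 1 * (4 * M)" using UW4 \<open>1 \<le> W\<close> by linarith
        also have "\<dots> = U * (4 * M)" using \<open>1 \<le> U\<close> by (cases U) simp_all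
        also have "\<dots> \<le> 4 * M * (4 * M)" using UW4 by (intro mult_le_mono) auto
        also have "\<dots> < 2 ^ w" using w(1) by (simp add: ac_simps)
        finally show ?thesis .
      qed
      \<comment> \<open>If a node is even, the cell read may lie outside the specified part of the
        table; the factors \<open>U mod 2\<close> and \<open>W mod 2\<close> discard it.\<close>
      have val: "of_bool (odd W) * (of_bool (odd U) * t) = f i j"
      proof (cases "odd U \<and> odd W")
        case True
        have eU: "even (2 ^ (m + 1 - i) :: nat)" and eW: "even (2 ^ (m + 1 - j) :: nat)" using ij by auto
        have oX: "odd (?X div 2 ^ i)" and oY: "odd (?Y div 2 ^ j)" using True eU eW unfolding U W by auto
        have pX: "(2::nat) ^ (m + 2 - i) = 2 * 2 ^ (m + 1 - i)" and pY: "(2::nat) ^ (m + 2 - j) = 2 * 2 ^ (m + 1 - j)"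
          using ij by (simp_all add: Suc_diff_le)
        have lX: "?X div 2 ^ i < 2 ^ (m + 1 - i)" and lY: "?Y div 2 ^ j < 2 ^ (m + 1 - j)"
        proof -
          have "2 * M = 2 ^ (m + 1 - i) * 2 ^ i" "2 * M = 2 ^ (m + 1 - j) * 2 ^ j"
            using ij unfolding M by (simp_all flip: power_add power_Suc)
          moreover have "?X < 2 * M" "?Y < 2 * M" using assms(5,6) M_less(3) by linarith+
          ultimately have "?X < 2 ^ (m + 1 - i) * 2 ^ i" "?Y < 2 ^ (m + 1 - j) * 2 ^ j" by simp_all
          then show "?X div 2 ^ i < 2 ^ (m + 1 - i)" "?Y div 2 ^ j < 2 ^ (m + 1 - j)"
            by (simp_all add: less_mult_imp_div_less)
        qed
        have "t = (\<Sum>q\<in>S. of_bool ((q + 2 * M) div 2 ^ i = U - 1 \<and> (\<pi> q + 2 * M) div 2 ^ j = W - 1))"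
        proof -
          have "1 \<le> ?X div 2 ^ i" "1 \<le> ?Y div 2 ^ j" using odd_pos[OF oX] odd_pos[OF oY] by linarith+
          then have "2 ^ (m + 1 - i) \<le> U - 1" "U - 1 < 2 ^ (m + 2 - i)" "2 ^ (m + 1 - j) \<le> W - 1" "W - 1 < 2 ^ (m + 2 - j)"
            using lX lY unfolding U W pX pY by linarith+
          then show ?thesis unfolding t_def by (rule tab[OF ij])
        qed
        also have "\<dots> = f i j"
          unfolding f_def
        proof (intro sum.cong refl)
          fix q assume "q \<in> S"
          have "(q + 2 * M) div 2 ^ i = U - 1 \<longleftrightarrow> sep i q ?X"
            using oX unfolding sep_def U shift_div[OF ij(1)] by (auto elim: oddE)
          moreover have "(\<pi> q + 2 * M) div 2 ^ j = W - 1 \<longleftrightarrow> sep j (\<pi> q) ?Y"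
            using oY unfolding sep_def W shift_div[OF ij(2)] by (auto elim: oddE)
          ultimately show "of_bool ((q + 2 * M) div 2 ^ i = U - 1 \<and> (\<pi> q + 2 * M) div 2 ^ j = W - 1) =
            of_bool (sep i q ?X) * (of_bool (sep j (\<pi> q) ?Y) :: nat)" by simp
        qed
        finally show ?thesis using True by simp
      next
        case False
        then have "\<not> (odd (?X div 2 ^ i) \<and> odd (?Y div 2 ^ j))" using ij unfolding U W by auto
        then have "f i j = 0" unfolding f_def sep_def by auto
        then show ?thesis using False by auto
      qed
      have idx: "x \<noteq> r" "y \<noteq> r" "x \<noteq> Suc r" "y \<noteq> Suc r" "x < r + 2" "y < r + 2" using assms by auto
      have e1: "alu w Mul 2 M = 2 * M" "alu w Mul 4 M = 4 * M" using M_less(1) by (simp_all add: alu_Mul)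
      have e2: "alu w Add ?X (2 * M) = ?X + 2 * M" "alu w Add ?Y (2 * M) = ?Y + 2 * M"
        using M_less(1) assms(5,6) by (simp_all add: alu_Add)
      have e3: "alu w Shr (?X + 2 * M) i = U" "alu w Shr (?Y + 2 * M) j = W" by (simp_all add: alu_Shr U_def W_def)
      have e4: "alu w Sub U (Suc 0) = U - 1" "alu w Sub W (Suc 0) = W - 1"
        using UW4 M_less(1) \<open>1 \<le> U\<close> \<open>1 \<le> W\<close> by (simp_all add: alu_Sub)
      have e5: "alu w Mul (U - 1) (4 * M) = (U - 1) * (4 * M)"
        "alu w Add ((U - 1) * (4 * M)) (W - 1) = (U - 1) * (4 * M) + (W - 1)"
        using addr by (simp_all add: alu_Mul alu_Add)
      have e6: "take_bit w (alu w Mul (alu w Mul t (U mod 2)) (W mod 2)) = take_bit w (of_bool (odd W) * (of_bool (odd U) * t))"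
        by (cases "odd U"; cases "odd W") (simp_all add: alu.simps(3) odd_iff_mod_2_eq_one even_iff_mod_2_eq_zero)
      show ?case
        using idx g assms(2) e6 val
        using w4 by (simp add: reg_simps numerals e1 e2 e3 e4 e5[unfolded One_nat_def] t_def)
    qed
    then show ?case using assms(2) by simp
  qed
  also have "(\<Sum>i<\<rho> 6. \<Sum>j<\<rho> 6. f i j) = rect S (\<lambda>q. q) \<pi> 0 ?X 0 ?Y"
  proof -
    have "(\<Sum>i<m+1. \<Sum>j<m+1. f i j) = (\<Sum>q\<in>S. (\<Sum>i<m+1. of_bool (sep i q ?X)) * (\<Sum>j<m+1. of_bool (sep j (\<pi> q) ?Y)))"
    proof -
      have "(\<Sum>i<m+1. \<Sum>j<m+1. f i j) = (\<Sum>i<m+1. \<Sum>q\<in>S. \<Sum>j<m+1. of_bool (sep i q ?X) * of_bool (sep j (\<pi> q) ?Y))"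
        unfolding f_def by (intro sum.cong refl sum.swap)
      also have "\<dots> = (\<Sum>q\<in>S. \<Sum>i<m+1. \<Sum>j<m+1. of_bool (sep i q ?X) * of_bool (sep j (\<pi> q) ?Y))"
        by (rule sum.swap)
      finally show ?thesis by (simp only: sum_product)
    qed
    also have "\<dots> = rect S (\<lambda>q. q) \<pi> 0 ?X 0 ?Y"
      unfolding rect_def
    proof (intro sum.cong refl)
      fix q assume q: "q \<in> S"
      have "q < 2 ^ (m + 1)" "\<pi> q < 2 ^ (m + 1)" "?X < 2 ^ (m + 1)" "?Y < 2 ^ (m + 1)"
        using q perm[OF q] m assms(5,6) M by auto
      then show "(\<Sum>i<m+1. of_bool (sep i q ?X)) * (\<Sum>j<m+1. of_bool (sep j (\<pi> q) ?Y)) =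
          (of_bool (0 \<le> q \<and> q < ?X \<and> 0 \<le> \<pi> q \<and> \<pi> q < ?Y) :: nat)"
        by (simp only: sum_sep) simp
    qed
    finally show ?thesis unfolding g .
  qed
  also have "take_bit w (rect S (\<lambda>q. q) \<pi> 0 ?X 0 ?Y) = rect S (\<lambda>q. q) \<pi> 0 ?X 0 ?Y"
    using rect_le_card[of S "\<lambda>q. q" \<pi> 0 ?X 0 ?Y] M_less by (simp add: take_bit_nat_eq_self)
  finally show ?thesis .
qed

end

text \<open>Half-open intervals stay half-open: \<open>[a, b)\<close> corresponds to
  \<open>[M - b, M - a)\<close>. Queries on the rotated set can thus be answered from the same
  table.\<close>

lemma rect_mirror:
  assumes "\<forall>q\<in>S. x q < M \<and> y q < M" "a \<le> M" "b \<le> M" "c \<le> M" "d \<le> M"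
  shows "rect S (\<lambda>q. mirror M (x q)) (\<lambda>q. mirror M (y q)) a b c d = rect S x y (M - b) (M - a) (M - d) (M - c)"
  unfolding rect_def
proof (intro sum.cong refl arg_cong[of _ _ of_bool])
  have *: "(a \<le> mirror M z \<and> mirror M z < b) = (M - b \<le> z \<and> z < M - a)" if "z < M" "a \<le> M" "b \<le> M" for z a b
    using that unfolding mirror_def by linarith
  fix q assume "q \<in> S"
  then show "(a \<le> mirror M (x q) \<and> mirror M (x q) < b \<and> c \<le> mirror M (y q) \<and> mirror M (y q) < d) =
    (M - b \<le> x q \<and> x q < M - a \<and> M - d \<le> y q \<and> y q < M - c)"
    using *[of "x q" a b] *[of "y q" c d] assms by blast
qed

lemma eval_LetI:
  "eval w \<mu> a r \<rho> = v \<Longrightarrow> eval w \<mu> b (Suc r) (\<rho>(r := v)) = u \<Longrightarrow> eval w \<mu> (Let a b) r \<rho> = u"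
  by simp

text \<open>Registers \<open>r\<close> to \<open>r + 3\<close> hold the box in unrotated
  coordinates, \<open>r + 4\<close> to \<open>r + 7\<close> its corner counts. The factors
  \<open>Lt\<close> give 0 for reversed boxes, where inclusion-exclusion breaks down; these do
  occur, as the searches test numbers on both sides of the fixed ends.\<close>

definition rng_exp :: "nat \<Rightarrow> nat \<Rightarrow> nat \<Rightarrow> nat \<Rightarrow> nat \<Rightarrow> exp" where
  "rng_exp r a b c d =
    Let (sel 13 (B Sub (V 5) (V b)) (V a))
    (Let (sel 13 (B Sub (V 5) (V a)) (V b))
    (Let (sel 13 (B Sub (V 5) (V d)) (V c))
    (Let (sel 13 (B Sub (V 5) (V c)) (V d))
    (Let (dom_exp (r + 4) (r + 1) (r + 3))
    (Let (dom_exp (r + 5) r (r + 2))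
    (Let (dom_exp (r + 6) r (r + 3))
    (Let (dom_exp (r + 7) (r + 1) (r + 2))
      (B Mul (B Mul (B Sub (B Add (V (r + 4)) (V (r + 5))) (B Add (V (r + 6)) (V (r + 7))))
        (Lt (V r) (V (r + 1)))) (Lt (V (r + 2)) (V (r + 3)))))))))))"

context algorithm
begin

definition coord :: "bool \<Rightarrow> nat \<Rightarrow> nat" where
  "coord \<sigma> z = (if \<sigma> then mirror M z else z)"

lemma S_less: "q \<in> S \<Longrightarrow> q < M - 1 \<and> \<pi> q < M - 1 \<and> 0 < q \<and> 0 < \<pi> q"
  using perm[of q] m by auto

text \<open>The bound survives mirroring because positions and values start at 1.\<close>

lemma coord_less: "q \<in> S \<Longrightarrow> coord \<sigma> q < M - 1 \<and> coord \<sigma> (\<pi> q) < M - 1"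
  using S_less[of q] unfolding coord_def mirror_def by auto

abbreviation "rng \<sigma> \<equiv> rect S (\<lambda>q. coord \<sigma> q) (\<lambda>q. coord \<sigma> (\<pi> q))"

lemma eval_rng_exp:
  assumes "glob \<rho>" "14 \<le> r" "a < r" "b < r" "c < r" "d < r" "\<rho> 13 = of_bool \<sigma>"
    "\<rho> a \<le> M" "\<rho> b \<le> M" "\<rho> c \<le> M" "\<rho> d \<le> M"
  shows "eval w \<mu> (rng_exp r a b c d) r \<rho> = rng \<sigma> (\<rho> a) (\<rho> b) (\<rho> c) (\<rho> d)"
proof -
  let ?D = "\<lambda>x y. rect S (\<lambda>q. q) \<pi> 0 x 0 y"
  define x\<^sub>1 where "x\<^sub>1 = (if \<sigma> then M - \<rho> b else \<rho> a)"
  define x\<^sub>2 where "x\<^sub>2 = (if \<sigma> then M - \<rho> a else \<rho> b)"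
  define y\<^sub>1 where "y\<^sub>1 = (if \<sigma> then M - \<rho> d else \<rho> c)"
  define y\<^sub>2 where "y\<^sub>2 = (if \<sigma> then M - \<rho> c else \<rho> d)"
  define \<rho>\<^sub>1 where "\<rho>\<^sub>1 = \<rho>(r := x\<^sub>1)"
  define \<rho>\<^sub>2 where "\<rho>\<^sub>2 = \<rho>\<^sub>1(Suc r := x\<^sub>2)"
  define \<rho>\<^sub>3 where "\<rho>\<^sub>3 = \<rho>\<^sub>2(Suc (Suc r) := y\<^sub>1)"
  define \<rho>\<^sub>4 where "\<rho>\<^sub>4 = \<rho>\<^sub>3(Suc (Suc (Suc r)) := y\<^sub>2)"
  define \<rho>\<^sub>5 where "\<rho>\<^sub>5 = \<rho>\<^sub>4(r + 4 := ?D x\<^sub>2 y\<^sub>2)"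
  define \<rho>\<^sub>6 where "\<rho>\<^sub>6 = \<rho>\<^sub>5(r + 5 := ?D x\<^sub>1 y\<^sub>1)"
  define \<rho>\<^sub>7 where "\<rho>\<^sub>7 = \<rho>\<^sub>6(r + 6 := ?D x\<^sub>1 y\<^sub>2)"
  define \<rho>\<^sub>8 where "\<rho>\<^sub>8 = \<rho>\<^sub>7(r + 7 := ?D x\<^sub>2 y\<^sub>1)"
  note defs = \<rho>\<^sub>1_def \<rho>\<^sub>2_def \<rho>\<^sub>3_def \<rho>\<^sub>4_def \<rho>\<^sub>5_def \<rho>\<^sub>6_def \<rho>\<^sub>7_def \<rho>\<^sub>8_def
  have Mw: "M < 2 ^ w" using M_less(1) by simp
  have le: "x\<^sub>1 \<le> M" "x\<^sub>2 \<le> M" "y\<^sub>1 \<le> M" "y\<^sub>2 \<le> M"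
    using assms(8-11) by (auto simp: x\<^sub>1_def x\<^sub>2_def y\<^sub>1_def y\<^sub>2_def)
  have g: "\<rho> 5 = M" using assms(1) by (simp add: glob_def)
  have gl: "glob \<rho>\<^sub>4" "glob \<rho>\<^sub>5" "glob \<rho>\<^sub>6" "glob \<rho>\<^sub>7"
    using assms(1,2) by (auto simp: defs intro!: glob_upd)
  have s1: "eval w \<mu> (sel 13 (B Sub (V 5) (V b)) (V a)) r \<rho> = x\<^sub>1" unfolding x\<^sub>1_def
    by (rule eval_sel[where \<rho> = \<rho>]) (use assms g w0 Mw in \<open>auto simp: alu_Sub\<close>)
  have s2: "eval w \<mu> (sel 13 (B Sub (V 5) (V a)) (V b)) (Suc r) \<rho>\<^sub>1 = x\<^sub>2" unfolding x\<^sub>2_def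
    by (rule eval_sel[where \<rho> = \<rho>\<^sub>1]) (use assms g w0 Mw in \<open>auto simp: alu_Sub \<rho>\<^sub>1_def\<close>)
  have s3: "eval w \<mu> (sel 13 (B Sub (V 5) (V d)) (V c)) (Suc (Suc r)) \<rho>\<^sub>2 = y\<^sub>1" unfolding y\<^sub>1_def
    by (rule eval_sel[where \<rho> = \<rho>\<^sub>2]) (use assms g w0 Mw in \<open>auto simp: alu_Sub \<rho>\<^sub>1_def \<rho>\<^sub>2_def\<close>)
  have s4: "eval w \<mu> (sel 13 (B Sub (V 5) (V c)) (V d)) (Suc (Suc (Suc r))) \<rho>\<^sub>3 = y\<^sub>2" unfolding y\<^sub>2_def
    by (rule eval_sel[where \<rho> = \<rho>\<^sub>3]) (use assms g w0 Mw in \<open>auto simp: alu_Sub \<rho>\<^sub>1_def \<rho>\<^sub>2_def \<rho>\<^sub>3_def\<close>)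
  have d1: "eval w \<mu> (dom_exp (r + 4) (r + 1) (r + 3)) (r + 4) \<rho>\<^sub>4 = ?D x\<^sub>2 y\<^sub>2"
    by (subst eval_dom_exp[OF gl(1)]) (use le assms(2) in \<open>auto simp: defs reg_simps\<close>)
  have d2: "eval w \<mu> (dom_exp (r + 5) r (r + 2)) (r + 5) \<rho>\<^sub>5 = ?D x\<^sub>1 y\<^sub>1"
    by (subst eval_dom_exp[OF gl(2)]) (use le assms(2) in \<open>auto simp: defs reg_simps\<close>)
  have d3: "eval w \<mu> (dom_exp (r + 6) r (r + 3)) (r + 6) \<rho>\<^sub>6 = ?D x\<^sub>1 y\<^sub>2"
    by (subst eval_dom_exp[OF gl(3)]) (use le assms(2) in \<open>auto simp: defs reg_simps\<close>)
  have d4: "eval w \<mu> (dom_exp (r + 7) (r + 1) (r + 2)) (r + 7) \<rho>\<^sub>7 = ?D x\<^sub>2 y\<^sub>1"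
    by (subst eval_dom_exp[OF gl(4)]) (use le assms(2) in \<open>auto simp: defs reg_simps\<close>)
  define E where "E = B Mul (B Mul (B Sub (B Add (V (r + 4)) (V (r + 5))) (B Add (V (r + 6)) (V (r + 7))))
        (Lt (V r) (V (r + 1)))) (Lt (V (r + 2)) (V (r + 3)))"
  have "eval w \<mu> (rng_exp r a b c d) r \<rho> = eval w \<mu> E (r + 8) \<rho>\<^sub>8"
  proof -
    have n: "r + 8 = Suc (r + 7)" "r + 7 = Suc (r + 6)" "r + 6 = Suc (r + 5)" "r + 5 = Suc (r + 4)"
      "r + 4 = Suc (Suc (Suc (Suc r)))" by simp_all
    show ?thesis
      unfolding rng_exp_def E_def[symmetric]
      apply (rule eval_LetI[OF s1], rule eval_LetI[OF s2[unfolded \<rho>\<^sub>1_def]])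
      apply (rule eval_LetI[OF s3[unfolded \<rho>\<^sub>2_def \<rho>\<^sub>1_def]])
      apply (rule eval_LetI[OF s4[unfolded \<rho>\<^sub>3_def \<rho>\<^sub>2_def \<rho>\<^sub>1_def]])
      unfolding \<rho>\<^sub>1_def[symmetric] \<rho>\<^sub>2_def[symmetric] \<rho>\<^sub>3_def[symmetric] \<rho>\<^sub>4_def[symmetric] n(5)[symmetric]
      apply (rule eval_LetI[OF d1])
      unfolding \<rho>\<^sub>5_def[symmetric] n(4)[symmetric]
      apply (rule eval_LetI[OF d2])
      unfolding \<rho>\<^sub>6_def[symmetric] n(3)[symmetric]
      apply (rule eval_LetI[OF d3])
      unfolding \<rho>\<^sub>7_def[symmetric] n(2)[symmetric]
      apply (rule eval_LetI[OF d4])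
      unfolding \<rho>\<^sub>8_def[symmetric] n(1)[symmetric] by (rule refl)
  qed
  also have "\<dots> = of_bool (y\<^sub>1 < y\<^sub>2) * (of_bool (x\<^sub>1 < x\<^sub>2) *
      alu w Sub (alu w Add (?D x\<^sub>2 y\<^sub>2) (?D x\<^sub>1 y\<^sub>1)) (alu w Add (?D x\<^sub>1 y\<^sub>2) (?D x\<^sub>2 y\<^sub>1)))"
  proof -
    have a: "alu w Sub u v < 2 ^ w" for u v by (simp add: alu.simps(2))
    then have "of_bool b * alu w Sub u v < 2 ^ w" for b u v by (cases b) auto
    then show ?thesis using a
      by (simp only: E_def eval.simps defs fun_upd_apply) (simp add: alu_Mul_of_bool)
  qed
  also have "\<dots> = rect S (\<lambda>q. q) \<pi> x\<^sub>1 x\<^sub>2 y\<^sub>1 y\<^sub>2"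
  proof (cases "x\<^sub>1 < x\<^sub>2 \<and> y\<^sub>1 < y\<^sub>2")
    case True
    have D: "?D u v \<le> n" for u v using rect_le_card[of S] by simp
    have D2: "?D u v + ?D u' v' < 2 ^ w" for u v u' v'
      using D[of u v] D[of u' v'] M_less by linarith
    have c: "rect S (\<lambda>q. q) \<pi> x\<^sub>1 x\<^sub>2 y\<^sub>1 y\<^sub>2 + (?D x\<^sub>1 y\<^sub>2 + ?D x\<^sub>2 y\<^sub>1) = ?D x\<^sub>2 y\<^sub>2 + ?D x\<^sub>1 y\<^sub>1"
      by (rule rect_corners) (use True in auto)
    have sub: "alu w Sub u v = z" if "z + v = u" "u < 2 ^ w" for u v z
      unfolding that(1)[symmetric] by (subst alu_Sub) (use that in simp_all)
    have "alu w Sub (?D x\<^sub>2 y\<^sub>2 + ?D x\<^sub>1 y\<^sub>1) (?D x\<^sub>1 y\<^sub>2 + ?D x\<^sub>2 y\<^sub>1) = rect S (\<lambda>q. q) \<pi> x\<^sub>1 x\<^sub>2 y\<^sub>1 y\<^sub>2"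
      by (rule sub[OF c D2])
    then show ?thesis using True by (simp only: alu_Add[OF D2] of_bool_eq mult_1 simp_thms)
  qed (auto simp: rect_empty)
  also have "\<dots> = rng \<sigma> (\<rho> a) (\<rho> b) (\<rho> c) (\<rho> d)"
  proof (cases \<sigma>)
    case True
    have "\<forall>q\<in>S. q < M \<and> \<pi> q < M" using S_less by fastforce
    from rect_mirror[of S "\<lambda>q. q" M \<pi>, OF this assms(8-11)] show ?thesis
      using True by (simp add: coord_def x\<^sub>1_def x\<^sub>2_def y\<^sub>1_def y\<^sub>2_def)
  qed (simp add: coord_def x\<^sub>1_def x\<^sub>2_def y\<^sub>1_def y\<^sub>2_def)
  finally show ?thesis .
qed

end

text \<open>
  In the main loops, registers 11, 13 and 15 hold \<open>p - 1\<close>, the bit that selects the rotated point set,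
  and the level \<open>d\<close>; registers 16 to 27 hold the coordinates of \<open>p\<close>, the bit that tells the half of \<open>p\<close>,
  the left end and the middle of its interval, \<open>upper_x\<close>, \<open>lower_x\<close>, \<open>lower_y\<close>, \<open>upper_y\<close>, \<open>lower_y'\<close>,
  \<open>upper_y'\<close>, and a bit that suppresses the left half of the rotated set, whose copies are counted
  already. Registers 29 and 31 number the thresholds for \<open>F\<close> and \<open>G\<close>.
\<close>

definition delta_exp :: "nat \<Rightarrow> exp" where
  "delta_exp t = B Mul (B Add (B Div (V t) (V 7)) (N 1)) (Lt (V t) (V 3))"

text \<open>A loop may only count up to a register below \<open>r\<^sub>0\<close>, so it always
  makes \<open>K * (m + 1)\<close> rounds; the factor \<open>Lt\<close> freezes the value after as
  many rounds as register \<open>i\<close> says.\<close>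

definition tau_exp :: "nat \<Rightarrow> nat \<Rightarrow> exp" where
  "tau_exp r i = Loop 8 (N 0) (B Add (B Mul (delta_exp r) (Lt (V (Suc r)) (V i))) (V r))"

text \<open>Registers 32 to 34 hold a threshold for \<open>F\<close>, its increment and the next
  threshold, 35 to 37 the same for \<open>G\<close>, and 38 and 39 the sides found by search. A
  non-strict comparison is \<open>Lt\<close> against the successor.\<close>

definition cell_exp :: exp where
  "cell_exp =
    Let (tau_exp 32 29) (Let (delta_exp 32) (Let (B Add (V 32) (V 33))
    (Let (tau_exp 35 31) (Let (delta_exp 35) (Let (B Add (V 35) (V 36))
    (Let (search_exp 38 (Lt (rng_exp 42 20 41 25 26) (V 34)))
    (Let (search_exp 39 (Let (B Add (V 42) (N 1)) (Lt (V 37) (B Add (rng_exp 45 22 20 43 24) (N 1)))))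
      (B Mul (B Mul (rng_exp 40 38 21 23 39) (V 33)) (V 36)))))))))"

definition pivot_exp :: exp where
  "pivot_exp =
    Let (sel 13 (B Sub (B Sub (V 5) (N 1)) (B Add (V 11) (N 1))) (B Add (V 11) (N 1)))
    (Let (sel 13 (B Sub (B Sub (V 5) (N 1)) (Ld (B Add (V 11) (N 1)))) (Ld (B Add (V 11) (N 1))))
    (Let (B Mod (B Shr (V 16) (V 15)) (N 2))
    (Let (B Shl (B Shr (V 16) (B Add (V 15) (N 1))) (B Add (V 15) (N 1)))
    (Let (B Add (V 19) (B Shl (N 1) (V 15)))
    (Let (sel 18 (V 16) (B Add (V 20) (B Shl (N 1) (V 15))))
    (Let (sel 18 (V 19) (B Add (V 16) (N 1)))
    (Let (sel 18 (N 0) (B Add (V 17) (N 1)))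
    (Let (sel 18 (V 17) (V 5))
    (Let (sel 18 (B Add (V 17) (N 1)) (N 0))
    (Let (sel 18 (V 5) (V 17))
    (Let (B Sub (N 1) (B Mul (B Sub (N 1) (V 18)) (V 13)))
      (B Mul (sum_exp 28 8 (sum_exp 30 8 cell_exp)) (V 27)))))))))))))"

definition main_exp :: exp where
  "main_exp = sum_exp 10 0 (sum_exp 12 9 (sum_exp 14 4 pivot_exp))"

lemma delta_le: "t \<le> 2 * n + 1 \<Longrightarrow> delta n K t \<le> n + 1"
proof -
  have "t div K \<le> t" by (rule div_le_dividend)
  then have "t div K \<le> n" if "t \<le> n" using that by linarith
  then show ?thesis by (simp add: delta_def)
qed

context algorithm
begin

lemma eval_delta_exp:
  assumes "glob \<rho>" "t < r" "\<rho> t \<le> 2 * n + 1" "3 < r" "7 < r"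
  shows "eval w \<mu> (delta_exp t) r \<rho> = delta n K (\<rho> t)"
proof -
  have g: "\<rho> 3 = n + 1" "\<rho> 7 = K" using assms(1) by (auto simp: glob_def)
  have "\<rho> t div K + 1 < 2 ^ w" using assms(3) div_le_dividend[of "\<rho> t" K] M_less by linarith
  then show ?thesis using assms(2,4,5) g
    by (auto simp: delta_exp_def delta_def numerals alu_Add alu_Mul less_Suc_eq_le simp del: of_bool_eq_iff)
qed

lemma eval_tau_exp:
  assumes "glob \<rho>" "i < r" "10 \<le> r" "\<rho> i \<le> g"
  shows "eval w \<mu> (tau_exp r i) r \<rho> = tau n K (\<rho> i)"
proof -
  have g: "\<rho> 8 = g" using assms(1) by (simp add: glob_def)
  define acc where "acc = rec_nat (0::nat) (\<lambda>k x. eval w \<mu> (B Add (B Mul (delta_exp r) (Lt (V (Suc r)) (V i))) (V r))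
     (r + 2) (\<rho>(r := x, Suc r := k)))"
  have "acc k = tau n K (min k (\<rho> i))" for k
  proof (induction k)
    case (Suc k)
    define t where "t = tau n K (min k (\<rho> i))"
    have t: "t \<le> 2 * n + 1" unfolding t_def by (rule tau_le)
    have d: "eval w \<mu> (delta_exp r) (r + 2) (\<rho>(r := t, Suc r := k)) = delta n K t"
      by (subst eval_delta_exp) (use assms t in \<open>auto intro!: glob_upd\<close>)
    have "t + delta n K t < 2 ^ w" "delta n K t < 2 ^ w" "t < 2 ^ w"
      using t delta_le[OF t, of K] M_less by linarith+
    then have "eval w \<mu> (B Add (B Mul (delta_exp r) (Lt (V (Suc r)) (V i))) (V r)) (r + 2) (\<rho>(r := t, Suc r := k)) =
        t + of_bool (k < \<rho> i) * delta n K t"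
      using assms(2) d
      by (cases "k < \<rho> i") (auto simp: alu_Add alu_Mul)
    moreover have "t + of_bool (k < \<rho> i) * delta n K t = tau n K (min (Suc k) (\<rho> i))"
      by (cases "k < \<rho> i") (auto simp: t_def min_def)
    ultimately show ?case using Suc unfolding acc_def t_def by simp
  qed (simp add: acc_def)
  then show ?thesis using assms(4) g by (simp add: tau_exp_def acc_def)
qed

lemma rng_le: "rng \<sigma> a b c d \<le> n"
  using rect_le_card[of S] by simp

lemma eval_cell_exp:
  assumes gl: "glob \<rho>" and \<sigma>: "\<rho> 13 = of_bool \<sigma>" and kl: "\<rho> 29 < g" "\<rho> 31 < g"
    and le: "\<rho> 20 \<le> M" "\<rho> 21 \<le> M" "\<rho> 22 \<le> M" "\<rho> 23 \<le> M" "\<rho> 24 \<le> M" "\<rho> 25 \<le> M" "\<rho> 26 \<le> M"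
  defines "s \<equiv> bsearch (\<lambda>z. rng \<sigma> (\<rho> 20) z (\<rho> 25) (\<rho> 26) < tau n K (Suc (\<rho> 29))) m m"
    and "t \<equiv> bsearch (\<lambda>z. tau n K (Suc (\<rho> 31)) \<le> rng \<sigma> (\<rho> 22) (\<rho> 20) (z + 1) (\<rho> 24)) m m"
  shows "eval w \<mu> cell_exp 32 \<rho> = take_bit w (delta n K (tau n K (\<rho> 29)) * delta n K (tau n K (\<rho> 31)) *
    rng \<sigma> s (\<rho> 21) (\<rho> 23) t)"
proof -
  let ?k = "\<rho> 29" and ?l = "\<rho> 31"
  let ?tk = "tau n K ?k" and ?tl = "tau n K ?l"
  let ?P = "\<lambda>z. rng \<sigma> (\<rho> 20) z (\<rho> 25) (\<rho> 26) < tau n K (Suc ?k)"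
  let ?Q = "\<lambda>z. tau n K (Suc ?l) \<le> rng \<sigma> (\<rho> 22) (\<rho> 20) (z + 1) (\<rho> 24)"
  have tau: "tau n K k \<le> 2 * n + 1" "delta n K (tau n K k) \<le> n + 1" for k
    using tau_le delta_le by auto
  have tw: "tau n K k + delta n K (tau n K k) < 2 ^ w" for k
    using tau(1)[of k] tau(2)[of k] M_less by linarith
  have Mw: "2 * 2 ^ m < (2::nat) ^ w" using M_less unfolding M by linarith
  have Pm: "z \<le> z' \<Longrightarrow> ?P z' \<Longrightarrow> ?P z" for z z'
    by (rule le_less_trans[OF rect_mono]) auto
  have Qm: "z \<le> z' \<Longrightarrow> ?Q z' \<Longrightarrow> ?Q z" for z z'
    by (rule order_trans[OF _ rect_mono]) auto
  have st: "s \<le> M" "t \<le> M"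
  proof -
    have "s < 2 ^ m" unfolding s_def by (rule bsearch_less) (use Pm in auto)
    moreover have "t < 2 ^ m" unfolding t_def by (rule bsearch_less) (use Qm in auto)
    ultimately show "s \<le> M" "t \<le> M" using M by simp_all
  qed
  note g = gl[unfolded glob_def]
  define \<rho>\<^sub>1 where "\<rho>\<^sub>1 = \<rho>(32 := ?tk)"
  define \<rho>\<^sub>2 where "\<rho>\<^sub>2 = \<rho>\<^sub>1(33 := delta n K ?tk)"
  define \<rho>\<^sub>3 where "\<rho>\<^sub>3 = \<rho>\<^sub>2(34 := tau n K (Suc ?k))"
  define \<rho>\<^sub>4 where "\<rho>\<^sub>4 = \<rho>\<^sub>3(35 := ?tl)"
  define \<rho>\<^sub>5 where "\<rho>\<^sub>5 = \<rho>\<^sub>4(36 := delta n K ?tl)"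
  define \<rho>\<^sub>6 where "\<rho>\<^sub>6 = \<rho>\<^sub>5(37 := tau n K (Suc ?l))"
  define \<rho>\<^sub>7 where "\<rho>\<^sub>7 = \<rho>\<^sub>6(38 := s)"
  define \<rho>\<^sub>8 where "\<rho>\<^sub>8 = \<rho>\<^sub>7(39 := t)"
  note defs = \<rho>\<^sub>1_def \<rho>\<^sub>2_def \<rho>\<^sub>3_def \<rho>\<^sub>4_def \<rho>\<^sub>5_def \<rho>\<^sub>6_def \<rho>\<^sub>7_def \<rho>\<^sub>8_def
  have gl': "glob \<rho>\<^sub>1" "glob \<rho>\<^sub>3" "glob \<rho>\<^sub>4" "glob \<rho>\<^sub>6" "glob \<rho>\<^sub>7" "glob \<rho>\<^sub>8"
    using gl by (auto simp: defs intro!: glob_upd)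
  have e1: "eval w \<mu> (tau_exp 32 29) 32 \<rho> = ?tk"
    by (rule eval_tau_exp[OF gl]) (use kl in auto)
  have e2: "eval w \<mu> (delta_exp 32) 33 \<rho>\<^sub>1 = delta n K ?tk"
    by (subst eval_delta_exp[OF gl'(1)]) (use tau in \<open>auto simp: \<rho>\<^sub>1_def\<close>)
  have e3: "eval w \<mu> (B Add (V 32) (V 33)) 34 \<rho>\<^sub>2 = tau n K (Suc ?k)"
    using tw[of ?k] by (simp add: defs alu_Add)
  have e4: "eval w \<mu> (tau_exp 35 31) 35 \<rho>\<^sub>3 = ?tl"
    by (subst eval_tau_exp[OF gl'(2)]) (use kl in \<open>auto simp: defs\<close>)
  have e5: "eval w \<mu> (delta_exp 35) 36 \<rho>\<^sub>4 = delta n K ?tl"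
    by (subst eval_delta_exp[OF gl'(3)]) (use tau in \<open>auto simp: defs\<close>)
  have e6: "eval w \<mu> (B Add (V 35) (V 36)) 37 \<rho>\<^sub>5 = tau n K (Suc ?l)"
    using tw[of ?l] by (simp add: defs alu_Add)
  have e7: "eval w \<mu> (search_exp 38 (Lt (rng_exp 42 20 41 25 26) (V 34))) 38 \<rho>\<^sub>6 = s"
    unfolding s_def
  proof (rule eval_search_exp, goal_cases)
    case (6 z z')
    then show ?case by (rule Pm)
  next
    case (7 k x q z)
    let ?r = "\<rho>\<^sub>6(38 := x, 39 := k, 40 := q, 41 := z)"
    have "glob ?r" using gl'(4) by (intro glob_upd) auto
    then have "eval w \<mu> (rng_exp 42 20 41 25 26) 42 ?r = rng \<sigma> (\<rho> 20) z (\<rho> 25) (\<rho> 26)"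
      by (subst eval_rng_exp[where \<sigma> = \<sigma>]) (use le \<sigma> 7 M in \<open>auto simp: defs\<close>)
    then show ?case by (simp add: defs)
  qed (use gl'(4) M_less w0 Mw in \<open>auto simp: glob_def\<close>)
  have e8: "eval w \<mu> (search_exp 39 (Let (B Add (V 42) (N 1)) (Lt (V 37) (B Add (rng_exp 45 22 20 43 24) (N 1))))) 39 \<rho>\<^sub>7 = t"
    unfolding t_def
  proof (rule eval_search_exp, goal_cases)
    case (6 z z')
    then show ?case by (rule Qm)
  next
    case (7 k x q z)
    \<comment> \<open>Register 43 is the successor of the tested number, as \<open>Gcount\<close>
      starts strictly above it; 44 is the left operand of \<open>Lt\<close>, evaluated before the
      box count.\<close>
    let ?r = "\<rho>\<^sub>7(39 := x, 40 := k, 41 := q, 42 := z, 43 := z + 1, 44 := tau n K (Suc ?l))"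
    have z: "z + 1 \<le> M" "z + 1 < 2 ^ w" using 7 M_less M by linarith+
    have "glob ?r" using gl'(5) by (intro glob_upd) auto
    then have "eval w \<mu> (rng_exp 45 22 20 43 24) 45 ?r = rng \<sigma> (\<rho> 22) (\<rho> 20) (z + 1) (\<rho> 24)"
      by (subst eval_rng_exp[where \<sigma> = \<sigma>]) (use le \<sigma> z in \<open>auto simp: defs\<close>)
    moreover have "rng \<sigma> (\<rho> 22) (\<rho> 20) (z + 1) (\<rho> 24) + 1 < 2 ^ w"
      using rng_le[of \<sigma> "\<rho> 22" "\<rho> 20" "z + 1" "\<rho> 24"] M_less by linarith
    ultimately show ?case using z w0
      by (simp add: defs numerals alu_Add less_Suc_eq_le)
  qed (use gl'(5) M_less w0 Mw in \<open>auto simp: glob_def\<close>)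
  have e9: "eval w \<mu> (rng_exp 40 38 21 23 39) 40 \<rho>\<^sub>8 = rng \<sigma> s (\<rho> 21) (\<rho> 23) t"
    by (subst eval_rng_exp[OF gl'(6), where \<sigma> = \<sigma>]) (use le \<sigma> st in \<open>auto simp: defs\<close>)
  have "eval w \<mu> cell_exp 32 \<rho> = eval w \<mu> (B Mul (B Mul (rng_exp 40 38 21 23 39) (V 33)) (V 36)) 40 \<rho>\<^sub>8"
    unfolding cell_exp_def
    by (simp only: eval.simps(6) Suc_numeral add_num_simps e1 e2[unfolded defs] e3[unfolded defs] e4[unfolded defs]
      e5[unfolded defs] e6[unfolded defs] e7[unfolded defs] e8[unfolded defs]) (simp only: defs)
  also have "\<dots> = alu w Mul (alu w Mul (rng \<sigma> s (\<rho> 21) (\<rho> 23) t) (delta n K ?tk)) (delta n K ?tl)"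
    by (simp add: e9) (simp add: defs)
  also have "\<dots> = take_bit w (delta n K ?tk * delta n K ?tl * rng \<sigma> s (\<rho> 21) (\<rho> 23) t)"
    unfolding alu.simps(3) take_bit_eq_mod mod_mult_left_eq by (simp only: ac_simps)
  finally show ?thesis .
qed

end

context algorithm
begin

lemma eval_pivot_exp:
  assumes gl: "glob \<rho>" and p: "\<rho> 11 < n" "p = Suc (\<rho> 11)" and \<sigma>: "\<rho> 13 = of_bool \<sigma>"
    and d: "\<rho> 15 = d" "d < m"
  shows "take_bit w (eval w \<mu> pivot_exp 16 \<rho>) = take_bit w (of_bool (\<sigma> \<longrightarrow> odd (coord \<sigma> p div 2 ^ d)) *
    pivot_approx n K m g (coord \<sigma>) (\<lambda>q. coord \<sigma> (\<pi> q)) d p S)"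
proof -
  define x where "x = coord \<sigma>"
  define y where "y = (\<lambda>q. coord \<sigma> (\<pi> q))"
  have R: "rng \<sigma> = rect S x y" by (simp add: x_def y_def)
  define px py where "px = x p" and "py = y p"
  define \<beta> where "\<beta> \<longleftrightarrow> odd (px div 2 ^ d)"
  define L where "L = px div 2 ^ Suc d * 2 ^ Suc d"
  define X where "X = middle d px"
  define xh xl yl yh fl fh where "xh = upper_x x d p" and "xl = lower_x x d p"
    and "yl = lower_y x y d p" and "yh = upper_y M x y d p"
    and "fl = lower_y' x y d p" and "fh = upper_y' M x y d p"
  note cases_defs = xh_def upper_x_def xl_def lower_x_def yl_def lower_y_def yh_def upper_y_def
    fl_def lower_y'_def fh_def upper_y'_def px_def[symmetric] py_def[symmetric] \<beta>_def[symmetric]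
    L_def[symmetric] X_def[symmetric]
  have pS: "p \<in> S" using p by auto
  have xy: "\<forall>v\<in>S. x v < M - 1 \<and> y v < M - 1" using coord_less by (auto simp: x_def y_def)
  have px: "px < M - 1" "py < M - 1" using xy pS by (auto simp: px_def py_def)
  have px_eq: "px = (if \<sigma> then M - 1 - p else p)" and py_eq: "py = (if \<sigma> then M - 1 - \<pi> p else \<pi> p)"
    by (simp_all add: px_def py_def x_def y_def coord_def mirror_def)
  have pM: "p < M - 1" "\<pi> p < M - 1" using S_less[OF pS] by auto
  have Mw: "16 * M < 2 ^ w" by (rule M_less)
  \<comment> \<open>By \<open>d < m\<close> the dyadic interval of \<open>p\<close> lies within the
    range below \<open>M\<close>, so all box sides are at most \<open>M\<close>, as box queries
    require.\<close>
  have E: "2 ^ Suc d \<le> M" "2 ^ d + 2 ^ d \<le> M" "L + 2 ^ Suc d \<le> M"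
  proof -
    have M2: "M = 2 ^ (m - Suc d) * 2 ^ Suc d" unfolding M using d by (simp only: flip: power_add) simp
    show "2 ^ Suc d \<le> M" unfolding M2 by simp
    then show "2 ^ d + 2 ^ d \<le> M" by simp
    have "px div 2 ^ Suc d < 2 ^ (m - Suc d)" using px(1) M2
      by (simp only: less_mult_imp_div_less)
    then have "Suc (px div 2 ^ Suc d) * 2 ^ Suc d \<le> M" unfolding M2 by (intro mult_le_mono1) simp
    then show "L + 2 ^ Suc d \<le> M" unfolding L_def by simp
  qed
  have X: "X = L + 2 ^ d" "X + 2 ^ d \<le> M" using E(3) by (simp_all add: X_def L_def middle_def)
  have le: "X \<le> M" "xh \<le> M" "xl \<le> M" "yl \<le> M" "yh \<le> M" "fl \<le> M" "fh \<le> M"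
    unfolding cases_defs using E X px by auto
  note g = gl[unfolded glob_def]
  define \<rho>\<^sub>1 where "\<rho>\<^sub>1 = \<rho>(16 := px)"
  define \<rho>\<^sub>2 where "\<rho>\<^sub>2 = \<rho>\<^sub>1(17 := py)"
  define \<rho>\<^sub>3 where "\<rho>\<^sub>3 = \<rho>\<^sub>2(18 := of_bool \<beta>)"
  define \<rho>\<^sub>4 where "\<rho>\<^sub>4 = \<rho>\<^sub>3(19 := L)"
  define \<rho>\<^sub>5 where "\<rho>\<^sub>5 = \<rho>\<^sub>4(20 := X)"
  define \<rho>\<^sub>6 where "\<rho>\<^sub>6 = \<rho>\<^sub>5(21 := xh)"
  define \<rho>\<^sub>7 where "\<rho>\<^sub>7 = \<rho>\<^sub>6(22 := xl)"
  define \<rho>\<^sub>8 where "\<rho>\<^sub>8 = \<rho>\<^sub>7(23 := yl)"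
  define \<rho>\<^sub>9 where "\<rho>\<^sub>9 = \<rho>\<^sub>8(24 := yh)"
  define \<rho>\<^sub>a where "\<rho>\<^sub>a = \<rho>\<^sub>9(25 := fl)"
  define \<rho>\<^sub>b where "\<rho>\<^sub>b = \<rho>\<^sub>a(26 := fh)"
  define \<rho>\<^sub>c where "\<rho>\<^sub>c = \<rho>\<^sub>b(27 := of_bool (\<sigma> \<longrightarrow> \<beta>))"
  note defs = \<rho>\<^sub>1_def \<rho>\<^sub>2_def \<rho>\<^sub>3_def \<rho>\<^sub>4_def \<rho>\<^sub>5_def \<rho>\<^sub>6_def \<rho>\<^sub>7_def \<rho>\<^sub>8_def \<rho>\<^sub>9_def \<rho>\<^sub>a_def \<rho>\<^sub>b_def \<rho>\<^sub>c_def
  have w1: "1 < (2::nat) ^ w" "2 < (2::nat) ^ w" using Mw m by linarith+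
  have small: "u \<le> M \<Longrightarrow> v \<le> M \<Longrightarrow> u + v < 2 ^ w" for u v using Mw by linarith
  have inp: "\<mu> p = \<pi> p" using input[OF pS] .
  have p1: "alu w Add (\<rho> 11) (Suc 0) = p" using p small[of "\<rho> 11" 1] pM by (simp add: alu_Add)
  have M1: "alu w Sub M (Suc 0) = M - 1" using Mw m by (simp add: alu_Sub)
  have s1: "alu w Sub (M - Suc 0) p = M - 1 - p" "alu w Sub (M - Suc 0) (\<pi> p) = M - 1 - \<pi> p"
    using Mw m pM by (simp_all add: alu_Sub)
  have d1: "alu w Add d (Suc 0) = Suc d" using d M_less by (simp add: alu_Add)
  have "(1::nat) * 2 ^ d < 2 ^ w" using E(2) Mw by linarith
  from alu_Shl[OF this] have sh: "alu w Shl (Suc 0) d = 2 ^ d" by simp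
  have e1: "eval w \<mu> (sel 13 (B Sub (B Sub (V 5) (N 1)) (B Add (V 11) (N 1))) (B Add (V 11) (N 1))) 16 \<rho> = px"
    unfolding px_eq by (rule eval_sel[where \<rho> = \<rho>]) (use \<sigma> w0 g pM small[of "M - 1 - p" 0] small[of p 0] in \<open>auto simp: numerals p1 M1 s1\<close>)
  have e2: "eval w \<mu> (sel 13 (B Sub (B Sub (V 5) (N 1)) (Ld (B Add (V 11) (N 1)))) (Ld (B Add (V 11) (N 1)))) 17 \<rho>\<^sub>1 = py"
    unfolding py_eq by (rule eval_sel[where \<rho> = \<rho>\<^sub>1])
      (use \<sigma> w0 g pM small[of "M - 1 - \<pi> p" 0] small[of "\<pi> p" 0] in \<open>auto simp: numerals p1 M1 s1 inp defs\<close>)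
  have e3: "eval w \<mu> (B Mod (B Shr (V 16) (V 15)) (N 2)) 18 \<rho>\<^sub>2 = of_bool \<beta>"
    using d w4 by (simp add: defs alu_Shr \<beta>_def numerals odd_iff_mod_2_eq_one mod2_eq_if)
  have e4: "eval w \<mu> (B Shl (B Shr (V 16) (B Add (V 15) (N 1))) (B Add (V 15) (N 1))) 19 \<rho>\<^sub>3 = L"
  proof -
    have "alu w Shl (px div 2 ^ Suc d) (Suc d) = L" unfolding L_def
      by (rule alu_Shl) (use E(3) Mw in \<open>unfold L_def, linarith\<close>)
    then show ?thesis using d w0 by (simp add: defs numerals d1 alu_Shr del: power_Suc)
  qed
  have e5: "eval w \<mu> (B Add (V 19) (B Shl (N 1) (V 15))) 20 \<rho>\<^sub>4 = X"
    using d w0 small[of L "2 ^ d"] E X(2) unfolding X(1) by (simp add: defs numerals sh alu_Add)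
  have e6: "eval w \<mu> (sel 18 (V 16) (B Add (V 20) (B Shl (N 1) (V 15)))) 21 \<rho>\<^sub>5 = xh"
    unfolding cases_defs by (rule eval_sel[where \<rho> = \<rho>\<^sub>5])
      (use d w0 px small[of px 0] small[of X "2 ^ d"] le E in \<open>auto simp: defs numerals sh alu_Add\<close>)
  have e7: "eval w \<mu> (sel 18 (V 19) (B Add (V 16) (N 1))) 22 \<rho>\<^sub>6 = xl"
    unfolding cases_defs by (rule eval_sel[where \<rho> = \<rho>\<^sub>6])
      (use w0 px small[of px 1] small[of L 0] X in \<open>auto simp: defs numerals alu_Add\<close>)
  have e8: "eval w \<mu> (sel 18 (N 0) (B Add (V 17) (N 1))) 23 \<rho>\<^sub>7 = yl"
    unfolding cases_defs by (rule eval_sel[where \<rho> = \<rho>\<^sub>7])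
      (use w0 px small[of py 1] in \<open>auto simp: defs numerals alu_Add\<close>)
  have e9: "eval w \<mu> (sel 18 (V 17) (V 5)) 24 \<rho>\<^sub>8 = yh"
    unfolding cases_defs by (rule eval_sel[where \<rho> = \<rho>\<^sub>8])
      (use w0 px g small[of py 0] small[of M 0] in \<open>auto simp: defs\<close>)
  have e10: "eval w \<mu> (sel 18 (B Add (V 17) (N 1)) (N 0)) 25 \<rho>\<^sub>9 = fl"
    unfolding cases_defs by (rule eval_sel[where \<rho> = \<rho>\<^sub>9])
      (use w0 px small[of py 1] in \<open>auto simp: defs numerals alu_Add\<close>)
  have e11: "eval w \<mu> (sel 18 (V 5) (V 17)) 26 \<rho>\<^sub>a = fh"
    unfolding cases_defs by (rule eval_sel[where \<rho> = \<rho>\<^sub>a])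
      (use w0 px g small[of py 0] small[of M 0] in \<open>auto simp: defs\<close>)
  have e12: "eval w \<mu> (B Sub (N 1) (B Mul (B Sub (N 1) (V 18)) (V 13))) 27 \<rho>\<^sub>b = of_bool (\<sigma> \<longrightarrow> \<beta>)"
    using \<sigma> w0 w1 by (cases \<sigma>; cases \<beta>) (auto simp: defs numerals alu_Sub alu_Mul)
  define s where "s k = bsearch (\<lambda>z. rng \<sigma> X z fl fh < tau n K (Suc k)) m m" for k
  define t where "t l = bsearch (\<lambda>z. tau n K (Suc l) \<le> rng \<sigma> xl X (z + 1) yh) m m" for l
  have "eval w \<mu> (sum_exp 28 8 (sum_exp 30 8 cell_exp)) 28 \<rho>\<^sub>c =
    take_bit w (\<Sum>k<\<rho>\<^sub>c 8. \<Sum>l<\<rho>\<^sub>c 8. delta n K (tau n K k) * delta n K (tau n K l) * rng \<sigma> (s k) xh yl (t l))"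
  proof (rule eval_sum_exp, goal_cases)
    case (1 k a)
    have "eval w \<mu> (sum_exp 30 8 cell_exp) 30 (\<rho>\<^sub>c(28 := a, 29 := k)) =
      take_bit w (\<Sum>l<(\<rho>\<^sub>c(28 := a, 29 := k)) 8. delta n K (tau n K k) * delta n K (tau n K l) * rng \<sigma> (s k) xh yl (t l))"
    proof (rule eval_sum_exp, goal_cases)
      case (1 l b)
      have glr: "glob (\<rho>\<^sub>c(28 := a, 29 := k, 30 := b, 31 := l))" using gl unfolding defs by (intro glob_upd) auto
      have kl: "k < g" "l < g" using 1 \<open>k < \<rho>\<^sub>c 8\<close> g by (auto simp: defs)
      have "eval w \<mu> cell_exp 32 (\<rho>\<^sub>c(28 := a, 29 := k, 30 := b, 31 := l)) =
        take_bit w (delta n K (tau n K k) * delta n K (tau n K l) * rng \<sigma> (s k) xh yl (t l))"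
        by (subst eval_cell_exp[OF glr, where \<sigma> = \<sigma>]) (use kl le \<sigma> in \<open>simp_all add: defs s_def t_def\<close>)
      then show ?case by simp
    qed
    then show ?case using g by simp
  qed
  also have "\<rho>\<^sub>c 8 = g" using g by (simp add: defs)
  also have "(\<Sum>k<g. \<Sum>l<g. delta n K (tau n K k) * delta n K (tau n K l) * rng \<sigma> (s k) xh yl (t l)) =
    pivot_approx n K m g x y d p S"
    unfolding R xh_def yl_def
  \<comment> \<open>Here \<open>Z\<close> is \<open>M - 1\<close>: coordinates stay below it, and
    there \<open>bsearch_iff\<close> applies.\<close>
  proof (rule pivot_approx_thresholds[OF _ _ refl xy])
    have F: "Fcount (2 ^ m) x y d p S z = rng \<sigma> X z fl fh" for z
      unfolding R Fcount_def X_def px_def fl_def fh_def unfolding M ..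
    have G: "Gcount (2 ^ m) x y d p S z = rng \<sigma> xl X (z + 1) yh" for z
      unfolding R Gcount_def X_def px_def xl_def yh_def unfolding M ..
    show "\<forall>k<g. \<forall>z<M - 1. (z < s k) = (Fcount (2 ^ m) x y d p S z < tau n K (Suc k))"
      unfolding F s_def
    proof (intro allI impI bsearch_iff)
      fix k z z' assume "z \<le> z'" "rng \<sigma> X z' fl fh < tau n K (Suc k)"
      then show "rng \<sigma> X z fl fh < tau n K (Suc k)"
        by (meson le_less_trans rect_mono order_refl)
    qed (simp add: M)
    show "\<forall>l<g. \<forall>z<M - 1. (z < t l) = (tau n K (Suc l) \<le> Gcount (2 ^ m) x y d p S z)"
      unfolding G t_def
    proof (intro allI impI bsearch_iff)
      fix l z z' assume "z \<le> z'" "tau n K (Suc l) \<le> rng \<sigma> xl X (z' + 1) yh"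
      moreover have "rng \<sigma> xl X (z' + 1) yh \<le> rng \<sigma> xl X (z + 1) yh"
        by (rule rect_mono) (use \<open>z \<le> z'\<close> in auto)
      ultimately show "tau n K (Suc l) \<le> rng \<sigma> xl X (z + 1) yh" by linarith
    qed (simp add: M)
  qed (use K m in \<open>simp_all add: M\<close>)
  finally have inner: "eval w \<mu> (sum_exp 28 8 (sum_exp 30 8 cell_exp)) 28 \<rho>\<^sub>c =
    take_bit w (pivot_approx n K m g x y d p S)" .
  have "eval w \<mu> pivot_exp 16 \<rho> = eval w \<mu> (B Mul (sum_exp 28 8 (sum_exp 30 8 cell_exp)) (V 27)) 28 \<rho>\<^sub>c"
    unfolding pivot_exp_def
    by (simp only: eval.simps(6) Suc_numeral add_num_simps e1 e2[unfolded defs] e3[unfolded defs] e4[unfolded defs]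
      e5[unfolded defs] e6[unfolded defs] e7[unfolded defs] e8[unfolded defs] e9[unfolded defs]
      e10[unfolded defs] e11[unfolded defs] e12[unfolded defs]) (simp only: defs)
  also have "\<dots> = of_bool (\<sigma> \<longrightarrow> \<beta>) * take_bit w (pivot_approx n K m g x y d p S)"
  proof -
    have "eval w \<mu> (V 27) (Suc 28) (\<rho>\<^sub>c(28 := v)) = of_bool (\<sigma> \<longrightarrow> \<beta>)" for v by (simp add: defs)
    then show ?thesis by (simp only: eval.simps(3) inner alu_Mul_of_bool[OF take_bit_nat_less_exp])
  qed
  finally have "eval w \<mu> pivot_exp 16 \<rho> = of_bool (\<sigma> \<longrightarrow> \<beta>) * take_bit w (pivot_approx n K m g x y d p S)" .
  moreover have "take_bit w (of_bool b * take_bit w z) = take_bit w (of_bool b * z)" for b and z :: nat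
    by (cases b) simp_all
  ultimately show ?thesis by (simp only: \<beta>_def px_def x_def y_def)
qed

lemma eval_main_exp:
  assumes "glob \<rho>"
  shows "eval w \<mu> main_exp 10 \<rho> = take_bit w (\<Sum>p\<in>S.
    (\<Sum>d<m. pivot_approx n K m g (\<lambda>q. q) \<pi> d p S) +
    (\<Sum>d<m. of_bool (odd (mirror M p div 2 ^ d)) *
       pivot_approx n K m g (\<lambda>q. mirror M q) (\<lambda>q. mirror M (\<pi> q)) d p S))"
proof -
  define f where "f p \<sigma> d = of_bool (\<sigma> \<longrightarrow> odd (coord \<sigma> p div 2 ^ d)) *
    pivot_approx n K m g (coord \<sigma>) (\<lambda>q. coord \<sigma> (\<pi> q)) d p S" for p \<sigma> d
  note g = assms[unfolded glob_def]
  have "eval w \<mu> main_exp 10 \<rho> = take_bit w (\<Sum>k<\<rho> 0. \<Sum>b<(2::nat). \<Sum>d<m. f (Suc k) (b = 1) d)"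
    unfolding main_exp_def
  proof (rule eval_sum_exp, goal_cases)
    case (1 k a)
    have "eval w \<mu> (sum_exp 12 9 (sum_exp 14 4 pivot_exp)) 12 (\<rho>(10 := a, 11 := k)) =
      take_bit w (\<Sum>b<(\<rho>(10 := a, 11 := k)) 9. \<Sum>d<m. f (Suc k) (b = 1) d)"
    proof (rule eval_sum_exp, goal_cases)
      case (1 b a')
      have "eval w \<mu> (sum_exp 14 4 pivot_exp) 14 (\<rho>(10 := a, 11 := k, 12 := a', 13 := b)) =
        take_bit w (\<Sum>d<(\<rho>(10 := a, 11 := k, 12 := a', 13 := b)) 4. f (Suc k) (b = 1) d)"
      proof (rule eval_sum_exp, goal_cases)
        case (1 d a'')
        have "b < 2" using \<open>b < _\<close> g by simp
        then have "b = of_bool (b = 1)" by auto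
        moreover have "glob (\<rho>(10 := a, 11 := k, 12 := a', 13 := b, 14 := a'', 15 := d))"
          using assms by (intro glob_upd) auto
        ultimately have "take_bit w (eval w \<mu> pivot_exp 16 (\<rho>(10 := a, 11 := k, 12 := a', 13 := b, 14 := a'', 15 := d))) =
          take_bit w (f (Suc k) (b = 1) d)"
          unfolding f_def using 1 \<open>k < \<rho> 0\<close> g by (intro eval_pivot_exp) auto
        then show ?case by simp
      qed
      then show ?case using g by simp
    qed
    then show ?case using g by simp
  qed
  also have "(\<Sum>k<\<rho> 0. \<Sum>b<(2::nat). \<Sum>d<m. f (Suc k) (b = 1) d) = (\<Sum>p\<in>S. (\<Sum>d<m. f p False d) + (\<Sum>d<m. f p True d))"
  proof -
    have "(\<Sum>b<(2::nat). h b) = h 0 + h 1" for h :: "nat \<Rightarrow> nat" by (simp add: numeral_2_eq_2)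
    then show ?thesis using g by (simp add: sum.atLeast1_atMost_eq)
  qed
  moreover have "coord True = mirror M" "coord False = (\<lambda>q. q)" by (simp_all add: coord_def fun_eq_iff)
  ultimately show ?thesis by (simp add: f_def)
qed

end

section \<open>Building the table\<close>

text \<open>Every point increments one cell for each pair of dyadic intervals around its two
  coordinates. \<open>V 13\<close> is the address, which \<open>Put\<close> has left in its own
  level register.\<close>

definition build_com :: com where
  "build_com = For 0 (For 6 (For 6 (Put
     (B Add (B Mul (B Shr (B Add (B Add (V 10) (N 1)) (B Mul (N 2) (V 5))) (V 11)) (B Mul (N 4) (V 5)))
       (B Shr (B Add (Ld (B Add (V 10) (N 1))) (B Mul (N 2) (V 5))) (V 12)))
     (B Add (Ld (V 13)) (N 1)))))"

context parameters
begin

text \<open>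
  The memory is tracked modulo \<open>2 ^ w\<close> only; the counts themselves are bounded at the very end.
\<close>

definition adds :: "com \<Rightarrow> nat \<Rightarrow> (nat \<Rightarrow> nat) \<Rightarrow> (nat \<Rightarrow> nat) \<Rightarrow> bool" where
  "adds c r \<rho> f \<longleftrightarrow> (\<forall>\<mu>. (\<forall>q\<in>S. \<mu> q = \<pi> q) \<longrightarrow> (\<forall>q\<in>S. run w c r \<rho> \<mu> q = \<pi> q) \<and>
     (\<forall>A. take_bit w (run w c r \<rho> \<mu> A) = take_bit w (\<mu> A + f A)))"

lemma adds_For:
  assumes "\<And>k. k < \<rho> i \<Longrightarrow> adds c (Suc r) (\<rho>(r := k)) (f k)"
  shows "adds (For i c) r \<rho> (\<lambda>A. \<Sum>k<\<rho> i. f k A)"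
  unfolding adds_def
proof (intro allI impI)
  fix \<mu> assume \<mu>: "\<forall>q\<in>S. \<mu> q = \<pi> q"
  define t where "t = rec_nat \<mu> (\<lambda>k. run w c (Suc r) (\<rho>(r := k)))"
  have "(\<forall>q\<in>S. t k q = \<pi> q) \<and> (\<forall>A. take_bit w (t k A) = take_bit w (\<mu> A + (\<Sum>k<k. f k A)))"
    if "k \<le> \<rho> i" for k
    using that
  proof (induction k)
    case 0
    then show ?case using \<mu> by (simp add: t_def)
  next
    case (Suc k)
    then have IH: "\<forall>q\<in>S. t k q = \<pi> q" "\<And>A. take_bit w (t k A) = take_bit w (\<mu> A + (\<Sum>k<k. f k A))"
      by auto
    have "adds c (Suc r) (\<rho>(r := k)) (f k)" using assms Suc.prems by simp
    moreover have t: "t (Suc k) = run w c (Suc r) (\<rho>(r := k)) (t k)" by (simp add: t_def)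
    ultimately have *: "\<forall>q\<in>S. t (Suc k) q = \<pi> q" "\<And>A. take_bit w (t (Suc k) A) = take_bit w (t k A + f k A)"
      using IH(1) unfolding adds_def by auto
    have "take_bit w (t k A + f k A) = take_bit w (\<mu> A + (\<Sum>k<Suc k. f k A))" for A
    proof -
      have "take_bit w (t k A + f k A) = take_bit w (take_bit w (t k A) + f k A)"
        unfolding take_bit_eq_mod by (rule mod_add_left_eq[symmetric])
      also have "\<dots> = take_bit w (\<mu> A + (\<Sum>k<k. f k A) + f k A)"
        unfolding IH(2) unfolding take_bit_eq_mod by (rule mod_add_left_eq)
      finally show ?thesis by (simp add: add.assoc)
    qed
    with * show ?case by simp
  qed
  from this[of "\<rho> i"] show "(\<forall>q\<in>S. run w (For i c) r \<rho> \<mu> q = \<pi> q) \<and>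
      (\<forall>A. take_bit w (run w (For i c) r \<rho> \<mu> A) = take_bit w (\<mu> A + (\<Sum>k<\<rho> i. f k A)))"
    by (simp add: t_def)
qed

definition "address q i j = (q + 2 * M) div 2 ^ i * (4 * M) + (\<pi> q + 2 * M) div 2 ^ j"

lemma S_less_M: "q \<in> S \<Longrightarrow> q < M \<and> \<pi> q < M"
  using perm[of q] m by auto

text \<open>Different levels occupy disjoint ranges of node numbers, so a number determines its
  level.\<close>

lemma node_range:
  assumes "z < 2 * M" "i < m + 1"
  shows "2 ^ (m + 1 - i) \<le> (z + 2 * M) div 2 ^ i" "(z + 2 * M) div 2 ^ i < 2 ^ (m + 2 - i)"
proof -
  have "2 * M = 2 ^ (m + 1 - i) * 2 ^ i" using assms(2) unfolding M by (simp flip: power_add power_Suc)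
  with assms(1) have "z div 2 ^ i < 2 ^ (m + 1 - i)" by (simp add: less_mult_imp_div_less)
  moreover have "(2::nat) ^ (m + 2 - i) = 2 * 2 ^ (m + 1 - i)" using assms(2) by (simp add: Suc_diff_le)
  ultimately show "2 ^ (m + 1 - i) \<le> (z + 2 * M) div 2 ^ i" "(z + 2 * M) div 2 ^ i < 2 ^ (m + 2 - i)"
    unfolding shift_div[OF assms(2)] by linarith+
qed

lemma node_less: "z < M \<Longrightarrow> (z + 2 * M) div 2 ^ i < 4 * M"
  using div_le_dividend[of "z + 2 * M" "2 ^ i"] by linarith

lemma adds_build_com:
  assumes "glob \<rho>"
  shows "adds build_com 10 \<rho> (\<lambda>A. \<Sum>k<n. \<Sum>i<m + 1. \<Sum>j<m + 1. of_bool (A = address (Suc k) i j))"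
proof -
  note g = assms[unfolded glob_def]
  have "adds build_com 10 \<rho> (\<lambda>A. \<Sum>k<\<rho> 0. \<Sum>i<\<rho> 6. \<Sum>j<\<rho> 6. of_bool (A = address (Suc k) i j))"
    unfolding build_com_def
  proof (rule adds_For)
    fix k assume k: "k < \<rho> 0"
    let ?P = "Put (B Add (B Mul (B Shr (B Add (B Add (V 10) (N 1)) (B Mul (N 2) (V 5))) (V 11)) (B Mul (N 4) (V 5)))
         (B Shr (B Add (Ld (B Add (V 10) (N 1))) (B Mul (N 2) (V 5))) (V 12)))
       (B Add (Ld (V 13)) (N 1))"
    have "adds (For 6 (For 6 ?P)) 11 (\<rho>(10 := k))
       (\<lambda>A. \<Sum>i<(\<rho>(10 := k)) 6. \<Sum>j<\<rho> 6. of_bool (A = address (Suc k) i j))"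
    proof (rule adds_For)
      fix i assume i: "i < (\<rho>(10 := k)) 6"
      have "adds (For 6 ?P) 12 (\<rho>(10 := k, 11 := i))
         (\<lambda>A. \<Sum>j<(\<rho>(10 := k, 11 := i)) 6. of_bool (A = address (Suc k) i j))"
      proof (rule adds_For)
        fix j assume j: "j < (\<rho>(10 := k, 11 := i)) 6"
        let ?r = "\<rho>(10 := k, 11 := i, 12 := j)"
        have kS: "Suc k \<in> S" using k g by auto
        have ij: "i < m + 1" "j < m + 1" using i j g by auto
        let ?q = "Suc k"
        have q: "?q < M" "\<pi> ?q < M" using S_less_M[OF kS] by auto
        have "adds ?P 13 ?r (\<lambda>A. of_bool (A = address ?q i j))"
          unfolding adds_def
        proof (intro allI impI)
          fix \<mu> assume \<mu>: "\<forall>q\<in>S. \<mu> q = \<pi> q"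
          have \<mu>k: "\<mu> ?q = \<pi> ?q" using \<mu> kS by blast
          have U: "(?q + 2 * M) div 2 ^ i < 4 * M" and W: "(\<pi> ?q + 2 * M) div 2 ^ j < 4 * M"
            by (rule node_less[OF q(1)], rule node_less[OF q(2)])
          have less: "address ?q i j < 2 ^ w"
          proof -
            have "Suc ((?q + 2 * M) div 2 ^ i) * (4 * M) \<le> 4 * M * (4 * M)"
              using U by (intro mult_le_mono1) simp
            then have "address ?q i j < 4 * M * (4 * M)" using W unfolding address_def by simp
            also have "\<dots> < 2 ^ w" using w(1) by (simp add: ac_simps)
            finally show ?thesis .
          qed
          \<comment> \<open>Node numbers are positive, so addresses are at least
            \<open>4 * M\<close> and the input cells, still to be read in later rounds, are never
            overwritten.\<close>
          have gt: "n < address ?q i j"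
          proof -
            have "(1::nat) \<le> 2 ^ (m + 1 - i)" by simp
            then have "1 \<le> (?q + 2 * M) div 2 ^ i" using node_range(1)[of ?q i] ij q by linarith
            then have "1 * (4 * M) \<le> (?q + 2 * M) div 2 ^ i * (4 * M)" by (rule mult_le_mono1)
            then show ?thesis using m unfolding address_def by linarith
          qed
          have e1: "alu w Add k (Suc 0) = ?q" using q M_less by (simp add: alu_Add)
          have e2: "alu w Mul 2 M = 2 * M" "alu w Mul 4 M = 4 * M" using M_less(1) by (simp_all add: alu_Mul)
          have e3: "alu w Add ?q (2 * M) = ?q + 2 * M" "alu w Add (\<pi> ?q) (2 * M) = \<pi> ?q + 2 * M"
            using q M_less(1) by (simp_all add: alu_Add)
          have less': "(?q + 2 * M) div 2 ^ i * (4 * M) + (\<pi> ?q + 2 * M) div 2 ^ j < 2 ^ w"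
            using less unfolding address_def .
          have e4: "alu w Mul ((?q + 2 * M) div 2 ^ i) (4 * M) = (?q + 2 * M) div 2 ^ i * (4 * M)"
            by (rule alu_Mul) (use less' in linarith)
          have e5: "alu w Add ((?q + 2 * M) div 2 ^ i * (4 * M)) ((\<pi> ?q + 2 * M) div 2 ^ j) = address ?q i j"
            unfolding address_def by (rule alu_Add[OF less'])
          have r: "run w ?P 13 ?r \<mu> = \<mu>(address ?q i j := alu w Add (\<mu> (address ?q i j)) (Suc 0))"
            using g w4 by (simp add: numerals e1 e2 e3 alu_Shr e4 e5 \<mu>k del: add_Suc)
          have "q \<noteq> address ?q i j" if "q \<in> S" for q using gt that by auto
          then show "(\<forall>q\<in>S. run w ?P 13 ?r \<mu> q = \<pi> q) \<and>
             (\<forall>A. take_bit w (run w ?P 13 ?r \<mu> A) = take_bit w (\<mu> A + of_bool (A = address ?q i j)))"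
            unfolding r using \<mu> by (auto simp: alu.simps(1))
        qed
        then show "adds ?P (Suc 12) ?r (\<lambda>A. of_bool (A = address ?q i j))" by simp
      qed
      then show "adds (For 6 ?P) (Suc 11) (\<rho>(10 := k, 11 := i)) (\<lambda>A. \<Sum>j<\<rho> 6. of_bool (A = address (Suc k) i j))"
        by simp
    qed
    then show "adds (For 6 (For 6 ?P)) (Suc 10) (\<rho>(10 := k))
       (\<lambda>A. \<Sum>i<\<rho> 6. \<Sum>j<\<rho> 6. of_bool (A = address (Suc k) i j))" by simp
  qed
  then show ?thesis using g by simp
qed

text \<open>Division by \<open>4 * M\<close> recovers both node numbers from an address, and their
  ranges give the levels. A point thus counts at most once in a specified cell, and the total, at
  most \<open>n\<close>, survives reduction modulo \<open>2 ^ w\<close>.\<close>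

lemma algorithm_after_build:
  assumes gl: "glob \<rho>" and \<rho>: "\<forall>i<10. \<rho> i < 2 ^ w" and \<mu>: "\<mu> = (\<lambda>i. if i \<in> S then \<pi> i else 0)"
  shows "algorithm w n m M K \<pi> (run w build_com 10 \<rho> \<mu>)"
proof -
  have "\<forall>q\<in>S. \<mu> q = \<pi> q" using \<mu> by simp
  note built = adds_build_com[OF gl, unfolded adds_def, THEN spec, THEN mp, OF this, THEN conjunct1]
    adds_build_com[OF gl, unfolded adds_def, THEN spec, THEN mp, OF this, THEN conjunct2, THEN spec]
  have tab: "run w build_com 10 \<rho> \<mu> (u * (4 * M) + v) =
      (\<Sum>q\<in>S. of_bool ((q + 2 * M) div 2 ^ i = u \<and> (\<pi> q + 2 * M) div 2 ^ j = v))"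
    if 2: "i < m + 1" "j < m + 1" "2 ^ (m + 1 - i) \<le> u" "u < 2 ^ (m + 2 - i)"
      "2 ^ (m + 1 - j) \<le> v" "v < 2 ^ (m + 2 - j)" for i j u v
  proof -
  let ?A = "u * (4 * M) + v"
  have M2: "(2::nat) ^ (m + 2 - i) \<le> 4 * M" "(2::nat) ^ (m + 2 - j) \<le> 4 * M"
  proof -
    have "4 * M = 2 ^ (m + 2)" unfolding M by simp
    moreover have "(2::nat) ^ (m + 2 - k) \<le> 2 ^ (m + 2)" for k by (rule power_increasing) simp_all
    ultimately show "(2::nat) ^ (m + 2 - i) \<le> 4 * M" "(2::nat) ^ (m + 2 - j) \<le> 4 * M" by simp_all
  qed
  have wf: "wf_com 10 build_com 10" by (simp add: build_com_def)
  have \<mu>w: "\<forall>A. \<mu> A < 2 ^ w"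
  proof
    fix A show "\<mu> A < 2 ^ w" using S_less_M[of A] M_less \<mu> w0 by (cases "A \<in> S") auto
  qed
  have "run w build_com 10 \<rho> \<mu> ?A < 2 ^ w"
    by (rule run_less[OF w0 wf order_refl \<rho> \<mu>w])
  then have r1: "run w build_com 10 \<rho> \<mu> ?A = take_bit w (run w build_com 10 \<rho> \<mu> ?A)"
    by (rule take_bit_nat_eq_self[symmetric])
  have r2: "take_bit w (run w build_com 10 \<rho> \<mu> ?A) =
      take_bit w (\<mu> ?A + (\<Sum>k<n. \<Sum>i<m + 1. \<Sum>j<m + 1. of_bool (?A = address (Suc k) i j)))"
    by (rule built(2))
  have \<mu>0: "\<mu> ?A = 0"
  proof -
    have "(1::nat) \<le> 2 ^ (m + 1 - i)" by simp
    then have "1 * (4 * M) \<le> u * (4 * M)" using 2 by (intro mult_le_mono1) linarith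
    then have "n < ?A" using m by linarith
    then show ?thesis using \<mu> by simp
  qed
  have count: "(\<Sum>k<n. \<Sum>i<m + 1. \<Sum>j<m + 1. of_bool (?A = address (Suc k) i j)) =
    (\<Sum>q\<in>S. of_bool ((q + 2 * M) div 2 ^ i = u \<and> (\<pi> q + 2 * M) div 2 ^ j = v) :: nat)"
  proof -
  have "(\<Sum>k<n. \<Sum>i<m + 1. \<Sum>j<m + 1. of_bool (?A = address (Suc k) i j)) =
    (\<Sum>q\<in>S. \<Sum>i<m + 1. \<Sum>j<m + 1. of_bool (?A = address q i j) :: nat)"
    by (simp only: One_nat_def sum.atLeast1_atMost_eq)
  also have "\<dots> = (\<Sum>q\<in>S. of_bool ((q + 2 * M) div 2 ^ i = u \<and> (\<pi> q + 2 * M) div 2 ^ j = v))"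
  proof (intro sum.cong refl)
    fix q assume "q \<in> S"
    then have q: "q < M" "\<pi> q < M" using S_less_M by auto
    have level: "i' = i"
      if "i' < m + 1" "i < m + 1" "z < M" "(z + 2 * M) div 2 ^ i' = u" "2 ^ (m + 1 - i) \<le> u" "u < 2 ^ (m + 2 - i)"
      for i i' z u
    proof -
      have r: "2 ^ (m + 1 - i') \<le> u" "u < 2 ^ (m + 2 - i')" using node_range[of z i'] that by auto
      have "(2::nat) ^ (m + 1 - i') < 2 ^ (m + 2 - i)" "(2::nat) ^ (m + 1 - i) < 2 ^ (m + 2 - i')"
        using r that by linarith+
      then have "m + 1 - i' < m + 2 - i" "m + 1 - i < m + 2 - i'"
        by simp_all
      then show ?thesis using that(1,2) by linarith
    qed
    have v4: "v < 4 * M" using 2 M2 by linarith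
    have "(?A = address q i' j') = (((q + 2 * M) div 2 ^ i' = u \<and> (\<pi> q + 2 * M) div 2 ^ j' = v))" for i' j'
    proof
      assume *: "?A = address q i' j'"
      have W: "(\<pi> q + 2 * M) div 2 ^ j' < 4 * M" by (rule node_less[OF q(2)])
      have "?A div (4 * M) = u" "?A mod (4 * M) = v" using v4 by simp_all
      moreover have "address q i' j' div (4 * M) = (q + 2 * M) div 2 ^ i'"
        "address q i' j' mod (4 * M) = (\<pi> q + 2 * M) div 2 ^ j'"
        unfolding address_def using W by simp_all
      ultimately show "(q + 2 * M) div 2 ^ i' = u \<and> (\<pi> q + 2 * M) div 2 ^ j' = v" using * by simp
    qed (simp add: address_def)
    then have "(\<Sum>i'<m + 1. \<Sum>j'<m + 1. of_bool (?A = address q i' j') :: nat) =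
      (\<Sum>i'<m + 1. \<Sum>j'<m + 1. of_bool ((q + 2 * M) div 2 ^ i' = u) * of_bool ((\<pi> q + 2 * M) div 2 ^ j' = v))"
      by (simp only: of_bool_conj)
    also have "\<dots> = (\<Sum>i'<m + 1. of_bool ((q + 2 * M) div 2 ^ i' = u)) * (\<Sum>j'<m + 1. of_bool ((\<pi> q + 2 * M) div 2 ^ j' = v))"
      by (simp only: sum_product)
    also have "(\<Sum>i'<m + 1. of_bool ((q + 2 * M) div 2 ^ i' = u) :: nat) =
        (\<Sum>i'<m + 1. if i' = i then of_bool ((q + 2 * M) div 2 ^ i = u) else 0)"
    proof (intro sum.cong refl)
      fix k assume k: "k \<in> {..<m + 1}"
      show "of_bool ((q + 2 * M) div 2 ^ k = u) = (if k = i then of_bool ((q + 2 * M) div 2 ^ i = u) else 0 :: nat)"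
      proof (cases "k = i")
        case False
        then have "(q + 2 * M) div 2 ^ k \<noteq> u" using level[of k i "q" u] k 2 q by (metis lessThan_iff)
        with False show ?thesis by simp
      qed simp
    qed
    also have "\<dots> = of_bool ((q + 2 * M) div 2 ^ i = u)" using 2 by (subst sum.delta) auto
    also have "(\<Sum>j'<m + 1. of_bool ((\<pi> q + 2 * M) div 2 ^ j' = v) :: nat) =
        (\<Sum>j'<m + 1. if j' = j then of_bool ((\<pi> q + 2 * M) div 2 ^ j = v) else 0)"
    proof (intro sum.cong refl)
      fix k assume k: "k \<in> {..<m + 1}"
      show "of_bool ((\<pi> q + 2 * M) div 2 ^ k = v) = (if k = j then of_bool ((\<pi> q + 2 * M) div 2 ^ j = v) else 0 :: nat)"
      proof (cases "k = j")
        case False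
        then have "(\<pi> q + 2 * M) div 2 ^ k \<noteq> v" using level[of k j "\<pi> q" v] k 2 q by (metis lessThan_iff)
        with False show ?thesis by simp
      qed simp
    qed
    also have "\<dots> = of_bool ((\<pi> q + 2 * M) div 2 ^ j = v)" using 2 by (subst sum.delta) auto
    finally show "(\<Sum>i'<m + 1. \<Sum>j'<m + 1. of_bool (?A = address q i' j') :: nat) =
      of_bool ((q + 2 * M) div 2 ^ i = u \<and> (\<pi> q + 2 * M) div 2 ^ j = v)" by simp
  qed
  finally show ?thesis .
  qed
  have bound: "(\<Sum>q\<in>S. of_bool ((q + 2 * M) div 2 ^ i = u \<and> (\<pi> q + 2 * M) div 2 ^ j = v) :: nat) < 2 ^ w"
  proof -
    have "(\<Sum>q\<in>S. of_bool ((q + 2 * M) div 2 ^ i = u \<and> (\<pi> q + 2 * M) div 2 ^ j = v) :: nat) \<le> (\<Sum>q\<in>S. 1)"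
      by (intro sum_mono) simp
    also have "\<dots> < 2 ^ w" using M_less by simp
    finally show ?thesis .
  qed
  show ?thesis
    by (rule trans[OF r1], rule trans[OF r2]) (simp only: \<mu>0 count add_0 take_bit_nat_eq_self[OF bound])
  qed
  show ?thesis
    by (intro algorithm.intro algorithm_axioms.intro parameters_axioms tab) (use built(1) in blast)
qed

end

section \<open>The program\<close>

primrec eval_seq :: "nat \<Rightarrow> (nat \<Rightarrow> nat) \<Rightarrow> exp list \<Rightarrow> nat \<Rightarrow> (nat \<Rightarrow> nat) \<Rightarrow> (nat \<Rightarrow> nat)" where
  "eval_seq w \<mu> [] r \<rho> = \<rho>"
| "eval_seq w \<mu> (e # es) r \<rho> = eval_seq w \<mu> es (Suc r) (\<rho>(r := eval w \<mu> e r \<rho>))"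

text \<open>Loop counts are read from the evolving assignment, since \<open>levels_exp\<close> loops
  up to a register that the prelude itself has computed.\<close>

primrec cost_seq :: "nat \<Rightarrow> (nat \<Rightarrow> nat) \<Rightarrow> exp list \<Rightarrow> nat \<Rightarrow> (nat \<Rightarrow> nat) \<Rightarrow> nat" where
  "cost_seq w \<mu> [] r \<rho> = 0"
| "cost_seq w \<mu> (e # es) r \<rho> = cost \<rho> e + cost_seq w \<mu> es (Suc r) (\<rho>(r := eval w \<mu> e r \<rho>))"

primrec compile_seq :: "exp list \<Rightarrow> nat \<Rightarrow> nat \<Rightarrow> instr list" where
  "compile_seq [] l r = []"
| "compile_seq (e # es) l r = (let A = compile e l r in A @ compile_seq es (l + length A) (Suc r))"

primrec wf_seq :: "exp list \<Rightarrow> nat \<Rightarrow> bool" where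
  "wf_seq [] r = True"
| "wf_seq (e # es) r = (wf_exp r e r \<and> wf_seq es (Suc r))"

lemma goes_compile_seq:
  assumes w: "0 < w" and \<mu>: "\<forall>A. \<mu> A < 2 ^ w"
  shows "code_at P l (compile_seq es l r) \<Longrightarrow> wf_seq es r \<Longrightarrow> \<forall>i<r. \<rho> i < 2 ^ w \<Longrightarrow>
    goes w P (cost_seq w \<mu> es r \<rho>) l \<mu> r \<rho> (l + length (compile_seq es l r)) \<mu>
      (r + length es) (eval_seq w \<mu> es r \<rho>) \<and> (\<forall>i<r + length es. eval_seq w \<mu> es r \<rho> i < 2 ^ w)"
proof (induction es arbitrary: l r \<rho>)
  case Nil
  then show ?case by (auto simp: goes_def)
next
  case (Cons e es)
  define A where "A = compile e l r"
  define v where "v = eval w \<mu> e r \<rho>"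
  have c: "code_at P l A" "code_at P (l + length A) (compile_seq es (l + length A) (Suc r))"
    using Cons.prems(1) by (auto simp: A_def Let_def dest!: code_at_append)
  have v: "v < 2 ^ w" unfolding v_def using Cons.prems eval_less[OF w \<mu>] by auto
  have 1: "goes w P (cost \<rho> e) l \<mu> r \<rho> (l + length A) \<mu> (Suc r) (\<rho>(r := v))"
    unfolding A_def v_def by (rule goes_compile[OF w \<mu>, where r\<^sub>0 = r]) (use c Cons.prems in \<open>auto simp: A_def\<close>)
  have IH: "goes w P (cost_seq w \<mu> es (Suc r) (\<rho>(r := v))) (l + length A) \<mu> (Suc r) (\<rho>(r := v))
     (l + length A + length (compile_seq es (l + length A) (Suc r))) \<mu>
      (Suc r + length es) (eval_seq w \<mu> es (Suc r) (\<rho>(r := v))) \<and>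
      (\<forall>i<Suc r + length es. eval_seq w \<mu> es (Suc r) (\<rho>(r := v)) i < 2 ^ w)"
    by (rule Cons.IH[OF c(2)]) (use Cons.prems v in \<open>auto simp: less_Suc_eq\<close>)
  have "goes w P (cost_seq w \<mu> (e # es) r \<rho>) l \<mu> r \<rho> (l + length (compile_seq (e # es) l r)) \<mu>
      (r + length (e # es)) (eval_seq w \<mu> (e # es) r \<rho>)"
    using goes_trans[OF 1 conjunct1[OF IH]] by (simp add: Let_def A_def v_def add.assoc del: fun_upd_apply)
  moreover have "\<forall>i<r + length (e # es). eval_seq w \<mu> (e # es) r \<rho> i < 2 ^ w"
    using conjunct2[OF IH] by (simp add: v_def del: fun_upd_apply)
  ultimately show ?case by blast
qed

text \<open>Raises \<open>m\<close> while \<open>2 ^ m \<le> n + 1\<close>. An early exit is not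
  expressible, but \<open>n + 1\<close> rounds fit into linear time.\<close>

definition levels_exp :: exp where
  "levels_exp = Loop 3 (N 0) (B Add (Lt (B Shl (N 1) (V 4)) (B Add (V 3) (N 1))) (V 4))"

definition ratio_exp :: exp where
  "ratio_exp = Let (B Div (V 2) (V 1)) (Let (Lt (V 7) (V 0))
    (B Mul (B Add (sel 8 (V 7) (V 0)) (N 1)) (N 3)))"

definition prelude :: "exp list" where
  "prelude = [B Add (V 0) (N 1), levels_exp, B Shl (N 1) (V 4), B Add (V 4) (N 1), ratio_exp, B Mul (V 7) (V 6), N 2]"

lemma eval_levels_exp:
  assumes \<rho>: "\<rho> 3 = n + 1" and w: "4 * (n + 1) < 2 ^ w" and n: "1 \<le> n"
    and m_def: "m = eval w \<mu> levels_exp 4 \<rho>"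
  shows "n + 1 < 2 ^ m" "2 ^ m \<le> 2 * (n + 1)"
proof -
  define acc where "acc = rec_nat (0::nat) (\<lambda>k x. eval w \<mu>
    (B Add (Lt (B Shl (N 1) (V 4)) (B Add (V 3) (N 1))) (V 4)) 6 (\<rho>(4 := x, 5 := k)))"
  have m: "m = acc (n + 1)" unfolding m_def levels_exp_def acc_def using \<rho> by simp
  have w0: "0 < w" using w n by (cases w) auto
  have step: "acc (Suc k) = acc k + of_bool (2 ^ acc k \<le> n + 1)" if "2 ^ acc k \<le> 2 * (n + 1)" for k
  proof -
    have "(2::nat) ^ acc k < 2 ^ w" using that w by linarith
    then have l: "(1::nat) * 2 ^ acc k < 2 ^ w" "n + 1 + 1 < 2 ^ w"
      by (simp_all only: mult_1) (use w in simp)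
    have a: "alu w Shl (Suc 0) (acc k) = 2 ^ acc k" using alu_Shl[OF l(1)] by simp
    have b: "alu w Add (Suc n) (Suc 0) = Suc (Suc n)" using alu_Add[OF l(2)] by simp
    have "acc k < 2 ^ acc k" by (rule less_exp)
    then have "Suc (acc k) < 2 ^ w" using l(1) by linarith
    then have c: "alu w Add (of_bool P) (acc k) = of_bool P + acc k" for P
      by (intro alu_Add) (cases P; simp)
    show ?thesis using w0 unfolding acc_def nat.rec unfolding acc_def[symmetric]
      by (simp add: \<rho> a b c less_Suc_eq_le)
  qed
  \<comment> \<open>A round either increments the value or finds it large enough;
    \<open>n + 1\<close> rounds suffice because \<open>n + 1 < 2 ^ (n + 1)\<close>.\<close>
  have "2 ^ acc k \<le> 2 * (n + 1) \<and> (n + 1 < 2 ^ acc k \<or> acc k = k)" for k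
  proof (induction k)
    case 0
    then show ?case by (simp add: acc_def)
  next
    case (Suc k)
    then show ?case using step[of k] by (cases "2 ^ acc k \<le> n + 1") auto
  qed
  moreover have "n + 1 < 2 ^ (n + 1)" by (rule less_exp)
  ultimately show "n + 1 < 2 ^ m" "2 ^ m \<le> 2 * (n + 1)" unfolding m by metis+
qed

lemma eval_ratio_exp:
  assumes \<rho>: "\<rho> 0 = n" "\<rho> 1 = a" "\<rho> 2 = b" and w: "4 * (n + 1) < 2 ^ w" "b < 2 ^ w"
  shows "eval w \<mu> ratio_exp 7 \<rho> = 3 * (min (b div a) n + 1)"
proof -
  have w2: "1 < w"
  proof (rule ccontr)
    assume "\<not> 1 < w"
    then have "(2::nat) ^ w \<le> 2 ^ 1" by (intro power_increasing) auto
    then show False using w(1) by simp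
  qed
  let ?r = "\<rho>(7 := b div a, 8 := of_bool (b div a < n))"
  have q: "b div a < 2 ^ w" using w(2) div_le_dividend[of b a] by linarith
  have s: "eval w \<mu> (sel 8 (V 7) (V 0)) 9 ?r = min (b div a) n"
    by (subst eval_sel[of ?r 8 "b div a < n" _ _ _ _ "b div a" _ n]) (use \<rho> w w2 q in auto)
  have "(3::nat) < 2 ^ w" "3 * (min (b div a) n + 1) < 2 ^ w" using w(1) by (auto simp: min_def)
  then have "take_bit w (3::nat) = 3" "take_bit w (Suc 0) = Suc 0"
    "alu w Add (min (b div a) n) (Suc 0) = min (b div a) n + 1"
    "alu w Mul (min (b div a) n + 1) 3 = 3 * (min (b div a) n + 1)"
    using w2 by (simp_all add: take_bit_nat_eq_self alu_Add alu_Mul)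
  then show ?thesis using \<rho> s by (simp add: ratio_exp_def)
qed

section \<open>Polynomial bounds on the cost\<close>

primrec depth :: "exp \<Rightarrow> nat" where
  "depth (V i) = 0"
| "depth (N k) = 0"
| "depth (B f a b) = depth a + depth b"
| "depth (Lt a b) = depth a + depth b"
| "depth (Ld a) = depth a"
| "depth (Let a b) = depth a + depth b"
| "depth (Loop i a b) = Suc (depth a + depth b)"

primrec loop_vars :: "exp \<Rightarrow> nat set" where
  "loop_vars (V i) = {}"
| "loop_vars (N k) = {}"
| "loop_vars (B f a b) = loop_vars a \<union> loop_vars b"
| "loop_vars (Lt a b) = loop_vars a \<union> loop_vars b"
| "loop_vars (Ld a) = loop_vars a"
| "loop_vars (Let a b) = loop_vars a \<union> loop_vars b"
| "loop_vars (Loop i a b) = insert i (loop_vars a \<union> loop_vars b)"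

text \<open>Each loop multiplies the cost by at most \<open>U\<close>. Adding the depths of operands
  overestimates the nesting, but exponent and leading factor depend on the expression alone.\<close>

lemma cost_le:
  assumes "1 \<le> U"
  shows "\<forall>i\<in>loop_vars e. \<rho> i \<le> U \<Longrightarrow> cost \<rho> e \<le> cost (\<lambda>_. 1) e * U ^ depth e"
proof (induction e)
  have U: "1 \<le> U ^ k" for k using assms by simp
  have up: "x \<le> c * U ^ i \<Longrightarrow> x \<le> c * U ^ (i + j)" "x \<le> c * U ^ j \<Longrightarrow> x \<le> c * U ^ (i + j)" for x c i j
    using assms by (auto elim!: order_trans intro!: mult_le_mono2 power_increasing)
  have sum: "u + v + k \<le> (c + d + k) * U ^ (i + j)"
    if "u \<le> c * U ^ i" "v \<le> d * U ^ j" for u v k c d i j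
  proof -
    have "k \<le> k * U ^ (i + j)" using mult_le_mono2[OF U, of k] by simp
    then show ?thesis unfolding add_mult_distrib
      using up(1)[OF that(1), of j] up(2)[OF that(2), of i] by linarith
  qed
  {
    case (B f a b)
    then show ?case using sum[of "cost \<rho> a" "cost (\<lambda>_. 1) a" "depth a" "cost \<rho> b" "cost (\<lambda>_. 1) b" "depth b" 1] by simp
  next
    case (Lt a b)
    then show ?case using sum[of "cost \<rho> a" "cost (\<lambda>_. 1) a" "depth a" "cost \<rho> b" "cost (\<lambda>_. 1) b" "depth b" 3] by simp
  next
    case (Let a b)
    then show ?case using sum[of "cost \<rho> a" "cost (\<lambda>_. 1) a" "depth a" "cost \<rho> b" "cost (\<lambda>_. 1) b" "depth b" 1] by simp
  next
    case (Ld a)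
    then show ?case using sum[of "cost \<rho> a" "cost (\<lambda>_. 1) a" "depth a" 0 0 0 1] by simp
  next
    case (Loop i a b)
    have "cost \<rho> b + 0 + 5 \<le> (cost (\<lambda>_. 1) b + 0 + 5) * U ^ (depth b + 0)"
      using Loop by (intro sum) auto
    then have "\<rho> i * (cost \<rho> b + 5) \<le> U * ((cost (\<lambda>_. 1) b + 5) * U ^ depth b)"
      using Loop.prems by (intro mult_le_mono) auto
    also have "\<dots> = (cost (\<lambda>_. 1) b + 5) * U ^ Suc (depth b)" by (simp add: ac_simps)
    finally have "cost \<rho> a + \<rho> i * (cost \<rho> b + 5) + 3 \<le> (cost (\<lambda>_. 1) a + (cost (\<lambda>_. 1) b + 5) + 3) * U ^ (depth a + Suc (depth b))"
      using Loop by (intro sum) auto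
    then show ?case by (simp del: power_Suc add: algebra_simps)
  }
qed simp_all

context algorithm
begin

definition approx_count :: nat where
  "approx_count = (\<Sum>p\<in>S.
    (\<Sum>d<m. pivot_approx n K m g (\<lambda>q. q) \<pi> d p S) +
    (\<Sum>d<m. of_bool (odd (mirror M p div 2 ^ d)) *
       pivot_approx n K m g (\<lambda>q. mirror M q) (\<lambda>q. mirror M (\<pi> q)) d p S))"

text \<open>All rounding errors have the same sign, so the bounds for single pivots and levels add
  up.\<close>

lemma approx_count_bounds:
  defines "X \<equiv> card (copies_2413 n \<pi>)"
  shows "approx_count \<le> X" "K ^ 2 * X \<le> (K + 1) ^ 2 * approx_count" "n < K \<Longrightarrow> approx_count = X"
proof -
  have bd: "\<forall>q\<in>S. q < 2 ^ m \<and> \<pi> q < 2 ^ m" using S_less_M M by auto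
  have X: "X = (\<Sum>p\<in>S. (\<Sum>d<m. pivot_sum (2 ^ m) (\<lambda>q. q) \<pi> d p S) +
     (\<Sum>d<m. of_bool (odd (mirror M p div 2 ^ d)) *
       pivot_sum (2 ^ m) (\<lambda>q. mirror M q) (\<lambda>q. mirror M (\<pi> q)) d p S))"
    unfolding X_def card_copies_2413 using copy_count[OF bd] unfolding M
    by (simp only: sum.distrib)
  have nM: "n < 2 ^ m" using m M by simp
  have card: "card S \<le> n" by simp
  note b = pivot_approx_bounds[OF K(1) nM refl card]
  show "approx_count \<le> X"
    unfolding X approx_count_def by (intro sum_mono add_mono mult_le_mono order_refl b(1))
  have scale: "k * (of_bool t * u) \<le> l * (of_bool t * v)" if "k * u \<le> l * v" for t and k l u v :: nat
    using that by (cases t) simp_all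
  have scale_add: "k * (u + u') \<le> l * (v + v')" if "k * u \<le> l * v" "k * u' \<le> l * v'" for k l u v u' v' :: nat
    unfolding distrib_left by (rule add_mono[OF that])
  have scale_sum: "k * sum u T \<le> l * sum v T" if "\<And>x. x \<in> T \<Longrightarrow> k * u x \<le> l * v x"
    for k l :: nat and u v and T :: "nat set"
    unfolding sum_distrib_left by (rule sum_mono[OF that])
  show "K ^ 2 * X \<le> (K + 1) ^ 2 * approx_count"
    unfolding X approx_count_def by (intro scale_sum scale_add scale b(2))
  assume "n < K"
  then show "approx_count = X" unfolding X approx_count_def by (simp only: b(3))
qed

text \<open>Rounding down keeps the result at most the true count, hence at most
  \<open>n ^ 4 < 2 ^ w\<close>; being known modulo \<open>2 ^ w\<close>, it is known
  exactly.\<close>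

lemma eval_main_exp_eq:
  assumes "glob \<rho>"
  shows "eval w \<mu> main_exp 10 \<rho> = approx_count"
proof -
  have "approx_count < 2 ^ w"
    using approx_count_bounds(1) card_copies_2413_le[of n \<pi>] w(2) by linarith
  then show ?thesis using eval_main_exp[OF assms] unfolding approx_count_def[symmetric]
    by (simp only: take_bit_nat_eq_self)
qed

end

definition program :: program where
  "program = (let A = compile_seq prelude 0 3; C = compile_com build_com (length A) 10;
     D = compile main_exp (length A + length C) 10 in A @ C @ D @ [Op Or 0 10 10])"

lemma wf_prelude: "wf_seq prelude 3"
  by (simp add: prelude_def levels_exp_def ratio_exp_def sel_def)

lemma wf_build_com: "wf_com 10 build_com 10"
  by (simp add: build_com_def)

lemmas exp_defs = main_exp_def pivot_exp_def cell_exp_def tau_exp_def delta_exp_def rng_exp_def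
  dom_exp_def search_exp_def sel_def sum_exp_def

lemma wf_main_exp: "wf_exp 10 main_exp 10"
  by (simp add: exp_defs)

abbreviation "inner_exp \<equiv> sum_exp 12 9 (sum_exp 14 4 pivot_exp)"

text \<open>Register 0 is absent: the only loop up to \<open>n\<close> is the outermost one, so the
  cost of one pivot depends on \<open>n\<close> only through \<open>m\<close> and
  \<open>K\<close>.\<close>

lemma loop_vars_inner_exp: "loop_vars inner_exp \<subseteq> {4, 6, 8, 9}"
  by (simp add: exp_defs)

lemma program_correct:
  assumes n: "1 \<le> n" and \<pi>: "\<pi> permutes {1..n}" and ab: "0 < a" "0 < b" "a < 2 ^ w" "b < 2 ^ w"
    and w: "(n + 1) ^ 10 \<le> 2 ^ w"
  defines "K \<equiv> 3 * (min (b div a) n + 1)"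
  obtains m \<mu> t where "algorithm w n m (2 ^ m) K \<pi> \<mu>" "2 ^ m \<le> 2 * (n + 1)"
    "outputs_within w program (input_config n \<pi> a b) t (algorithm.approx_count n m (2 ^ m) K \<pi>)"
    "t \<le> n * ((cost (\<lambda>_. 1) inner_exp + 400) * (K * (m + 1)) ^ (depth inner_exp + 2))"
proof -
  define \<mu> where "\<mu> = (\<lambda>i. if i \<in> {1..n} then \<pi> i else 0)"
  define \<rho>\<^sub>0 :: "nat \<Rightarrow> nat" where "\<rho>\<^sub>0 = (\<lambda>_. 0)(0 := n, 1 := a, 2 := b)"
  define m where "m = eval w \<mu> levels_exp 4 (\<rho>\<^sub>0(3 := n + 1))"
  define M :: nat where "M = 2 ^ m"
  define N where "N = n + 1"
  have N2: "2 \<le> N" using n by (simp add: N_def)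
  \<comment> \<open>Everything that must fit into a word is bounded by a monomial in 2 and
    \<open>n + 1\<close> of total degree below 10; this is what the exponent in the word-size
    hypothesis pays for.\<close>
  have pow: "2 ^ i * N ^ j < 2 ^ w" if "i + j < 10" for i j
  proof -
    have "2 ^ i * N ^ j \<le> N ^ i * N ^ j" using N2 by (intro mult_le_mono1 power_mono) auto
    also have "\<dots> = N ^ (i + j)" by (simp add: power_add)
    also have "\<dots> < N ^ 10" using that N2 by (intro power_strict_increasing) auto
    also have "\<dots> \<le> 2 ^ w" using w by (simp add: N_def)
    finally show ?thesis .
  qed
  have w4n: "4 * (n + 1) < 2 ^ w" using pow[of 2 1] by (simp add: N_def)
  have "n + 1 < 2 ^ m" and M_le: "2 ^ m \<le> 2 * (n + 1)"
    by (rule eval_levels_exp[where \<rho> = "\<rho>\<^sub>0(3 := n + 1)" and \<mu> = \<mu>, OF _ w4n n m_def]; simp)+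
  then have nM: "n + 1 < M" "M \<le> 2 * N" by (simp_all add: M_def N_def)
  have mM: "m + 1 \<le> M" unfolding M_def by (simp add: Suc_leI less_exp)
  have K: "0 < K" "K \<le> 3 * N" by (simp_all add: K_def N_def)
  have G: "K * (m + 1) \<le> 6 * N ^ 2"
    using mult_le_mono[OF K(2) order_trans[OF mM nM(2)]] by (simp add: power2_eq_square)
  have MM: "16 * M * M < 2 ^ w"
  proof -
    have "16 * M * M \<le> 2 ^ 6 * N ^ 2" using mult_le_mono[OF nM(2) nM(2)] by (simp add: power2_eq_square)
    then show ?thesis using pow[of 6 2] by linarith
  qed
  interpret parameters w n m M K \<pi>
  proof
    show "\<pi> q \<in> {1..n}" if "q \<in> {1..n}" for q using permutes_in_image[OF \<pi>] that by blast
    show "n ^ 4 < 2 ^ w"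
    proof -
      have "n ^ 4 \<le> N ^ 4" by (intro power_mono) (simp_all add: N_def)
      also have "\<dots> < 2 ^ w" using pow[of 0 4] by simp
      finally show ?thesis .
    qed
    show "K < 2 ^ w" using K(2) pow[of 2 1] by simp
    show "K * (m + 1) < 2 ^ w" using G pow[of 3 2] by simp
  qed (use nM MM K in \<open>simp_all add: M_def\<close>)
  define \<rho> where "\<rho> = eval_seq w \<mu> prelude 3 \<rho>\<^sub>0"
  have N1: "n + 1 < 2 ^ w" and m1: "m + 1 < 2 ^ w" using w4n mM nM by (simp_all only: N_def; linarith)+
  have three: "alu w Add n (Suc 0) = n + 1" using alu_Add[OF N1] by simp
  have five: "alu w Shl (Suc 0) m = M"
  proof -
    have "1 * 2 ^ m < (2::nat) ^ w" using M_less(1) M_def by linarith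
    from alu_Shl[OF this] show ?thesis by (simp add: M_def)
  qed
  have six: "alu w Add m (Suc 0) = m + 1" using alu_Add[OF m1] by simp
  have seven: "eval w \<mu> ratio_exp 7 (\<rho>\<^sub>0(3 := n + 1, 4 := m, 5 := M, 6 := m + 1)) = K"
    unfolding K_def by (rule eval_ratio_exp) (use w4n ab in \<open>auto simp: \<rho>\<^sub>0_def\<close>)
  have eight: "alu w Mul K (m + 1) = K * (m + 1)" by (rule alu_Mul) (use G pow[of 3 2] in simp)
  have \<rho>: "\<rho> = \<rho>\<^sub>0(3 := n + 1, 4 := m, 5 := M, 6 := m + 1, 7 := K, 8 := K * (m + 1), 9 := 2)"
  proof -
    have "\<rho>\<^sub>0 0 = n" by (simp add: \<rho>\<^sub>0_def)
    moreover have "0 < w" "2 \<le> w" using w4 by simp_all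
    ultimately show ?thesis unfolding \<rho>_def prelude_def
      using three five six seven eight
      by (simp add: m_def[symmetric] numerals del: fun_upd_apply) (simp add: m_def[unfolded One_nat_def])
  qed
  have gl: "glob \<rho>" unfolding glob_def \<rho> by (simp add: \<rho>\<^sub>0_def)
  have \<rho>0: "\<forall>i<3. \<rho>\<^sub>0 i < 2 ^ w" using ab N1 by (auto simp: \<rho>\<^sub>0_def)
  have \<mu>w: "\<forall>A. \<mu> A < 2 ^ w"
  proof
    fix A show "\<mu> A < 2 ^ w" using S_less_M[of A] M_less w0 by (cases "A \<in> S") (auto simp: \<mu>_def)
  qed
  define A where "A = compile_seq prelude 0 3"
  define C where "C = compile_com build_com (length A) 10"
  define D where "D = compile main_exp (length A + length C) 10"
  have P: "program = A @ C @ D @ [Op Or 0 10 10]" by (simp add: program_def A_def C_def D_def Let_def)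
  have c0: "code_at program 0 (A @ C @ D @ [Op Or 0 10 10])" unfolding P code_at_def by force
  have c1: "code_at program 0 A" and c2: "code_at program (length A) C"
    and c3: "code_at program (length A + length C) D"
    and c4: "code_at program (length A + length C + length D) [Op Or 0 10 10]"
  proof -
    note s = code_at_append[OF c0]
    then show "code_at program 0 A" by blast
    note s = code_at_append[OF conjunct2[OF s, simplified]]
    then show "code_at program (length A) C" by blast
    note s = code_at_append[OF conjunct2[OF s]]
    then show "code_at program (length A + length C) D" by blast
    show "code_at program (length A + length C + length D) [Op Or 0 10 10]" using s by blast
  qed
  have len: "length prelude = 7" by (simp add: prelude_def)
  have g1: "goes w program (cost_seq w \<mu> prelude 3 \<rho>\<^sub>0) 0 \<mu> 3 \<rho>\<^sub>0 (length A) \<mu> 10 \<rho>" and \<rho>w: "\<forall>i<10. \<rho> i < 2 ^ w"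
    using goes_compile_seq[OF w0 \<mu>w c1[unfolded A_def] wf_prelude \<rho>0] unfolding A_def \<rho>_def len by simp_all
  define \<mu>' where "\<mu>' = run w build_com 10 \<rho> \<mu>"
  have g2: "goes w program (cost_com \<rho> build_com) (length A) \<mu> 10 \<rho> (length A + length C) \<mu>' 10 \<rho>"
    unfolding C_def \<mu>'_def
    by (rule goes_compile_com[OF w0 _ wf_build_com]) (use c2 \<rho>w \<mu>w in \<open>auto simp: C_def\<close>)
  have \<mu>'w: "\<forall>A. \<mu>' A < 2 ^ w" unfolding \<mu>'_def
    using run_less[OF w0 wf_build_com order_refl \<rho>w \<mu>w] by blast
  have g3: "goes w program (cost \<rho> main_exp) (length A + length C) \<mu>' 10 \<rho> (length A + length C + length D) \<mu>' 11
      (\<rho>(10 := eval w \<mu>' main_exp 10 \<rho>))"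
    using goes_compile[OF w0 \<mu>'w c3[unfolded D_def] wf_main_exp order_refl \<rho>w, of \<rho>] by (simp add: D_def del: fun_upd_apply)
  have alg: "algorithm w n m M K \<pi> \<mu>'"
    unfolding \<mu>'_def by (rule algorithm_after_build[OF gl \<rho>w \<mu>_def])
  define v where "v = algorithm.approx_count n m M K \<pi>"
  have ev: "eval w \<mu>' main_exp 10 \<rho> = v"
    unfolding v_def by (rule algorithm.eval_main_exp_eq[OF alg gl])
  have g4: "goes w program 1 (length A + length C + length D) \<mu>' 11 (\<rho>(10 := v)) (length program) \<mu>' 1 (\<lambda>_. v)"
    by (rule goes_instr[OF c4]) (auto simp: holds_def P)
  define T where "T = cost_seq w \<mu> prelude 3 \<rho>\<^sub>0 + cost_com \<rho> build_com + cost \<rho> main_exp + 1"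
  have "goes w program T 0 \<mu> 3 \<rho>\<^sub>0 (length program) \<mu>' 1 (\<lambda>_. v)"
    unfolding T_def using goes_trans[OF goes_trans[OF goes_trans[OF g1 g2] g3[unfolded ev]] g4] .
  moreover have "holds 0 \<mu> 3 \<rho>\<^sub>0 (input_config n \<pi> a b)"
    by (simp add: holds_def input_config_def \<mu>_def \<rho>\<^sub>0_def)
  ultimately obtain t where t: "t \<le> T" "holds (length program) \<mu>' 1 (\<lambda>_. v) ((step w program ^^ t) (input_config n \<pi> a b))"
    unfolding goes_def by blast
  then have out: "outputs_within w program (input_config n \<pi> a b) t v"
    by (simp add: outputs_within_def halted_def holds_def)
  \<comment> \<open>A common bound for the loop counts of \<open>inner_exp\<close>, which are
    \<open>m\<close>, \<open>m + 1\<close>, \<open>K * (m + 1)\<close> and 2.\<close>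
  define U where "U = K * (m + 1)"
  have U: "1 \<le> U" "m \<le> U" "m + 1 \<le> U" "2 \<le> U"
  proof -
    have "3 \<le> K" by (simp add: K_def)
    then have "3 * (m + 1) \<le> U" unfolding U_def by (rule mult_le_mono1)
    then show "1 \<le> U" "m \<le> U" "m + 1 \<le> U" "2 \<le> U" by simp_all
  qed
  define c where "c = cost (\<lambda>_. 1) inner_exp"
  define k where "k = depth inner_exp"
  have "cost \<rho> inner_exp \<le> c * U ^ k" unfolding c_def k_def
    by (rule cost_le[OF U(1)]) (use loop_vars_inner_exp U in \<open>auto simp: \<rho> U_def\<close>)
  also have "\<dots> \<le> c * U ^ (k + 2)" using U(1) by (intro mult_le_mono2 power_increasing) auto
  finally have inner: "cost \<rho> inner_exp \<le> c * U ^ (k + 2)" .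
  have U2: "U ^ 2 \<le> U ^ (k + 2)" "1 \<le> U ^ (k + 2)" 
    by (rule power_increasing; use U(1) in simp) (use U(1) in \<open>rule one_le_power\<close>)
  have \<rho>n: "\<rho> 0 = n" "\<rho> 6 = m + 1" by (simp_all add: \<rho> \<rho>\<^sub>0_def)
  \<comment> \<open>The exponent \<open>k + 2\<close> covers both the \<open>U ^ 2\<close> of the
    table and the \<open>U ^ k\<close> of a pivot; 400 generously absorbs the constants and the
    linear prelude.\<close>
  have "T \<le> n * ((c + 400) * U ^ (k + 2))"
  proof -
    have "cost_seq w \<mu> prelude 3 \<rho>\<^sub>0 \<le> 100 * n"
      using n w0 by (simp add: prelude_def levels_exp_def ratio_exp_def sel_def three \<rho>\<^sub>0_def)
    moreover have "cost_com \<rho> build_com \<le> n * (50 * U ^ 2)"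
    proof -
      have "7 + (m + 1) * 33 \<le> 40 * U" using U by simp
      then have "(m + 1) * (7 + (m + 1) * 33) \<le> U * (40 * U)" using U(3) by (rule mult_le_mono[rotated])
      moreover have "1 \<le> U ^ 2" using U(1) by (rule one_le_power)
      ultimately have "7 + (m + 1) * (7 + (m + 1) * 33) \<le> 47 * U ^ 2" unfolding power2_eq_square by linarith
      then have "n * (7 + (m + 1) * (7 + (m + 1) * 33)) \<le> n * (47 * U ^ 2)" by (rule mult_le_mono2)
      moreover have "3 \<le> n * (3 * U ^ 2)" using mult_le_mono[OF n, of 3 "3 * U ^ 2"] \<open>1 \<le> U ^ 2\<close> by simp
      moreover have "cost_com \<rho> build_com = 3 + n * (7 + (m + 1) * (7 + (m + 1) * 33))"
        by (simp add: build_com_def \<rho>n)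
      ultimately show ?thesis by (simp add: algebra_simps)
    qed
    moreover have "cost \<rho> main_exp \<le> n * (cost \<rho> inner_exp + 11)"
    proof -
      have "cost \<rho> main_exp = 4 + n * (7 + cost \<rho> inner_exp)"
        by (simp add: main_exp_def sum_exp_def[of 10] \<rho>n)
      then show ?thesis using n by (simp add: algebra_simps)
    qed
    moreover have "n * (50 * U ^ 2) \<le> n * (50 * U ^ (k + 2))" "n * (cost \<rho> inner_exp + 11) \<le> n * (c * U ^ (k + 2) + 11)"
      using U2(1) inner by (intro mult_le_mono2; simp only: add_le_cancel_right mult_le_mono2)+
    moreover have "n \<le> n * U ^ (k + 2)" using mult_le_mono2[OF U2(2), of n] by simp
    ultimately have "T \<le> 100 * (n * U ^ (k + 2)) + n * (50 * U ^ (k + 2)) + n * (c * U ^ (k + 2) + 11) + n * U ^ (k + 2)"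
      using n unfolding T_def by linarith
    also have "\<dots> \<le> n * ((c + 400) * U ^ (k + 2))"
    proof -
      have "n * (c * W + 11) = n * (c * W) + 11 * n" "n * ((c + 400) * W) = n * (c * W) + 400 * (n * W)"
        "n * (50 * W) = 50 * (n * W)" for W by (simp_all add: algebra_simps)
      note eqs = this[of "U ^ (k + 2)"]
      show ?thesis unfolding eqs using \<open>n \<le> n * U ^ (k + 2)\<close> by linarith
    qed
    finally show ?thesis .
  qed
  then have "t \<le> n * ((c + 400) * U ^ (k + 2))" using t(1) by linarith
  then show ?thesis using that[of m \<mu>' t] alg out M_le unfolding v_def M_def U_def c_def k_def by blast
qed

theorem theorem4p1:
  "\<exists>(P :: program) (c :: nat) (Q :: real poly poly).
     \<forall>(n :: nat) (\<pi> :: nat \<Rightarrow> nat) (a :: nat) (b :: nat) (\<epsilon> :: real) (w :: nat).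
       1 \<le> n \<and> \<pi> permutes {1..n} \<and>
       0 < a \<and> 0 < b \<and> a < 2 ^ w \<and> b < 2 ^ w \<and> \<epsilon> = real a / real b \<and>
       real c * log 2 (real n + 1) \<le> real w \<longrightarrow>
       (\<exists>t v. outputs_within w P (input_config n \<pi> a b) t v \<and>
              approximates_within_factor (1 + \<epsilon>) (real v) (real (card (copies_2413 n \<pi>))) \<and>
              real t \<le> real n * poly (poly Q [:log 2 (real n):]) (1 / \<epsilon>))"
proof -
  define C where "C = cost (\<lambda>_. 1) inner_exp + 400"
  define k where "k = depth inner_exp + 2"
  \<comment> \<open>The outer variable stands for the logarithm, the inner one for
    \<open>1 / \<epsilon>\<close>; the factors \<open>3 + 3 * y\<close> and \<open>3 + l\<close>
    bound \<open>K\<close> and \<open>m + 1\<close>.\<close>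
  define Q :: "real poly poly" where "Q = [:[:real C:]:] * ([:[:3, 3:]:] * [:[:3:], 1:]) ^ k"
  have Q: "poly (poly Q [:l:]) y = real C * ((3 + 3 * y) * (3 + l)) ^ k" for l y
    by (simp add: Q_def algebra_simps)
  show ?thesis
  proof (rule exI[of _ program], rule exI[of _ 10], rule exI[of _ Q], intro allI impI, elim conjE)
    fix n \<pi> a b w and \<epsilon> :: real
    assume n: "1 \<le> n" and \<pi>: "\<pi> permutes {1..n}"
      and ab: "0 < a" "0 < b" "a < 2 ^ w" "b < 2 ^ w" and \<epsilon>: "\<epsilon> = real a / real b"
      and w: "real 10 * log 2 (real n + 1) \<le> real w"
    have "(n + 1) ^ 10 \<le> 2 ^ w"
    proof -
      have "real ((n + 1) ^ 10) = 2 powr (10 * log 2 (real n + 1))"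
        by (simp add: powr_mult_base powr_powr[symmetric] mult.commute[of 10] powr_realpow[of "real n + 1" 10, symmetric] add.commute)
      also have "\<dots> \<le> 2 powr real w" using w by simp
      also have "\<dots> = real (2 ^ w)" by (simp add: powr_realpow)
      finally show ?thesis by (simp only: of_nat_le_iff)
    qed
    define K where "K = 3 * (min (b div a) n + 1)"
    obtain m \<mu> t where alg: "algorithm w n m (2 ^ m) K \<pi> \<mu>" and m: "2 ^ m \<le> 2 * (n + 1)"
      and out: "outputs_within w program (input_config n \<pi> a b) t (algorithm.approx_count n m (2 ^ m) K \<pi>)"
      and t: "t \<le> n * (C * (K * (m + 1)) ^ k)"
      using program_correct[OF n \<pi> ab \<open>(n + 1) ^ 10 \<le> 2 ^ w\<close>] unfolding K_def C_def k_def by blast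
    define v where "v = algorithm.approx_count n m (2 ^ m) K \<pi>"
    define X where "X = card (copies_2413 n \<pi>)"
    have v: "v \<le> X" "K ^ 2 * X \<le> (K + 1) ^ 2 * v" "n < K \<Longrightarrow> v = X"
      using algorithm.approx_count_bounds[OF alg] unfolding v_def X_def by blast+
    have \<epsilon>0: "0 < \<epsilon>" using ab \<epsilon> by simp
    have "real X \<le> (1 + \<epsilon>) * real v"
    \<comment> \<open>The first case includes the capped \<open>K\<close> and is exact; in the
      second, \<open>K\<close> is determined by \<open>b div a\<close>.\<close>
    proof (cases "n < K")
      case True
      then show ?thesis using v(3) \<epsilon>0 by (simp add: distrib_right)
    next
      case False
      then have "min (b div a) n = b div a" by (auto simp: K_def min_def split: if_splits)
      then have K: "K = 3 * (b div a + 1)" by (simp add: K_def)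
      define \<delta> where "\<delta> = 1 / real K"
      have "b < a * (b div a + 1)" using dividend_less_times_div[OF ab(1)] by simp
      then have "real b < real (a * (b div a + 1))" by (simp only: of_nat_less_iff)
      then have "real b < real a * (real (b div a) + 1)" by (simp only: of_nat_mult of_nat_add of_nat_1)
      then have "3 * \<delta> \<le> \<epsilon>" unfolding \<delta>_def K \<epsilon> using ab by (simp add: field_simps)
      moreover have "0 \<le> \<delta>" "\<delta> \<le> 1" unfolding \<delta>_def K by simp_all
      then have "\<delta> ^ 2 \<le> \<delta>" by (simp add: power2_eq_square mult_left_le)
      \<comment> \<open>\<open>2 * \<delta> + \<delta> ^ 2 \<le> 3 * \<delta> \<le>
        \<epsilon>\<close>, the origin of the 3 in \<open>K\<close>.\<close>
      ultimately have "(1 + \<delta>) ^ 2 \<le> 1 + \<epsilon>" by (simp add: power2_sum)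
      have "real (K ^ 2 * X) \<le> real ((K + 1) ^ 2 * v)" using v(2) by (simp only: of_nat_le_iff)
      then have "real K ^ 2 * real X \<le> (real K + 1) ^ 2 * real v"
        by (simp only: of_nat_mult of_nat_add of_nat_1 of_nat_power)
      also have "real K + 1 = real K * (1 + \<delta>)"
        using K by (simp only: \<delta>_def distrib_left) simp
      also have "(real K * (1 + \<delta>)) ^ 2 = real K ^ 2 * (1 + \<delta>) ^ 2" by (rule power_mult_distrib)
      finally have "real X \<le> (1 + \<delta>) ^ 2 * real v" by (simp add: K mult.assoc)
      also have "\<dots> \<le> (1 + \<epsilon>) * real v" using \<open>(1 + \<delta>) ^ 2 \<le> 1 + \<epsilon>\<close> by (intro mult_right_mono) auto
      finally show ?thesis .
    qed
    moreover have "real v \<le> (1 + \<epsilon>) * real X"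
      using v(1) \<epsilon>0 by (simp add: distrib_right add_increasing2)
    moreover have "real t \<le> real n * poly (poly Q [:log 2 (real n):]) (1 / \<epsilon>)"
    proof -
      have "real (b div a) \<le> real b / real a" by (rule of_nat_div_le_of_nat)
      then have "real K \<le> 3 + 3 * (1 / \<epsilon>)" unfolding K_def \<epsilon> by simp
      moreover have "real (m + 1) \<le> 3 + log 2 (real n)"
      proof -
        have "real m = log 2 (2 ^ m)" by simp
        also have "\<dots> \<le> log 2 (4 * real n)"
        proof (rule log_mono)
          have "(2::nat) ^ m \<le> 4 * n" using m n by simp
          then have "real (2 ^ m) \<le> real (4 * n)" by (simp only: of_nat_le_iff)
          then show "(2::real) ^ m \<le> 4 * real n" by simp
        qed simp_all
        also have "\<dots> = 2 + log 2 (real n)"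
          using n log_pow_cancel[of "2::real" 2] by (simp add: log_mult)
        finally show ?thesis by simp
      qed
      ultimately have "real K * real (m + 1) \<le> (3 + 3 * (1 / \<epsilon>)) * (3 + log 2 (real n))"
        using \<epsilon>0 by (intro mult_mono) auto
      then have "(real K * real (m + 1)) ^ k \<le> ((3 + 3 * (1 / \<epsilon>)) * (3 + log 2 (real n))) ^ k"
        by (rule power_mono) simp
      then have "real n * (real C * (real K * real (m + 1)) ^ k) \<le> real n * poly (poly Q [:log 2 (real n):]) (1 / \<epsilon>)"
        unfolding Q by (intro mult_left_mono) auto
      moreover have "real t \<le> real n * (real C * (real K * real (m + 1)) ^ k)"
        using of_nat_mono[OF t, where 'a = real] by (simp only: of_nat_mult of_nat_power)
      ultimately show ?thesis by linarith
    qed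
    ultimately show "\<exists>t v. outputs_within w program (input_config n \<pi> a b) t v \<and>
              approximates_within_factor (1 + \<epsilon>) (real v) (real (card (copies_2413 n \<pi>))) \<and>
              real t \<le> real n * poly (poly Q [:log 2 (real n):]) (1 / \<epsilon>)"
      using out unfolding approximates_within_factor_def v_def X_def by blast
  qed
qed

end
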